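(* Let $\Lambda$ be an Artinian algebra and let $M$ be a finitely generated left $\Lambda$-module which is faithful and indecomposable. If $\operatorname{Tr} M$ is torsionless (equivalently, $\operatorname{Ext}^1_\Lambda(M,\Lambda)=0$) and $\operatorname{Ext}^1_{\Lambda^{op}}(\operatorname{Tr} M,\operatorname{Tr} M)=0$, then $M$ is projective.
   Context: An Artinian algebra (Artin algebra) is a ring $\Lambda$ whose center $R$ is a commutative Artinian ring and which is finitely generated as an $R$-module. A module $M$ is faithful if its annihilator in $\Lambda$ is zero. Write $(-)^*=\operatorname{Hom}(-,\Lambda)$, which takes left $\Lambda$-modules to left $\Lambda^{op}$-modules and vice versa. Given a minimal projective presentation $P_1\xrightarrow{f}P_0\to M\to 0$ of a finitely generated left $\Lambda$-module $M$, the transpose of $M$ is the left $\Lambda^{op}$-module $\operatorname{Tr} M=\operatorname{Coker}(f^*:P_0^*\to P_1^* )$. A finitely generated module $X$ (over $\Lambda$ or $\Lambda^{op}$) is torsionless if the canonical evaluation homomorphism $\sigma_X:X\to X^{**}$, $\sigma_X(x)(g)=g(x)$, is a monomorphism. *)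

theory Defs
  imports "HOL-Algebra.Module" "HOL-Algebra.Ideal" "HOL-Algebra.Elementary_Groups"
begin

section \<open>Modules over a noncommutative ring\<close>

text \<open>The locale \<^locale>\<open>module\<close> of the library is restricted to commutative rings. We reuse its
  record type, its notation and its notion of \<^locale>\<open>submodule\<close> (which does not mention
  commutativity). The fields \<^const>\<open>mult\<close> and \<^const>\<open>one\<close> of a module record are never used.\<close>

locale left_module = R?: ring R + M?: abelian_group M
  for R :: "('a, 'r) ring_scheme" (structure) and M :: "('a, 'b, 'm) module_scheme" (structure) +
  assumes smult_closed [simp, intro]:
      "\<lbrakk>a \<in> carrier R; x \<in> carrier M\<rbrakk> \<Longrightarrow> a \<odot>\<^bsub>M\<^esub> x \<in> carrier M"
    and smult_l_distr:
      "\<lbrakk>a \<in> carrier R; b \<in> carrier R; x \<in> carrier M\<rbrakk> \<Longrightarrow>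
        (a \<oplus> b) \<odot>\<^bsub>M\<^esub> x = a \<odot>\<^bsub>M\<^esub> x \<oplus>\<^bsub>M\<^esub> b \<odot>\<^bsub>M\<^esub> x"
    and smult_r_distr:
      "\<lbrakk>a \<in> carrier R; x \<in> carrier M; y \<in> carrier M\<rbrakk> \<Longrightarrow>
        a \<odot>\<^bsub>M\<^esub> (x \<oplus>\<^bsub>M\<^esub> y) = a \<odot>\<^bsub>M\<^esub> x \<oplus>\<^bsub>M\<^esub> a \<odot>\<^bsub>M\<^esub> y"
    and smult_assoc1:
      "\<lbrakk>a \<in> carrier R; b \<in> carrier R; x \<in> carrier M\<rbrakk> \<Longrightarrow>
        (a \<otimes> b) \<odot>\<^bsub>M\<^esub> x = a \<odot>\<^bsub>M\<^esub> (b \<odot>\<^bsub>M\<^esub> x)"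
    and smult_one [simp]:
      "x \<in> carrier M \<Longrightarrow> \<one> \<odot>\<^bsub>M\<^esub> x = x"

definition opp_ring :: "('a, 'r) ring_scheme \<Rightarrow> ('a, 'r) ring_scheme" where
  "opp_ring R = R\<lparr>mult := \<lambda>x y. y \<otimes>\<^bsub>R\<^esub> x\<rparr>"

definition regular_module :: "('a, 'r) ring_scheme \<Rightarrow> ('a, 'a) module" where
  "regular_module R = \<lparr>carrier = carrier R, mult = mult R, one = \<one>\<^bsub>R\<^esub>,
     zero = \<zero>\<^bsub>R\<^esub>, add = add R, smult = mult R\<rparr>"

definition quot_module :: "('a, 'b) module \<Rightarrow> 'b set \<Rightarrow> ('a, 'b set) module" where
  "quot_module M N = \<lparr>carrier = a_rcosets\<^bsub>M\<^esub> N, mult = undefined, one = undefined,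
     zero = N, add = set_add M, smult = (\<lambda>a C. \<Union>x\<in>C. N +>\<^bsub>M\<^esub> (a \<odot>\<^bsub>M\<^esub> x))\<rparr>"

definition finitely_generated :: "('a, 'r) ring_scheme \<Rightarrow> ('a, 'b) module \<Rightarrow> bool" where
  "finitely_generated R M \<longleftrightarrow> (\<exists>S. finite S \<and> S \<subseteq> carrier M \<and>
     (\<forall>N. submodule N R M \<and> S \<subseteq> N \<longrightarrow> N = carrier M))"

definition faithful :: "('a, 'r) ring_scheme \<Rightarrow> ('a, 'b) module \<Rightarrow> bool" where
  "faithful R M \<longleftrightarrow>
     {a \<in> carrier R. \<forall>x\<in>carrier M. a \<odot>\<^bsub>M\<^esub> x = \<zero>\<^bsub>M\<^esub>} = {\<zero>\<^bsub>R\<^esub>}"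

definition indecomposable :: "('a, 'r) ring_scheme \<Rightarrow> ('a, 'b) module \<Rightarrow> bool" where
  "indecomposable R M \<longleftrightarrow> carrier M \<noteq> {\<zero>\<^bsub>M\<^esub>} \<and>
     (\<forall>N N'. submodule N R M \<and> submodule N' R M \<and>
        N <+>\<^bsub>M\<^esub> N' = carrier M \<and> N \<inter> N' = {\<zero>\<^bsub>M\<^esub>} \<longrightarrow>
        N = {\<zero>\<^bsub>M\<^esub>} \<or> N' = {\<zero>\<^bsub>M\<^esub>})"


section \<open>Artin algebras\<close>

definition center :: "('a, 'r) ring_scheme \<Rightarrow> ('a, 'r) ring_scheme" where
  "center R = R\<lparr>carrier := {z \<in> carrier R. \<forall>x\<in>carrier R. z \<otimes>\<^bsub>R\<^esub> x = x \<otimes>\<^bsub>R\<^esub> z}\<rparr>"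

definition artinian_cring :: "('a, 'r) ring_scheme \<Rightarrow> bool" where
  "artinian_cring R \<longleftrightarrow> cring R \<and>
     (\<forall>I :: nat \<Rightarrow> 'a set. (\<forall>n. ideal (I n) R \<and> I (Suc n) \<subseteq> I n) \<longrightarrow>
        (\<exists>n. \<forall>m\<ge>n. I m = I n))"

definition artin_algebra :: "('a, 'r) ring_scheme \<Rightarrow> bool" where
  "artin_algebra R \<longleftrightarrow> ring R \<and> artinian_cring (center R) \<and>
     finitely_generated (center R) (regular_module R)"


section \<open>Homomorphisms and duals\<close>

text \<open>Homomorphisms are extensional functions, so that equality in Hom is equality of
  homomorphisms.\<close>

definition mod_hom ::
    "('a, 'r) ring_scheme \<Rightarrow> ('a, 'b) module \<Rightarrow> ('a, 'c) module \<Rightarrow> ('b \<Rightarrow> 'c) set" where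
  "mod_hom R M N = {h \<in> carrier M \<rightarrow>\<^sub>E carrier N.
     (\<forall>x\<in>carrier M. \<forall>y\<in>carrier M. h (x \<oplus>\<^bsub>M\<^esub> y) = h x \<oplus>\<^bsub>N\<^esub> h y) \<and>
     (\<forall>a\<in>carrier R. \<forall>x\<in>carrier M. h (a \<odot>\<^bsub>M\<^esub> x) = a \<odot>\<^bsub>N\<^esub> h x)}"

definition hom_group ::
    "('a, 'r) ring_scheme \<Rightarrow> ('a, 'b) module \<Rightarrow> ('a, 'c) module \<Rightarrow> ('b \<Rightarrow> 'c) monoid" where
  "hom_group R M N = \<lparr>carrier = mod_hom R M N,
     mult = (\<lambda>g h. \<lambda>x\<in>carrier M. g x \<oplus>\<^bsub>N\<^esub> h x),
     one = (\<lambda>x\<in>carrier M. \<zero>\<^bsub>N\<^esub>)\<rparr>"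

text \<open>\<open>dual R M\<close> is Hom(M, R) for a left R-module M. It is a left module over \<open>opp_ring R\<close>;
  as \<open>opp_ring (opp_ring R) = R\<close>, the bidual \<open>dual (opp_ring R) (dual R M)\<close> is again a left
  R-module.\<close>

definition dual :: "('a, 'r) ring_scheme \<Rightarrow> ('a, 'b) module \<Rightarrow> ('a, 'b \<Rightarrow> 'a) module" where
  "dual R M = \<lparr>carrier = mod_hom R M (regular_module R), mult = undefined, one = undefined,
     zero = (\<lambda>x\<in>carrier M. \<zero>\<^bsub>R\<^esub>),
     add = (\<lambda>g h. \<lambda>x\<in>carrier M. g x \<oplus>\<^bsub>R\<^esub> h x),
     smult = (\<lambda>a g. \<lambda>x\<in>carrier M. g x \<otimes>\<^bsub>R\<^esub> a)\<rparr>"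

definition eval_map ::
    "('a, 'r) ring_scheme \<Rightarrow> ('a, 'b) module \<Rightarrow> 'b \<Rightarrow> ('b \<Rightarrow> 'a) \<Rightarrow> 'a" where
  "eval_map R X = (\<lambda>x\<in>carrier X. \<lambda>g\<in>carrier (dual R X). g x)"

definition torsionless :: "('a, 'r) ring_scheme \<Rightarrow> ('a, 'b) module \<Rightarrow> bool" where
  "torsionless R X \<longleftrightarrow> inj_on (eval_map R X) (carrier X)"


section \<open>Projective modules and the transpose\<close>

text \<open>A definition cannot quantify over all types, so the lifting property is required only for
  epimorphisms between modules on the types \<open>'b \<Rightarrow> 'a\<close> and \<open>'b\<close>. This is no restriction:
  the canonical epimorphism from the free module on the underlying set of P onto P lives there, and
  a section of it gives lifts along arbitrary epimorphisms; see \<open>projective_lift\<close> below.\<close>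

definition projective :: "('a, 'r) ring_scheme \<Rightarrow> ('a, 'b) module \<Rightarrow> bool" where
  "projective R P \<longleftrightarrow> left_module R P \<and>
     (\<forall>(N :: ('a, 'b \<Rightarrow> 'a) module) (N' :: ('a, 'b) module) g h.
        left_module R N \<and> left_module R N' \<and> g \<in> mod_hom R N N' \<and>
        g ` carrier N = carrier N' \<and> h \<in> mod_hom R P N' \<longrightarrow>
        (\<exists>k\<in>mod_hom R P N. \<forall>x\<in>carrier P. g (k x) = h x))"

definition projective_cover ::
    "('a, 'r) ring_scheme \<Rightarrow> ('a, 'b) module \<Rightarrow> ('b \<Rightarrow> 'c) \<Rightarrow> ('a, 'c) module \<Rightarrow> bool" where
  "projective_cover R P f N \<longleftrightarrow> projective R P \<and> f \<in> mod_hom R P N \<and>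
     f ` carrier P = carrier N \<and>
     (\<forall>L. submodule L R P \<and> f ` L = carrier N \<longrightarrow> L = carrier P)"

definition minimal_projective_presentation ::
    "('a, 'r) ring_scheme \<Rightarrow> ('a, 'd) module \<Rightarrow> ('d \<Rightarrow> 'c) \<Rightarrow> ('a, 'c) module \<Rightarrow> ('c \<Rightarrow> 'b) \<Rightarrow>
     ('a, 'b) module \<Rightarrow> bool" where
  "minimal_projective_presentation R P1 f P0 p M \<longleftrightarrow>
     finitely_generated R P1 \<and> finitely_generated R P0 \<and>
     projective_cover R P0 p M \<and>
     projective_cover R P1 f (P0\<lparr>carrier := a_kernel P0 M p\<rparr>)"

definition transpose_module ::
    "('a, 'r) ring_scheme \<Rightarrow> ('a, 'd) module \<Rightarrow> ('d \<Rightarrow> 'c) \<Rightarrow> ('a, 'c) module \<Rightarrow>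
     ('a, ('d \<Rightarrow> 'a) set) module" where
  "transpose_module R P1 f P0 =
     quot_module (dual R P1) ((\<lambda>g. compose (carrier P1) g f) ` carrier (dual R P0))"


section \<open>The first Ext group\<close>

text \<open>\<open>free_module R S\<close> is the free module on S, realised as finitely supported functions on S.
  \<open>free_cover R X\<close> is the canonical epimorphism onto X from the free module on the underlying set
  of X, and \<open>syzygy R X\<close> is its kernel.\<close>

definition free_module :: "('a, 'r) ring_scheme \<Rightarrow> 'b set \<Rightarrow> ('a, 'b \<Rightarrow> 'a) module" where
  "free_module R S = \<lparr>carrier = {u \<in> S \<rightarrow>\<^sub>E carrier R. finite {x \<in> S. u x \<noteq> \<zero>\<^bsub>R\<^esub>}},
     mult = undefined, one = undefined,
     zero = (\<lambda>x\<in>S. \<zero>\<^bsub>R\<^esub>),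
     add = (\<lambda>u v. \<lambda>x\<in>S. u x \<oplus>\<^bsub>R\<^esub> v x),
     smult = (\<lambda>a u. \<lambda>x\<in>S. a \<otimes>\<^bsub>R\<^esub> u x)\<rparr>"

definition free_cover :: "('a, 'r) ring_scheme \<Rightarrow> ('a, 'b) module \<Rightarrow> ('b \<Rightarrow> 'a) \<Rightarrow> 'b" where
  "free_cover R X = (\<lambda>u\<in>carrier (free_module R (carrier X)).
     \<Oplus>\<^bsub>X\<^esub>x\<in>{x \<in> carrier X. u x \<noteq> \<zero>\<^bsub>R\<^esub>}. u x \<odot>\<^bsub>X\<^esub> x)"

definition syzygy :: "('a, 'r) ring_scheme \<Rightarrow> ('a, 'b) module \<Rightarrow> ('a, 'b \<Rightarrow> 'a) module" where
  "syzygy R X = (let F = free_module R (carrier X) in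
     F\<lparr>carrier := a_kernel F X (free_cover R X)\<rparr>)"

text \<open>The canonical free resolution of X begins with
  \<open>F2 \<longrightarrow> F1 \<longrightarrow> F0 \<longrightarrow> X\<close>, where each differential is the free cover of
  the kernel of the previous map. Ext1(X, Y) is the cohomology at Hom(F1, Y) of the complex
  \<open>Hom(F0, Y) \<longrightarrow> Hom(F1, Y) \<longrightarrow> Hom(F2, Y)\<close>.\<close>

definition Ext1 :: "('a, 'r) ring_scheme \<Rightarrow> ('a, 'b) module \<Rightarrow> ('a, 'c) module \<Rightarrow>
    ((('b \<Rightarrow> 'a) \<Rightarrow> 'a) \<Rightarrow> 'c) set monoid" where
  "Ext1 R X Y =
    (let K = syzygy R X; L = syzygy R K;
         F0 = free_module R (carrier X); F1 = free_module R (carrier K);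
         F2 = free_module R (carrier L);
         d1 = free_cover R K; d2 = free_cover R L;
         Z = kernel (hom_group R F1 Y) (hom_group R F2 Y) (\<lambda>h. compose (carrier F2) h d2);
         B = (\<lambda>h. compose (carrier F1) h d1) ` mod_hom R F0 Y
     in (hom_group R F1 Y)\<lparr>carrier := Z\<rparr> Mod B)"


section \<open>Basic facts\<close>


lemma left_moduleI:
  assumes "ring R" "abelian_group M"
    "\<And>a x. a \<in> carrier R \<Longrightarrow> x \<in> carrier M \<Longrightarrow> a \<odot>\<^bsub>M\<^esub> x \<in> carrier M"
    "\<And>a b x. a \<in> carrier R \<Longrightarrow> b \<in> carrier R \<Longrightarrow> x \<in> carrier M \<Longrightarrow>
        (a \<oplus>\<^bsub>R\<^esub> b) \<odot>\<^bsub>M\<^esub> x = a \<odot>\<^bsub>M\<^esub> x \<oplus>\<^bsub>M\<^esub> b \<odot>\<^bsub>M\<^esub> x"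
    "\<And>a x y. a \<in> carrier R \<Longrightarrow> x \<in> carrier M \<Longrightarrow> y \<in> carrier M \<Longrightarrow>
        a \<odot>\<^bsub>M\<^esub> (x \<oplus>\<^bsub>M\<^esub> y) = a \<odot>\<^bsub>M\<^esub> x \<oplus>\<^bsub>M\<^esub> a \<odot>\<^bsub>M\<^esub> y"
    "\<And>a b x. a \<in> carrier R \<Longrightarrow> b \<in> carrier R \<Longrightarrow> x \<in> carrier M \<Longrightarrow>
        (a \<otimes>\<^bsub>R\<^esub> b) \<odot>\<^bsub>M\<^esub> x = a \<odot>\<^bsub>M\<^esub> (b \<odot>\<^bsub>M\<^esub> x)"
    "\<And>x. x \<in> carrier M \<Longrightarrow> \<one>\<^bsub>R\<^esub> \<odot>\<^bsub>M\<^esub> x = x"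
  shows "left_module R M"
  using assms by (auto intro!: left_module.intro left_module_axioms.intro)

lemma opp_ring_simps [simp]: "carrier (opp_ring R) = carrier R" "add (opp_ring R) = add R"
  "zero (opp_ring R) = zero R" "one (opp_ring R) = one R" "a \<otimes>\<^bsub>opp_ring R\<^esub> b = b \<otimes>\<^bsub>R\<^esub> a"
  "opp_ring (opp_ring R) = R"
  by (auto simp: opp_ring_def)

lemma opp_ring_is_ring:
  fixes R (structure)
  assumes "ring R"
  shows "ring (opp_ring R)"
proof -
  interpret ring R by fact
  show ?thesis
    by (rule ringI) (auto simp: opp_ring_def m_assoc l_distr r_distr a_ac intro!: abelian_groupI monoidI intro: l_neg bexI[of _ "\<ominus> x" for x])
qed

lemma regular_left_module:
  fixes R (structure)
  assumes "ring R"
  shows "left_module R (regular_module R)"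
proof -
  interpret ring R by fact
  show ?thesis
    by (rule left_moduleI) (auto simp: regular_module_def m_assoc l_distr r_distr a_ac assms intro!: abelian_groupI intro: l_neg bexI[of _ "\<ominus> x" for x])
qed

lemma dual_left_module:
  fixes R (structure)
  assumes "left_module R M"
  shows "left_module (opp_ring R) (dual R M)"
proof -
  interpret left_module R M by fact
  show ?thesis
  proof (rule left_moduleI)
    show "abelian_group (dual R M)"
    proof (rule abelian_groupI, goal_cases)
      case (6 x)
      show ?case
        by (rule bexI[of _ "\<lambda>y\<in>carrier M. \<ominus> (x y)"]) (use 6 in \<open>auto simp: dual_def mod_hom_def regular_module_def PiE_def Pi_def restrict_def fun_eq_iff R.minus_add R.l_neg R.r_minus extensional_def\<close>)
    qed (auto simp: dual_def mod_hom_def regular_module_def PiE_def Pi_def fun_eq_iff R.a_ac R.r_distr extensional_def)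
  qed (auto simp: dual_def mod_hom_def regular_module_def PiE_def Pi_def fun_eq_iff R.a_ac R.r_distr R.l_distr R.m_assoc extensional_def smult_r_distr opp_ring_is_ring R.ring_axioms)
qed

lemma free_left_module:
  fixes R (structure)
  assumes "ring R"
  shows "left_module R (free_module R S)"
proof -
  interpret ring R by fact
  have A: "finite {x \<in> S. u x \<noteq> \<zero>} \<Longrightarrow> finite {x \<in> S. v x \<noteq> \<zero>} \<Longrightarrow> finite {x \<in> S. u x \<oplus> v x \<noteq> \<zero>}" for u v
    by (rule finite_subset[of _ "{x \<in> S. u x \<noteq> \<zero>} \<union> {x \<in> S. v x \<noteq> \<zero>}"]) auto
  have B: "a \<in> carrier R \<Longrightarrow> finite {x \<in> S. u x \<noteq> \<zero>} \<Longrightarrow> finite {x \<in> S. a \<otimes> u x \<noteq> \<zero>}" for u a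
    by (rule finite_subset[of _ "{x \<in> S. u x \<noteq> \<zero>}"]) auto
  have C: "(\<And>x. x \<in> S \<Longrightarrow> u x \<in> carrier R) \<Longrightarrow> finite {x \<in> S. u x \<noteq> \<zero>} \<Longrightarrow> finite {x \<in> S. \<ominus> u x \<noteq> \<zero>}" for u
    by (rule finite_subset[of _ "{x \<in> S. u x \<noteq> \<zero>}"]) auto
  have D: "finite {x \<in> S. restrict u S x \<noteq> \<zero>} = finite {x \<in> S. u x \<noteq> \<zero>}" for u
    by (rule arg_cong[of _ _ finite]) auto
  have G: "{x. (x \<in> S \<longrightarrow> Q x) \<and> x \<in> S} = {x \<in> S. Q x}" for Q by auto
  show ?thesis
  proof (rule left_moduleI)
    show "abelian_group (free_module R S)"
    proof (rule abelian_groupI, goal_cases)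
      case (6 x)
      have [simp]: "{xa. (xa \<in> S \<longrightarrow> x xa \<noteq> \<zero>) \<and> xa \<in> S} = {xa\<in>S. x xa \<noteq> \<zero>}" by auto
      show ?case
        by (rule bexI[of _ "\<lambda>y\<in>S. \<ominus> (x y)"]) (use 6 in \<open>auto simp: free_module_def D  PiE_def Pi_def fun_eq_iff l_neg C extensional_def\<close>)
    next
      case 2 have "{x \<in> S. (\<lambda>x\<in>S. \<zero>) x \<noteq> \<zero>} = {}" by auto
      then have "finite {x \<in> S. (\<lambda>x\<in>S. \<zero>) x \<noteq> \<zero>}" by (simp only: finite.emptyI)
      then show ?case unfolding free_module_def by (simp del: restrict_apply add: restrict_PiE_iff)
    qed (auto simp: free_module_def G D PiE_def Pi_def fun_eq_iff a_ac extensional_def intro!: A)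
  qed (auto simp: free_module_def G D PiE_def Pi_def fun_eq_iff a_ac r_distr l_distr m_assoc extensional_def B assms)
qed


lemma quot_left_module: fixes R (structure) and M :: "('a,'b) module" (structure)
  assumes "left_module R M" "submodule N R M" shows "left_module R (quot_module M N)"
proof -
  interpret left_module R M by fact
  interpret N: submodule N R M by fact
  interpret N: abelian_subgroup N M
    using N.subgroup_axioms by (intro abelian_subgroupI3 additive_subgroup.intro M.abelian_group_axioms)
  have C: "carrier (quot_module M N) = (\<lambda>x. N +>\<^bsub>M\<^esub> x) ` carrier M"
    by (auto simp: quot_module_def A_RCOSETS_def')
  have A: "x \<in> carrier M \<Longrightarrow> y \<in> carrier M \<Longrightarrow> (N +>\<^bsub>M\<^esub> x) \<oplus>\<^bsub>quot_module M N\<^esub> (N +>\<^bsub>M\<^esub> y) = N +>\<^bsub>M\<^esub> (x \<oplus>\<^bsub>M\<^esub> y)" for x y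
    by (simp add: quot_module_def N.a_rcos_sum)
  have S: "a \<odot>\<^bsub>quot_module M N\<^esub> (N +>\<^bsub>M\<^esub> x) = N +>\<^bsub>M\<^esub> (a \<odot>\<^bsub>M\<^esub> x)" if a: "a \<in> carrier R" and x: "x \<in> carrier M" for a x
  proof -
    have "N +>\<^bsub>M\<^esub> (a \<odot>\<^bsub>M\<^esub> y) = N +>\<^bsub>M\<^esub> (a \<odot>\<^bsub>M\<^esub> x)" if "y \<in> N +>\<^bsub>M\<^esub> x" for y
    proof -
      obtain n where n: "n \<in> N" "y = n \<oplus>\<^bsub>M\<^esub> x" using \<open>y \<in> _\<close> by (auto simp: a_r_coset_def')
      then have "a \<odot>\<^bsub>M\<^esub> y \<in> N +>\<^bsub>M\<^esub> (a \<odot>\<^bsub>M\<^esub> x)"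
        using a x by (auto simp: a_r_coset_def' smult_r_distr intro!: bexI[of _ "a \<odot>\<^bsub>M\<^esub> n"])
      then show ?thesis using a x using N.a_repr_independence'[of "a \<odot>\<^bsub>M\<^esub> y" "a \<odot>\<^bsub>M\<^esub> x"] by simp
    qed
    moreover have "x \<in> N +>\<^bsub>M\<^esub> x" by (simp add: N.a_rcos_self x)
    ultimately have "(\<Union>y\<in>N +>\<^bsub>M\<^esub> x. N +>\<^bsub>M\<^esub> (a \<odot>\<^bsub>M\<^esub> y)) = N +>\<^bsub>M\<^esub> (a \<odot>\<^bsub>M\<^esub> x)"
      by blast
    then show ?thesis by (simp add: quot_module_def)
  qed
  show ?thesis
  proof (rule left_moduleI)
    show "abelian_group (quot_module M N)"
    proof (rule abelian_groupI, goal_cases)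
      case 2 show ?case unfolding C
        by (rule image_eqI[of _ _ "\<zero>\<^bsub>M\<^esub>"]) (auto simp: quot_module_def M.a_coset_join2[OF _ N.subgroup_axioms])
    next
      case (5 x)
      have "\<zero>\<^bsub>quot_module M N\<^esub> = N +>\<^bsub>M\<^esub> \<zero>\<^bsub>M\<^esub>" by (auto simp: quot_module_def M.a_coset_join2[OF _ N.subgroup_axioms])
      with 5 show ?case by (auto simp: C A)
    next
      case (6 x)
      have Z: "\<zero>\<^bsub>quot_module M N\<^esub> = N +>\<^bsub>M\<^esub> \<zero>\<^bsub>M\<^esub>" by (auto simp: quot_module_def M.a_coset_join2[OF _ N.subgroup_axioms])
      obtain y where y: "y \<in> carrier M" "x = N +>\<^bsub>M\<^esub> y" using 6 by (auto simp: C)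
      show ?case unfolding Z
        by (rule bexI[of _ "N +>\<^bsub>M\<^esub> (\<ominus>\<^bsub>M\<^esub> y)"]) (use y in \<open>auto simp: C A M.l_neg\<close>)
    qed (auto simp: C A M.a_ac)
  qed (auto simp: C A S smult_l_distr smult_r_distr smult_assoc1 R.ring_axioms)
qed
lemma free_ext_support:
  fixes R (structure) and X :: "('a,'b) module" (structure)
  assumes "left_module R X" "u \<in> carrier (free_module R S)" "finite T" "T \<subseteq> S" "{x \<in> S. u x \<noteq> \<zero>\<^bsub>R\<^esub>} \<subseteq> T"
    "\<phi> \<in> S \<rightarrow> carrier X"
  shows "(\<Oplus>\<^bsub>X\<^esub>x\<in>{x \<in> S. u x \<noteq> \<zero>\<^bsub>R\<^esub>}. u x \<odot>\<^bsub>X\<^esub> \<phi> x) = (\<Oplus>\<^bsub>X\<^esub>x\<in>T. u x \<odot>\<^bsub>X\<^esub> \<phi> x)"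
proof -
  interpret left_module R X by fact
  have Z: "\<zero>\<^bsub>R\<^esub> \<odot>\<^bsub>X\<^esub> y = \<zero>\<^bsub>X\<^esub>" if "y \<in> carrier X" for y
    using that by (metis M.add.l_cancel_one' R.add.r_cancel_one' R.zero_closed smult_closed smult_l_distr)
  have c: "u x \<odot>\<^bsub>X\<^esub> \<phi> x \<in> carrier X" if "x \<in> S" for x
    using assms(2,6) that by (intro smult_closed) (auto simp: free_module_def PiE_def Pi_def)
  show ?thesis
    using assms(2-) c by (intro M.add.finprod_mono_neutral_cong_left) (auto simp: Z Pi_def)
qed

definition free_ext ::
    "('a, 'r) ring_scheme \<Rightarrow> ('a, 'b) module \<Rightarrow> 'c set \<Rightarrow> ('c \<Rightarrow> 'b) \<Rightarrow> ('c \<Rightarrow> 'a) \<Rightarrow> 'b" where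
  "free_ext R X S \<phi> =
     (\<lambda>u\<in>carrier (free_module R S).
        \<Oplus>\<^bsub>X\<^esub>x\<in>{x \<in> S. u x \<noteq> \<zero>\<^bsub>R\<^esub>}. u x \<odot>\<^bsub>X\<^esub> \<phi> x)"

lemma free_ext_hom:
  fixes R (structure) and X :: "('a,'b) module" (structure)
  assumes "left_module R X" "\<phi> \<in> S \<rightarrow> carrier X"
  shows "free_ext R X S \<phi> \<in> mod_hom R (free_module R S) X"
proof -
  interpret left_module R X by fact
  interpret F: left_module R "free_module R S" by (rule free_left_module) (rule R.ring_axioms)
  note [simp] = funcset_mem[OF assms(2)]
  have S0: "a \<odot>\<^bsub>X\<^esub> \<zero>\<^bsub>X\<^esub> = \<zero>\<^bsub>X\<^esub>" if "a \<in> carrier R" for a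
    using that by (metis M.add.l_cancel_one' M.zero_closed M.r_zero smult_closed smult_r_distr)
  have C: "u x \<in> carrier R" if "u \<in> carrier (free_module R S)" "x \<in> S" for u x using that by (auto simp: free_module_def)
  have add_app: "(u \<oplus>\<^bsub>free_module R S\<^esub> v) x = u x \<oplus>\<^bsub>R\<^esub> v x" if "x \<in> S" for u v x
    using that by (simp add: free_module_def)
  have smul_app: "(a \<odot>\<^bsub>free_module R S\<^esub> u) x = a \<otimes>\<^bsub>R\<^esub> u x" if "x \<in> S" for a u x
    using that by (simp add: free_module_def)
  have D: "a \<odot>\<^bsub>X\<^esub> (\<Oplus>\<^bsub>X\<^esub>x\<in>T. f x) = (\<Oplus>\<^bsub>X\<^esub>x\<in>T. a \<odot>\<^bsub>X\<^esub> f x)" if "finite T" "f \<in> T \<rightarrow> carrier X" "a \<in> carrier R" for a f T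
    using that by (induction T) (auto simp: S0 smult_r_distr Pi_def)
  show ?thesis
    unfolding mod_hom_def
  proof (intro CollectI conjI ballI)
    show "free_ext R X S \<phi> \<in> carrier (free_module R S) \<rightarrow>\<^sub>E carrier X"
      by (auto simp: free_ext_def C intro!: M.finsum_closed smult_closed)
  next
    fix u v assume u: "u \<in> carrier (free_module R S)" and v: "v \<in> carrier (free_module R S)"
    let ?T = "{x\<in>S. u x \<noteq> \<zero>\<^bsub>R\<^esub>} \<union> {x\<in>S. v x \<noteq> \<zero>\<^bsub>R\<^esub>}"
    have T: "finite ?T" using u v by (auto simp: free_module_def)
    have uv: "u \<oplus>\<^bsub>free_module R S\<^esub> v \<in> carrier (free_module R S)" using u v by simp
    have sub: "{x\<in>S. (u \<oplus>\<^bsub>free_module R S\<^esub> v) x \<noteq> \<zero>\<^bsub>R\<^esub>} \<subseteq> ?T" by (auto simp: free_module_def)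
    show "free_ext R X S \<phi> (u \<oplus>\<^bsub>free_module R S\<^esub> v) = free_ext R X S \<phi> u \<oplus>\<^bsub>X\<^esub> free_ext R X S \<phi> v"
      unfolding free_ext_def restrict_apply' [OF u] restrict_apply' [OF v] restrict_apply' [OF uv]
      unfolding free_ext_support[OF assms(1) u T _ _ assms(2), OF Un_least[OF Collect_restrict Collect_restrict] Un_upper1]
       free_ext_support[OF assms(1) v T _ _ assms(2), OF Un_least[OF Collect_restrict Collect_restrict] Un_upper2]
       free_ext_support[OF assms(1) uv T _ sub assms(2), OF Un_least[OF Collect_restrict Collect_restrict]]
    proof -
      have "(\<Oplus>\<^bsub>X\<^esub>x\<in>?T. (u \<oplus>\<^bsub>free_module R S\<^esub> v) x \<odot>\<^bsub>X\<^esub> \<phi> x) = (\<Oplus>\<^bsub>X\<^esub>x\<in>?T. u x \<odot>\<^bsub>X\<^esub> \<phi> x \<oplus>\<^bsub>X\<^esub> v x \<odot>\<^bsub>X\<^esub> \<phi> x)"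
        by (rule M.finsum_cong') (auto simp: C u v add_app smult_l_distr)
      also have "\<dots> = (\<Oplus>\<^bsub>X\<^esub>x\<in>?T. u x \<odot>\<^bsub>X\<^esub> \<phi> x) \<oplus>\<^bsub>X\<^esub> (\<Oplus>\<^bsub>X\<^esub>x\<in>?T. v x \<odot>\<^bsub>X\<^esub> \<phi> x)"
        by (rule M.finsum_addf) (auto simp: C u v)
      finally show "(\<Oplus>\<^bsub>X\<^esub>x\<in>?T. (u \<oplus>\<^bsub>free_module R S\<^esub> v) x \<odot>\<^bsub>X\<^esub> \<phi> x) = (\<Oplus>\<^bsub>X\<^esub>x\<in>?T. u x \<odot>\<^bsub>X\<^esub> \<phi> x) \<oplus>\<^bsub>X\<^esub> (\<Oplus>\<^bsub>X\<^esub>x\<in>?T. v x \<odot>\<^bsub>X\<^esub> \<phi> x)" .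
    qed
  next
    fix a u assume a: "a \<in> carrier R" and u: "u \<in> carrier (free_module R S)"
    let ?T = "{x\<in>S. u x \<noteq> \<zero>\<^bsub>R\<^esub>}"
    have T: "finite ?T" using u by (auto simp: free_module_def)
    have au: "a \<odot>\<^bsub>free_module R S\<^esub> u \<in> carrier (free_module R S)" using a u by simp
    have sub: "{x\<in>S. (a \<odot>\<^bsub>free_module R S\<^esub> u) x \<noteq> \<zero>\<^bsub>R\<^esub>} \<subseteq> ?T" using a by (auto simp: free_module_def)
    show "free_ext R X S \<phi> (a \<odot>\<^bsub>free_module R S\<^esub> u) = a \<odot>\<^bsub>X\<^esub> free_ext R X S \<phi> u"
      unfolding free_ext_def restrict_apply' [OF u] restrict_apply' [OF au]
       free_ext_support[OF assms(1) au T _ sub assms(2), OF Collect_restrict]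
      apply (subst D)
         apply (auto simp: C u a T smul_app smult_assoc1 intro!: M.finsum_cong' smult_closed)
      done
  qed
qed

lemma free_cover_eq: "free_cover R X = free_ext R X (carrier X) (\<lambda>x. x)"
  by (simp add: free_cover_def free_ext_def)

lemma mod_hom_finsum:
  fixes R (structure)
  assumes "left_module R N" "left_module R N'" "g \<in> mod_hom R N N'" "finite T" "f \<in> T \<rightarrow> carrier N"
  shows "g (\<Oplus>\<^bsub>N\<^esub>x\<in>T. f x) = (\<Oplus>\<^bsub>N'\<^esub>x\<in>T. g (f x))"
proof -
  interpret N: left_module R N by fact
  interpret N': left_module R N' by fact
  have g0: "g \<zero>\<^bsub>N\<^esub> = \<zero>\<^bsub>N'\<^esub>"
    using assms(3) by (auto simp: mod_hom_def)
      (metis N'.add.l_cancel_one' N.M.l_zero N.M.zero_closed PiE_mem)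
  have gc: "g x \<in> carrier N'" if "x \<in> carrier N" for x using assms(3) that by (auto simp: mod_hom_def)
  have ga: "g (x \<oplus>\<^bsub>N\<^esub> y) = g x \<oplus>\<^bsub>N'\<^esub> g y" if "x \<in> carrier N" "y \<in> carrier N" for x y using assms(3) that by (auto simp: mod_hom_def)
  show ?thesis using assms(4,5)
    by (induction T) (auto simp: g0 gc ga Pi_def)
qed

lemma free_cover_surj:
  fixes R (structure)
  assumes "left_module R X"
  shows "free_cover R X ` carrier (free_module R (carrier X)) = carrier X"
proof -
  interpret left_module R X by fact
  have "free_cover R X \<in> mod_hom R (free_module R (carrier X)) X"
    unfolding free_cover_eq by (rule free_ext_hom) (auto simp: assms)
  moreover have "x \<in> free_cover R X ` carrier (free_module R (carrier X))" if x: "x \<in> carrier X" for x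
  proof
    let ?u = "\<lambda>y\<in>carrier X. if y = x then \<one>\<^bsub>R\<^esub> else \<zero>\<^bsub>R\<^esub>"
    have "{y \<in> carrier X. ?u y \<noteq> \<zero>\<^bsub>R\<^esub>} \<subseteq> {x}" by auto
    then have "finite {y \<in> carrier X. ?u y \<noteq> \<zero>\<^bsub>R\<^esub>}" using finite_subset by blast
    then show u: "?u \<in> carrier (free_module R (carrier X))"
      by (auto simp: free_module_def simp del: restrict_apply)
    have "free_cover R X ?u = (\<Oplus>\<^bsub>X\<^esub>y\<in>{y \<in> carrier X. ?u y \<noteq> \<zero>\<^bsub>R\<^esub>}. ?u y \<odot>\<^bsub>X\<^esub> y)"
      unfolding free_cover_def using u by (simp only: restrict_apply')
    also have "\<dots> = (\<Oplus>\<^bsub>X\<^esub>y\<in>{x}. ?u y \<odot>\<^bsub>X\<^esub> y)"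
      by (rule free_ext_support[OF assms u]) (auto simp: x)
    also have "\<dots> = x" using x by simp
    finally show "x = free_cover R X ?u" by simp
  qed
  ultimately show ?thesis by (auto simp: mod_hom_def)
qed

lemma mod_hom_compose: "h \<in> mod_hom R N L \<Longrightarrow> g \<in> mod_hom R M N \<Longrightarrow> left_module R M \<Longrightarrow> compose (carrier M) h g \<in> mod_hom R M L"
proof -
  assume a: "h \<in> mod_hom R N L" "g \<in> mod_hom R M N" "left_module R M"
  interpret M: left_module R M by fact
  show ?thesis using a(1,2) by (auto simp: mod_hom_def compose_eq compose_def PiE_def Pi_def)
qed

lemma projective_lift:
  fixes R :: "('a, 'r) ring_scheme" and P :: "('a, 'b) module"
    and N :: "('a, 'c) module" and N' :: "('a, 'd) module"
  assumes "projective R P" "left_module R N" "left_module R N'" "g \<in> mod_hom R N N'"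
    "g ` carrier N = carrier N'" "h \<in> mod_hom R P N'"
  shows "\<exists>k\<in>mod_hom R P N. \<forall>x\<in>carrier P. g (k x) = h x"
proof -
  have P: "left_module R P" using assms(1) by (simp add: projective_def)
  interpret P: left_module R P by fact
  interpret N: left_module R N by fact
  interpret N': left_module R N' by fact
  let ?F = "free_module R (carrier P)"
  interpret F: left_module R ?F by (rule free_left_module) (rule P.R.ring_axioms)
  have fch: "free_cover R P \<in> mod_hom R ?F P"
    unfolding free_cover_eq by (rule free_ext_hom) (auto simp: P)
  moreover have "(\<lambda>x\<in>carrier P. x) \<in> mod_hom R P P" by (auto simp: mod_hom_def)
  moreover have L: "\<And>(N :: ('a, 'b \<Rightarrow> 'a) module) (N' :: ('a, 'b) module) g h. left_module R N \<Longrightarrow> left_module R N' \<Longrightarrow> g \<in> mod_hom R N N' \<Longrightarrow>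
        g ` carrier N = carrier N' \<Longrightarrow> h \<in> mod_hom R P N' \<Longrightarrow>
        (\<exists>k\<in>mod_hom R P N. \<forall>x\<in>carrier P. g (k x) = h x)"
    using assms(1) unfolding projective_def by blast
  ultimately have "\<exists>k\<in>mod_hom R P ?F. \<forall>x\<in>carrier P. free_cover R P (k x) = (\<lambda>x\<in>carrier P. x) x"
    using L[OF F.left_module_axioms P _ free_cover_surj[OF P]] by blast
  then obtain s where s: "s \<in> mod_hom R P ?F" "\<And>x. x \<in> carrier P \<Longrightarrow> free_cover R P (s x) = x"
    by (metis (no_types, lifting) restrict_apply')
  obtain c where c: "\<And>x. x \<in> carrier P \<Longrightarrow> c x \<in> carrier N \<and> g (c x) = h x"
  proof -
    have "\<forall>x\<in>carrier P. \<exists>y. y \<in> carrier N \<and> g y = h x"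
    proof
      fix x assume "x \<in> carrier P"
      then have "h x \<in> g ` carrier N" unfolding assms(5) using assms(6) by (auto simp: mod_hom_def)
      then show "\<exists>y. y \<in> carrier N \<and> g y = h x" by (metis imageE)
    qed
    then show ?thesis using that by metis
  qed
  have e: "free_ext R N (carrier P) c \<in> mod_hom R ?F N" by (rule free_ext_hom[OF assms(2)]) (simp add: Pi_def c)
  have hc: "h x \<in> carrier N'" if "x \<in> carrier P" for x using assms(6) that by (auto simp: mod_hom_def)
  have g_s: "g (a \<odot>\<^bsub>N\<^esub> y) = a \<odot>\<^bsub>N'\<^esub> g y" if "a \<in> carrier R" "y \<in> carrier N" for a y
    using assms(4) that by (auto simp: mod_hom_def)
  have h_s: "h (a \<odot>\<^bsub>P\<^esub> y) = a \<odot>\<^bsub>N'\<^esub> h y" if "a \<in> carrier R" "y \<in> carrier P" for a y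
    using assms(6) that by (auto simp: mod_hom_def)
  have ge: "g (free_ext R N (carrier P) c u) = h (free_cover R P u)" if u: "u \<in> carrier ?F" for u
  proof -
    let ?T = "{x \<in> carrier P. u x \<noteq> \<zero>\<^bsub>R\<^esub>}"
    have T: "finite ?T" and uc: "\<And>x. x \<in> carrier P \<Longrightarrow> u x \<in> carrier R"
      using u by (auto simp: free_module_def)
    show ?thesis
      unfolding free_ext_def free_cover_def restrict_apply'[OF u]
      using mod_hom_finsum[OF assms(2,3,4) T, of "\<lambda>x. u x \<odot>\<^bsub>N\<^esub> c x"]
        mod_hom_finsum[OF P assms(3,6) T, of "\<lambda>x. u x \<odot>\<^bsub>P\<^esub> x"]
        N'.M.finsum_cong'[of ?T ?T "\<lambda>x. g (u x \<odot>\<^bsub>N\<^esub> c x)" "\<lambda>x. h (u x \<odot>\<^bsub>P\<^esub> x)"]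
      by (simp add: Pi_def uc c hc g_s h_s)
  qed
  show ?thesis
  proof (rule bexI[of _ "compose (carrier P) (free_ext R N (carrier P) c) s"])
    have sF: "s x \<in> carrier ?F" if "x \<in> carrier P" for x using s(1) that by (auto simp: mod_hom_def)
    then show "\<forall>x\<in>carrier P. g (compose (carrier P) (free_ext R N (carrier P) c) s x) = h x"
      by (simp add: compose_eq ge s(2))
    show "compose (carrier P) (free_ext R N (carrier P) c) s \<in> mod_hom R P N"
      by (rule mod_hom_compose[OF e s(1) P])
  qed
qed

lemma mod_hom_zero:
  assumes "left_module R N" "left_module R N'" "g \<in> mod_hom R N N'"
  shows "g \<zero>\<^bsub>N\<^esub> = \<zero>\<^bsub>N'\<^esub>"
proof -
  interpret N: left_module R N by fact
  interpret N': left_module R N' by fact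
  show ?thesis
    using assms(3) by (auto simp: mod_hom_def)
      (metis N'.add.l_cancel_one' N.M.l_zero N.M.zero_closed PiE_mem)
qed

lemma left_submoduleI:
  assumes "left_module R M" "H \<subseteq> carrier M" "\<zero>\<^bsub>M\<^esub> \<in> H"
   "\<And>x y. x \<in> H \<Longrightarrow> y \<in> H \<Longrightarrow> x \<oplus>\<^bsub>M\<^esub> y \<in> H"
   "\<And>a x. a \<in> carrier R \<Longrightarrow> x \<in> H \<Longrightarrow> a \<odot>\<^bsub>M\<^esub> x \<in> H"
  shows "left_module R (M\<lparr>carrier := H\<rparr>)" "submodule H R M"
proof -
  interpret left_module R M by fact
  have Z: "\<zero>\<^bsub>R\<^esub> \<odot>\<^bsub>M\<^esub> y = \<zero>\<^bsub>M\<^esub>" if "y \<in> carrier M" for y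
    using that by (metis M.add.l_cancel_one' R.add.r_cancel_one' R.zero_closed smult_closed smult_l_distr)
  have m: "\<exists>y\<in>H. y \<oplus>\<^bsub>M\<^esub> x = \<zero>\<^bsub>M\<^esub>" if "x \<in> H" for x
  proof (rule bexI)
    have x: "x \<in> carrier M" using that assms by auto
    have "(\<ominus>\<^bsub>R\<^esub> \<one>\<^bsub>R\<^esub>) \<odot>\<^bsub>M\<^esub> x \<oplus>\<^bsub>M\<^esub> x = (\<ominus>\<^bsub>R\<^esub> \<one>\<^bsub>R\<^esub> \<oplus>\<^bsub>R\<^esub> \<one>\<^bsub>R\<^esub>) \<odot>\<^bsub>M\<^esub> x"
      using x by (subst smult_l_distr) auto
    then show "(\<ominus>\<^bsub>R\<^esub> \<one>\<^bsub>R\<^esub>) \<odot>\<^bsub>M\<^esub> x \<oplus>\<^bsub>M\<^esub> x = \<zero>\<^bsub>M\<^esub>" using x Z by (simp add: R.l_neg)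
    show "(\<ominus>\<^bsub>R\<^esub> \<one>\<^bsub>R\<^esub>) \<odot>\<^bsub>M\<^esub> x \<in> H" using that assms by auto
  qed
  have ag: "abelian_group (M\<lparr>carrier := H\<rparr>)"
    by (rule abelian_groupI) (use assms(2-4) m in \<open>auto simp: M.a_ac subset_iff\<close>)
  then show "left_module R (M\<lparr>carrier := H\<rparr>)"
    by (rule left_moduleI[rotated]) (use assms in \<open>auto simp: subset_iff R.ring_axioms smult_l_distr smult_r_distr smult_assoc1\<close>)
  have "group ((add_monoid M)\<lparr>carrier := H\<rparr>)" using abelian_group.a_group[OF ag] by simp
  then have "subgroup H (add_monoid M)"
    using assms(2) by (intro M.add.group_incl_imp_subgroup) auto
  then show "submodule H R M" using assms(5) by (simp add: submodule_def submodule_axioms_def)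
qed

lemma kernel_left_module:
  assumes "left_module R M" "left_module R N" "g \<in> mod_hom R M N"
  shows "left_module R (M\<lparr>carrier := a_kernel M N g\<rparr>)"
proof -
  interpret M: left_module R M by fact
  interpret N: left_module R N by fact
  have S0: "a \<odot>\<^bsub>N\<^esub> \<zero>\<^bsub>N\<^esub> = \<zero>\<^bsub>N\<^esub>" if "a \<in> carrier R" for a
    using that by (metis N.M.add.l_cancel_one' N.M.zero_closed N.M.r_zero N.smult_closed N.smult_r_distr)
  show ?thesis
    by (rule left_submoduleI(1)[OF assms(1)]) (use assms(3) mod_hom_zero[OF assms] S0 in \<open>auto simp: a_kernel_def kernel_def mod_hom_def\<close>)
qed

lemma free_cover_hom:
  assumes "left_module R X"
  shows "free_cover R X \<in> mod_hom R (free_module R (carrier X)) X"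
  unfolding free_cover_eq by (rule free_ext_hom) (use assms in auto)

lemma syzygy_left_module:
  assumes "left_module R X"
  shows "left_module R (syzygy R X)"
  unfolding syzygy_def Let_def
  using assms by (intro kernel_left_module free_cover_hom free_left_module) (auto simp: left_module_def)

lemma hom_group_comm_group:
  assumes "left_module R M" "left_module R N"
  shows "comm_group (hom_group R M N)"
proof -
  interpret M: left_module R M by fact
  interpret N: left_module R N by fact
  have S0: "a \<odot>\<^bsub>N\<^esub> \<zero>\<^bsub>N\<^esub> = \<zero>\<^bsub>N\<^esub>" if "a \<in> carrier R" for a
    using that by (metis N.M.add.l_cancel_one' N.M.zero_closed N.M.r_zero N.smult_closed N.smult_r_distr)
  have neg: "\<ominus>\<^bsub>N\<^esub> (a \<odot>\<^bsub>N\<^esub> x) = a \<odot>\<^bsub>N\<^esub> (\<ominus>\<^bsub>N\<^esub> x)" if "a \<in> carrier R" "x \<in> carrier N" for a x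
    using that by (intro N.M.minus_equality) (auto simp: N.smult_r_distr[symmetric] N.M.l_neg S0)
  show ?thesis
  proof (rule comm_groupI, goal_cases)
    case (6 x)
    show ?case
      by (rule bexI[of _ "\<lambda>y\<in>carrier M. \<ominus>\<^bsub>N\<^esub> (x y)"]) (use 6 in \<open>auto simp: hom_group_def mod_hom_def PiE_def Pi_def fun_eq_iff N.M.minus_add N.M.l_neg extensional_def neg\<close>)
  qed (auto simp: hom_group_def mod_hom_def PiE_def Pi_def fun_eq_iff N.M.a_ac N.smult_r_distr extensional_def S0)
qed

lemma precompose_group_hom:
  assumes "left_module R M" "left_module R N" "left_module R Y" "d \<in> mod_hom R M N"
  shows "group_hom (hom_group R N Y) (hom_group R M Y) (\<lambda>h. compose (carrier M) h d)"
proof (intro group_hom.intro group_hom_axioms.intro)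
  show "group (hom_group R N Y)" "group (hom_group R M Y)" using hom_group_comm_group assms comm_group.axioms(2) by blast+
  show "(\<lambda>h. compose (carrier M) h d) \<in> hom (hom_group R N Y) (hom_group R M Y)"
    using assms mod_hom_compose[OF _ assms(4,1)]
    by (auto simp: hom_def hom_group_def) (auto simp: mod_hom_def compose_def fun_eq_iff PiE_def Pi_def)
qed

lemma mod_hom_syzygyD: "d \<in> mod_hom R F (syzygy R X) \<Longrightarrow> d \<in> mod_hom R F (free_module R (carrier X))"
  by (auto simp: mod_hom_def syzygy_def Let_def a_kernel_def kernel_def PiE_def Pi_def)

lemma Ext1_comm_group:
  assumes X: "left_module R X" and Y: "left_module R Y" shows "comm_group (Ext1 R X Y)"
proof -
  interpret X: left_module R X by fact
  interpret Y: left_module R Y by fact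
  define K where "K = syzygy R X"
  define L where "L = syzygy R K"
  define F0 where "F0 = free_module R (carrier X)"
  define F1 where "F1 = free_module R (carrier K)"
  define F2 where "F2 = free_module R (carrier L)"
  define d1 where "d1 = free_cover R K"
  define d2 where "d2 = free_cover R L"
  let ?G = "hom_group R F1 Y"
  have KL: "left_module R K" "left_module R L" unfolding K_def L_def by (intro syzygy_left_module X)+
  have F: "left_module R F0" "left_module R F1" "left_module R F2" unfolding F0_def F1_def F2_def by (intro free_left_module X.R.ring_axioms)+
  have d1: "d1 \<in> mod_hom R F1 F0" unfolding d1_def F1_def F0_def K_def
    using free_cover_hom[OF KL(1)] by (auto simp: K_def intro: mod_hom_syzygyD)
  have d2': "d2 \<in> mod_hom R F2 L" unfolding d2_def F2_def by (rule free_cover_hom[OF KL(2)])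
  have d2: "d2 \<in> mod_hom R F2 F1" using d2' unfolding L_def F1_def by (rule mod_hom_syzygyD)
  have dd: "d1 (d2 z) = \<zero>\<^bsub>F0\<^esub>" if "z \<in> carrier F2" for z
  proof -
    have "d2 z \<in> carrier (syzygy R K)" using d2' that by (auto simp: mod_hom_def L_def)
    then have "d1 (d2 z) = \<zero>\<^bsub>K\<^esub>" by (auto simp: syzygy_def Let_def a_kernel_def kernel_def d1_def)
    then show ?thesis by (simp add: K_def F0_def syzygy_def Let_def)
  qed
  let ?Z = "kernel (hom_group R F1 Y) (hom_group R F2 Y) (\<lambda>h. compose (carrier F2) h d2)"
  let ?B = "(\<lambda>h. compose (carrier F1) h d1) ` mod_hom R F0 Y"
  interpret G: comm_group ?G by (rule hom_group_comm_group) (auto simp: F Y)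
  interpret g2: group_hom "hom_group R F1 Y" "hom_group R F2 Y" "\<lambda>h. compose (carrier F2) h d2"
    by (rule precompose_group_hom) (auto simp: F Y d2)
  interpret g1: group_hom "hom_group R F0 Y" "hom_group R F1 Y" "\<lambda>h. compose (carrier F1) h d1"
    by (rule precompose_group_hom) (auto simp: F Y d1)
  have Z: "subgroup ?Z ?G" by (rule g2.subgroup_kernel)
  have B: "subgroup ?B ?G" using g1.img_is_subgroup by (simp add: hom_group_def)
  have BZ: "?B \<subseteq> ?Z"
  proof
    fix b assume "b \<in> ?B"
    then obtain h where h: "h \<in> mod_hom R F0 Y" "b = compose (carrier F1) h d1" by auto
    have "compose (carrier F2) b d2 = (\<lambda>x\<in>carrier F2. \<zero>\<^bsub>Y\<^esub>)"
      unfolding h(2) compose_def using mod_hom_zero[OF F(1) Y h(1)] d2 dd by (intro restrict_ext) (auto simp: mod_hom_def)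
    moreover have "b \<in> carrier ?G" using \<open>b \<in> ?B\<close> B subgroup.subset by blast
    ultimately show "b \<in> ?Z" by (auto simp: kernel_def hom_group_def)
  qed
  have cz: "comm_group (?G\<lparr>carrier := ?Z\<rparr>)"
    by (rule group.group_comm_groupI[OF subgroup.subgroup_is_group[OF Z G.group_axioms]]) (use subgroup.subset[OF Z] in \<open>auto simp: subset_iff G.m_comm\<close>)
  have "subgroup ?B (?G\<lparr>carrier := ?Z\<rparr>)"
    using G.subgroup_incl[OF B Z BZ] .
  then have "comm_group ((?G\<lparr>carrier := ?Z\<rparr>) Mod ?B)"
    by (rule comm_group.abelian_FactGroup[OF cz])
  then show ?thesis unfolding Ext1_def Let_def
    by (simp add: K_def L_def F0_def F1_def F2_def d1_def d2_def)
qed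

lemma transpose_left_module:
  assumes "left_module R P0" "left_module R P1" "f \<in> mod_hom R P1 P0"
  shows "left_module (opp_ring R) (transpose_module R P1 f P0)"
proof -
  interpret P0: left_module R P0 by fact
  interpret P1: left_module R P1 by fact
  interpret D0: left_module "opp_ring R" "dual R P0" by (rule dual_left_module) fact
  interpret D1: left_module "opp_ring R" "dual R P1" by (rule dual_left_module) fact
  let ?c = "\<lambda>g. compose (carrier P1) g f"
  have f: "f x \<in> carrier P0" if "x \<in> carrier P1" for x using assms(3) that by (auto simp: mod_hom_def)
  have z: "?c \<zero>\<^bsub>dual R P0\<^esub> = \<zero>\<^bsub>dual R P1\<^esub>" by (auto simp: dual_def compose_def fun_eq_iff f)
  have a: "?c x \<oplus>\<^bsub>dual R P1\<^esub> ?c y = ?c (x \<oplus>\<^bsub>dual R P0\<^esub> y)" for x y by (auto simp: dual_def compose_def fun_eq_iff f)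
  have s: "r \<odot>\<^bsub>dual R P1\<^esub> ?c y = ?c (r \<odot>\<^bsub>dual R P0\<^esub> y)" for r y by (auto simp: dual_def compose_def fun_eq_iff f)
  have "submodule (?c ` carrier (dual R P0)) (opp_ring R) (dual R P1)"
  proof (rule left_submoduleI(2)[OF D1.left_module_axioms])
    show "?c ` carrier (dual R P0) \<subseteq> carrier (dual R P1)"
      using mod_hom_compose[OF _ assms(3,2)] by (auto simp: dual_def)
    show "\<zero>\<^bsub>dual R P1\<^esub> \<in> ?c ` carrier (dual R P0)" using z D0.M.zero_closed by (metis image_eqI)
  qed (use D0.smult_closed in \<open>auto simp: a s\<close>)
  then show ?thesis unfolding transpose_module_def by (intro quot_left_module D1.left_module_axioms)
qed

lemma eval_map_hom:
  assumes "left_module R X"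
  shows "eval_map R X \<in> mod_hom R X (dual (opp_ring R) (dual R X))"
proof -
  interpret left_module R X by fact
  interpret D: left_module "opp_ring R" "dual R X" by (rule dual_left_module) fact
  have D: "carrier (dual R X) = mod_hom R X (regular_module R)" by (simp add: dual_def)
  have 1: "(\<lambda>g\<in>carrier (dual R X). g x) \<in> mod_hom (opp_ring R) (dual R X) (regular_module (opp_ring R))" if "x \<in> carrier X" for x
    using that D.M.a_closed D.smult_closed by (auto simp: mod_hom_def) (auto simp: dual_def mod_hom_def regular_module_def)
  show ?thesis
    unfolding mod_hom_def eval_map_def
    apply (auto simp: 1 dual_def[of "opp_ring R"])
    by (auto simp: fun_eq_iff D mod_hom_def regular_module_def)
qed

end

theory Submission
  imports Defs
begin

text \<open>
  Let \<open>X = P1\<^sup>* / B\<close> with \<open>B = f\<^sup>*(P0\<^sup>*)\<close>. Since finitely generated projectives are reflexive, \<open>X\<close> is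
  torsionless iff every \<open>\<phi> \<in> P1\<^sup>*\<close> that vanishes on \<open>ker f\<close> lies in \<open>B\<close>, and this is
  \<open>Ext1(M, \<Lambda>) = 0\<close>.

  Suppose that \<open>M\<close> is not projective. Then \<open>f\<close> is not a split monomorphism, so \<open>B \<noteq> P1\<^sup>*\<close>. If
  \<open>\<alpha> : M \<rightarrow> \<Lambda>\<close> takes a value \<open>\<alpha>(m)\<close> that is not nilpotent, then the chain condition gives a
  nonzero idempotent \<open>\<alpha>(m) w\<close> and hence an idempotent endomorphism
  of the indecomposable module \<open>M\<close> that factors through \<open>\<Lambda>\<close>, so \<open>M\<close> would be projective.
  Choose \<open>\<phi>\<^sub>0 \<in> P1\<^sup>* - B\<close> and \<open>\<phi> = \<phi>\<^sub>0 r \<notin> B\<close> with \<open>r \<Lambda>\<close> minimal. If \<open>\<phi> \<alpha>(m) \<notin> B\<close>, then minimality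
  gives \<open>r = r \<alpha>(m) b\<close>, so \<open>\<alpha>(m) b\<close>, a value of \<open>x \<mapsto> \<alpha>(x) b\<close>, is not nilpotent. Hence
  \<open>\<phi> \<alpha>(m) \<in> B\<close> for all \<open>\<alpha> : M \<rightarrow> \<Lambda>\<close> and \<open>m \<in> M\<close>.

  Fix \<open>m = p(m')\<close>. The map \<open>P0\<^sup>* \<rightarrow> X\<close>, \<open>g \<mapsto> [\<phi> g(m')]\<close> vanishes on \<open>ker f\<^sup>*\<close> by the choice of \<open>\<phi>\<close>,
  so by \<open>Ext1(X, X) = 0\<close> it extends along \<open>f\<^sup>*\<close> to \<open>P1\<^sup>* \<rightarrow> X\<close>. Composing the extension
  with evaluation at some \<open>x \<in> ker f\<close> gives a functional on \<open>P1\<^sup>*\<close>, which is evaluation at some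
  \<open>l \<in> P1\<close>. It follows that \<open>\<phi>(x) m' = f(l)\<close>, so \<open>\<phi>(x) m = 0\<close>. As \<open>M\<close> is faithful, \<open>\<phi>\<close> vanishes
  on \<open>ker f\<close>, and so \<open>\<phi> \<in> B\<close>, a contradiction.
\<close>

section \<open>Linear maps\<close>

lemma regular_module_simps [simp]:
  "carrier (regular_module R) = carrier R" "zero (regular_module R) = \<zero>\<^bsub>R\<^esub>"
  "add (regular_module R) = add R" "smult (regular_module R) = mult R"
  by (simp_all add: regular_module_def)

text \<open>Sums see only the additive structure, which a ring shares with its opposite. This moves
  sums between the bidual and the ring.\<close>

lemma finsum_regular_opp:
  "finsum (regular_module (opp_ring R)) g A = finsum (regular_module R) g A"
  by (simp add: finsum_def)

lemma mod_hom_closed: "h \<in> mod_hom R M N \<Longrightarrow> x \<in> carrier M \<Longrightarrow> h x \<in> carrier N"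
  by (auto simp: mod_hom_def)

lemma mod_hom_add:
  "h \<in> mod_hom R M N \<Longrightarrow> x \<in> carrier M \<Longrightarrow> y \<in> carrier M \<Longrightarrow> h (x \<oplus>\<^bsub>M\<^esub> y) = h x \<oplus>\<^bsub>N\<^esub> h y"
  by (auto simp: mod_hom_def)

lemma mod_hom_smult:
  "h \<in> mod_hom R M N \<Longrightarrow> a \<in> carrier R \<Longrightarrow> x \<in> carrier M \<Longrightarrow> h (a \<odot>\<^bsub>M\<^esub> x) = a \<odot>\<^bsub>N\<^esub> h x"
  by (auto simp: mod_hom_def)

lemma mod_hom_eqI:
  assumes "h \<in> mod_hom R M N" "h' \<in> mod_hom R M N" "\<And>x. x \<in> carrier M \<Longrightarrow> h x = h' x"
  shows "h = h'"
  using assms unfolding mod_hom_def by (auto intro: PiE_ext)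

lemma mod_hom_restrictI:
  assumes "left_module R M"
    and "\<And>x. x \<in> carrier M \<Longrightarrow> h x \<in> carrier N"
    and "\<And>x y. x \<in> carrier M \<Longrightarrow> y \<in> carrier M \<Longrightarrow> h (x \<oplus>\<^bsub>M\<^esub> y) = h x \<oplus>\<^bsub>N\<^esub> h y"
    and "\<And>a x. a \<in> carrier R \<Longrightarrow> x \<in> carrier M \<Longrightarrow> h (a \<odot>\<^bsub>M\<^esub> x) = a \<odot>\<^bsub>N\<^esub> h x"
  shows "(\<lambda>x\<in>carrier M. h x) \<in> mod_hom R M N"
proof -
  interpret left_module R M by fact
  show ?thesis using assms(2-4) by (auto simp: mod_hom_def)
qed

context left_module
begin

lemma smult_l_null: "x \<in> carrier M \<Longrightarrow> \<zero>\<^bsub>R\<^esub> \<odot>\<^bsub>M\<^esub> x = \<zero>\<^bsub>M\<^esub>"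
  by (metis M.add.l_cancel_one' R.add.r_cancel_one' R.zero_closed smult_closed smult_l_distr)

lemma smult_r_null: "a \<in> carrier R \<Longrightarrow> a \<odot>\<^bsub>M\<^esub> \<zero>\<^bsub>M\<^esub> = \<zero>\<^bsub>M\<^esub>"
  by (metis M.add.l_cancel_one' M.zero_closed M.r_zero smult_closed smult_r_distr)

lemma smult_r_minus:
  "a \<in> carrier R \<Longrightarrow> x \<in> carrier M \<Longrightarrow> a \<odot>\<^bsub>M\<^esub> (\<ominus>\<^bsub>M\<^esub> x) = \<ominus>\<^bsub>M\<^esub> (a \<odot>\<^bsub>M\<^esub> x)"
  by (rule M.minus_equality[symmetric]) (auto simp: smult_r_distr[symmetric] M.l_neg smult_r_null)

lemma finsum_smult:
  assumes "finite T" "c \<in> T \<rightarrow> carrier M" "a \<in> carrier R"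
  shows "a \<odot>\<^bsub>M\<^esub> (\<Oplus>\<^bsub>M\<^esub>i\<in>T. c i) = (\<Oplus>\<^bsub>M\<^esub>i\<in>T. a \<odot>\<^bsub>M\<^esub> c i)"
  using assms by (induction T) (auto simp: smult_r_null smult_r_distr Pi_def)

end

text \<open>The composite of \<open>g\<close> with the map from R to M that sends 1 to
  \<open>m\<close>. It serves to multiply functionals by scalars on the right and, over the opposite
  ring, to define a map into the transpose.\<close>

lemma smult_left_hom:
  assumes "left_module R N" "left_module R M" "g \<in> mod_hom R N (regular_module R)" "m \<in> carrier M"
  shows "(\<lambda>x\<in>carrier N. g x \<odot>\<^bsub>M\<^esub> m) \<in> mod_hom R N M"
proof -
  interpret left_module R M by fact
  show ?thesis
    using assms(4) mod_hom_closed[OF assms(3)] mod_hom_add[OF assms(3)] mod_hom_smult[OF assms(3)]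
    by (intro mod_hom_restrictI assms(1)) (auto simp: smult_l_distr smult_assoc1)
qed

lemma mod_hom_minus:
  assumes "left_module R M" "left_module R N" "h \<in> mod_hom R M N" "x \<in> carrier M"
  shows "h (\<ominus>\<^bsub>M\<^esub> x) = \<ominus>\<^bsub>N\<^esub> h x"
proof -
  interpret M: left_module R M by fact
  interpret N: left_module R N by fact
  show ?thesis
    using mod_hom_add[OF assms(3), of "\<ominus>\<^bsub>M\<^esub> x" x] mod_hom_zero[OF assms(1-3)]
      mod_hom_closed[OF assms(3)] assms(4)
    by (intro N.M.minus_equality[symmetric]) (auto simp: M.M.l_neg)
qed

text \<open>Maps out of a finitely generated projective module are built in this form: the
  \<open>\<psi> i\<close> are its coordinate functionals, and the \<open>c i\<close> can be chosen
  freely.\<close>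

lemma lincomb_hom:
  assumes "left_module R P" "left_module R N" "finite T"
    and psi: "\<psi> \<in> T \<rightarrow> mod_hom R P (regular_module R)" and c: "c \<in> T \<rightarrow> carrier N"
  shows "(\<lambda>x\<in>carrier P. \<Oplus>\<^bsub>N\<^esub>i\<in>T. \<psi> i x \<odot>\<^bsub>N\<^esub> c i) \<in> mod_hom R P N"
proof -
  interpret P: left_module R P by fact
  interpret N: left_module R N by fact
  have psi': "\<psi> i \<in> mod_hom R P (regular_module R)" if "i \<in> T" for i using psi that by auto
  have [simp]: "\<psi> i x \<in> carrier R" if "i \<in> T" "x \<in> carrier P" for i x
    using mod_hom_closed[OF psi'] that by auto
  have [simp]: "c i \<in> carrier N" if "i \<in> T" for i using c that by auto
  show ?thesis
  proof (rule mod_hom_restrictI)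
    fix x y assume x: "x \<in> carrier P" and y: "y \<in> carrier P"
    have "(\<Oplus>\<^bsub>N\<^esub>i\<in>T. \<psi> i (x \<oplus>\<^bsub>P\<^esub> y) \<odot>\<^bsub>N\<^esub> c i) = (\<Oplus>\<^bsub>N\<^esub>i\<in>T. \<psi> i x \<odot>\<^bsub>N\<^esub> c i \<oplus>\<^bsub>N\<^esub> \<psi> i y \<odot>\<^bsub>N\<^esub> c i)"
      by (rule N.M.finsum_cong')
        (auto simp: x y mod_hom_add[OF psi'] N.smult_l_distr)
    also have "\<dots> = (\<Oplus>\<^bsub>N\<^esub>i\<in>T. \<psi> i x \<odot>\<^bsub>N\<^esub> c i) \<oplus>\<^bsub>N\<^esub> (\<Oplus>\<^bsub>N\<^esub>i\<in>T. \<psi> i y \<odot>\<^bsub>N\<^esub> c i)"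
      by (rule N.M.finsum_addf) (auto simp: x y)
    finally show "(\<Oplus>\<^bsub>N\<^esub>i\<in>T. \<psi> i (x \<oplus>\<^bsub>P\<^esub> y) \<odot>\<^bsub>N\<^esub> c i) = \<dots>" .
  next
    fix a x assume a: "a \<in> carrier R" and x: "x \<in> carrier P"
    show "(\<Oplus>\<^bsub>N\<^esub>i\<in>T. \<psi> i (a \<odot>\<^bsub>P\<^esub> x) \<odot>\<^bsub>N\<^esub> c i) = a \<odot>\<^bsub>N\<^esub> (\<Oplus>\<^bsub>N\<^esub>i\<in>T. \<psi> i x \<odot>\<^bsub>N\<^esub> c i)"
      by (subst N.finsum_smult)
        (auto simp: a x assms(3) mod_hom_smult[OF psi'] N.smult_assoc1 intro!: N.M.finsum_cong')
  qed (auto intro!: N.M.finsum_closed assms)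
qed

text \<open>Since \<open>e\<close> is onto, X is Q modulo the kernel of \<open>e\<close>; this is
  the universal property of that quotient.\<close>

lemma mod_hom_factor:
  assumes Q: "left_module R Q" and X: "left_module R X" and Y: "left_module R Y"
    and e: "e \<in> mod_hom R Q X" "e ` carrier Q = carrier X" and g: "g \<in> mod_hom R Q Y"
    and ker: "\<And>z. z \<in> carrier Q \<Longrightarrow> e z = \<zero>\<^bsub>X\<^esub> \<Longrightarrow> g z = \<zero>\<^bsub>Y\<^esub>"
  obtains k where "k \<in> mod_hom R X Y" "\<And>z. z \<in> carrier Q \<Longrightarrow> k (e z) = g z"
proof -
  interpret Q: left_module R Q by fact
  interpret X: left_module R X by fact
  interpret Y: left_module R Y by fact
  have eq: "g z = g w" if z: "z \<in> carrier Q" and w: "w \<in> carrier Q" and zw: "e z = e w" for z w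
  proof -
    have "e (z \<oplus>\<^bsub>Q\<^esub> \<ominus>\<^bsub>Q\<^esub> w) = \<zero>\<^bsub>X\<^esub>"
      using z w zw mod_hom_closed[OF e(1)]
      by (simp add: mod_hom_add[OF e(1)] mod_hom_minus[OF Q X e(1)] X.M.r_neg)
    then have "g z \<oplus>\<^bsub>Y\<^esub> \<ominus>\<^bsub>Y\<^esub> g w = \<zero>\<^bsub>Y\<^esub>"
      using ker[of "z \<oplus>\<^bsub>Q\<^esub> \<ominus>\<^bsub>Q\<^esub> w"] z w
      by (simp add: mod_hom_add[OF g] mod_hom_minus[OF Q Y g])
    then show ?thesis using mod_hom_closed[OF g] z w
      by (metis Y.M.add.inv_closed Y.M.minus_equality Y.M.minus_minus)
  qed
  \<comment> \<open>Only a set-theoretic section of \<open>e\<close>. By \<open>eq\<close> the value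
    \<open>g (s x)\<close> does not depend on the preimage chosen, which makes it linear in
    \<open>x\<close>.\<close>
  define s where "s = inv_into (carrier Q) e"
  have s: "s x \<in> carrier Q" "e (s x) = x" if "x \<in> carrier X" for x
    using that unfolding s_def e(2)[symmetric] by (auto intro: inv_into_into f_inv_into_f)
  have k: "g (s (e z)) = g z" if "z \<in> carrier Q" for z
    using that s mod_hom_closed[OF e(1)] by (intro eq) auto
  show thesis
  proof (rule that)
    show "(\<lambda>x\<in>carrier X. g (s x)) \<in> mod_hom R X Y"
    proof (rule mod_hom_restrictI[OF X])
      fix x y assume xy: "x \<in> carrier X" "y \<in> carrier X"
      then have "g (s (x \<oplus>\<^bsub>X\<^esub> y)) = g (s x \<oplus>\<^bsub>Q\<^esub> s y)"
        by (intro eq) (auto simp: s mod_hom_add[OF e(1)])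
      then show "g (s (x \<oplus>\<^bsub>X\<^esub> y)) = g (s x) \<oplus>\<^bsub>Y\<^esub> g (s y)"
        using xy by (simp add: s mod_hom_add[OF g])
    next
      fix a x assume ax: "a \<in> carrier R" "x \<in> carrier X"
      then have "g (s (a \<odot>\<^bsub>X\<^esub> x)) = g (a \<odot>\<^bsub>Q\<^esub> s x)"
        by (intro eq) (auto simp: s mod_hom_smult[OF e(1)])
      then show "g (s (a \<odot>\<^bsub>X\<^esub> x)) = a \<odot>\<^bsub>Y\<^esub> g (s x)"
        using ax by (simp add: s mod_hom_smult[OF g])
    qed (use s mod_hom_closed[OF g] in auto)
    show "\<And>z. z \<in> carrier Q \<Longrightarrow> (\<lambda>x\<in>carrier X. g (s x)) (e z) = g z"
      using k mod_hom_closed[OF e(1)] by simp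
  qed
qed


section \<open>Dual bases\<close>

text \<open>The classical description of finitely generated projective modules by coordinates. It is
  used in place of \<open>projective\<close> because it passes to the dual module and involves no
  quantification over modules.\<close>

definition dual_basis where
  "dual_basis R P T q \<psi> \<longleftrightarrow> finite T \<and> q \<in> T \<rightarrow> carrier P \<and>
     \<psi> \<in> T \<rightarrow> mod_hom R P (regular_module R) \<and>
     (\<forall>x\<in>carrier P. (\<Oplus>\<^bsub>P\<^esub>i\<in>T. \<psi> i x \<odot>\<^bsub>P\<^esub> q i) = x)"

lemma dual_basis_mod_hom:
  assumes "dual_basis R P T q \<psi>" "left_module R P" "left_module R N" "h \<in> mod_hom R P N"
    "x \<in> carrier P"
  shows "h x = (\<Oplus>\<^bsub>N\<^esub>i\<in>T. \<psi> i x \<odot>\<^bsub>N\<^esub> h (q i))"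
proof -
  interpret P: left_module R P by fact
  interpret N: left_module R N by fact
  have fT: "finite T" and q: "\<And>i. i \<in> T \<Longrightarrow> q i \<in> carrier P"
    and psi: "\<And>i. i \<in> T \<Longrightarrow> \<psi> i \<in> mod_hom R P (regular_module R)"
    and x: "(\<Oplus>\<^bsub>P\<^esub>i\<in>T. \<psi> i x \<odot>\<^bsub>P\<^esub> q i) = x"
    using assms(1,5) by (auto simp: dual_basis_def)
  have [simp]: "\<psi> i x \<in> carrier R" if "i \<in> T" for i
    using mod_hom_closed[OF psi[OF that] assms(5)] by simp
  have "h x = h (\<Oplus>\<^bsub>P\<^esub>i\<in>T. \<psi> i x \<odot>\<^bsub>P\<^esub> q i)" by (simp add: x)
  also have "\<dots> = (\<Oplus>\<^bsub>N\<^esub>i\<in>T. h (\<psi> i x \<odot>\<^bsub>P\<^esub> q i))"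
    by (rule mod_hom_finsum[OF assms(2-4) fT]) (auto simp: q)
  also have "\<dots> = (\<Oplus>\<^bsub>N\<^esub>i\<in>T. \<psi> i x \<odot>\<^bsub>N\<^esub> h (q i))"
    by (rule N.M.finsum_cong') (auto simp: q mod_hom_smult[OF assms(4)] mod_hom_closed[OF assms(4)])
  finally show ?thesis .
qed

text \<open>Choose preimages \<open>c i\<close> of the elements \<open>h (q i)\<close> and combine
  them with the coordinates \<open>\<psi> i\<close>.\<close>

lemma dual_basis_lift:
  assumes db: "dual_basis R P T q \<psi>" and P: "left_module R P" and N: "left_module R N"
    and N': "left_module R N'" and g: "g \<in> mod_hom R N N'" "g ` carrier N = carrier N'"
    and h: "h \<in> mod_hom R P N'"
  shows "\<exists>k\<in>mod_hom R P N. \<forall>x\<in>carrier P. g (k x) = h x"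
proof -
  interpret P: left_module R P by fact
  interpret N: left_module R N by fact
  interpret N': left_module R N' by fact
  have fT: "finite T" and q: "\<And>i. i \<in> T \<Longrightarrow> q i \<in> carrier P"
    and psi: "\<psi> \<in> T \<rightarrow> mod_hom R P (regular_module R)"
    using db by (auto simp: dual_basis_def)
  have psi_c [simp]: "\<psi> i x \<in> carrier R" if "i \<in> T" "x \<in> carrier P" for i x
    using mod_hom_closed[OF funcset_mem[OF psi]] that by simp
  have "\<forall>i\<in>T. \<exists>y\<in>carrier N. g y = h (q i)"
  proof
    fix i assume "i \<in> T"
    then have "h (q i) \<in> g ` carrier N" using g(2) mod_hom_closed[OF h] q by simp
    then show "\<exists>y\<in>carrier N. g y = h (q i)" by (metis imageE)
  qed
  then obtain c where c: "\<And>i. i \<in> T \<Longrightarrow> c i \<in> carrier N" "\<And>i. i \<in> T \<Longrightarrow> g (c i) = h (q i)"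
    by metis
  let ?k = "\<lambda>x\<in>carrier P. \<Oplus>\<^bsub>N\<^esub>i\<in>T. \<psi> i x \<odot>\<^bsub>N\<^esub> c i"
  show ?thesis
  proof (intro bexI[of _ ?k] ballI)
    show "?k \<in> mod_hom R P N" by (rule lincomb_hom) (use P N fT psi c in auto)
    fix x assume x: "x \<in> carrier P"
    have "g (?k x) = (\<Oplus>\<^bsub>N'\<^esub>i\<in>T. g (\<psi> i x \<odot>\<^bsub>N\<^esub> c i))"
      using x c by (simp add: mod_hom_finsum[OF N N' g(1) fT])
    also have "\<dots> = (\<Oplus>\<^bsub>N'\<^esub>i\<in>T. \<psi> i x \<odot>\<^bsub>N'\<^esub> h (q i))"
      by (rule N'.M.finsum_cong') (auto simp: x c q mod_hom_smult[OF g(1)] mod_hom_closed[OF h])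
    also have "\<dots> = h x" by (rule dual_basis_mod_hom[OF db P N' h x, symmetric])
    finally show "g (?k x) = h x" .
  qed
qed

lemma dual_basis_projective:
  "dual_basis R P T q \<psi> \<Longrightarrow> left_module R P \<Longrightarrow> projective R P"
  unfolding projective_def by (intro conjI allI impI) (assumption, elim conjE, rule dual_basis_lift)

text \<open>Projectivity splits the free cover. The coordinates of the splitting \<open>s\<close>
  are functionals, and finite generation leaves only finitely many that are not identically
  zero.\<close>

lemma projective_dual_basis:
  fixes P :: "('a, 'b) module"
  assumes "projective R P" "finitely_generated R P"
  obtains T :: "'b set" and q \<psi> where "dual_basis R P T q \<psi>"
proof -
  have P: "left_module R P" using assms(1) by (simp add: projective_def)
  interpret P: left_module R P by fact
  let ?F = "free_module R (carrier P)"
  have F: "left_module R ?F" by (rule free_left_module) (rule P.R.ring_axioms)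
  interpret F: left_module R ?F by (rule F)
  have "(\<lambda>x\<in>carrier P. x) \<in> mod_hom R P P" by (rule mod_hom_restrictI[OF P]) auto
  from projective_lift[OF assms(1) F P free_cover_hom[OF P] free_cover_surj[OF P] this]
  obtain s where s: "s \<in> mod_hom R P ?F" and cs: "\<And>x. x \<in> carrier P \<Longrightarrow> free_cover R P (s x) = x"
    by auto
  have sF: "s x \<in> carrier ?F" if "x \<in> carrier P" for x using mod_hom_closed[OF s that] .
  have sc: "s x y \<in> carrier R" if "x \<in> carrier P" "y \<in> carrier P" for x y
    using sF[OF that(1)] that(2) by (auto simp: free_module_def)
  obtain S where S: "finite S" "S \<subseteq> carrier P"
    and gen: "\<And>N. submodule N R P \<Longrightarrow> S \<subseteq> N \<Longrightarrow> N = carrier P"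
    using assms(2) unfolding finitely_generated_def by (elim exE conjE) (rule that, auto)
  \<comment> \<open>The union of the supports of \<open>s x\<close> over the finitely many
    generators \<open>x\<close>.\<close>
  define T where "T = (\<Union>x\<in>S. {y \<in> carrier P. s x y \<noteq> \<zero>\<^bsub>R\<^esub>})"
  have fT: "finite T" unfolding T_def using S sF by (auto simp: free_module_def)
  have TP: "T \<subseteq> carrier P" unfolding T_def by auto
  \<comment> \<open>The elements whose coordinates vanish outside \<open>T\<close> form a submodule
    that contains the generators, so \<open>T\<close> supports every \<open>s x\<close>.\<close>
  let ?N = "{x \<in> carrier P. \<forall>y\<in>carrier P - T. s x y = \<zero>\<^bsub>R\<^esub>}"
  have "submodule ?N R P"
    using mod_hom_zero[OF P F s]
    by (intro left_submoduleI(2)[OF P])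
      (auto simp: mod_hom_add[OF s] mod_hom_smult[OF s] free_module_def)
  moreover have "S \<subseteq> ?N" using S(2) by (auto simp: T_def)
  ultimately have N: "?N = carrier P" by (rule gen)
  have "dual_basis R P T (\<lambda>y. y) (\<lambda>y. \<lambda>x\<in>carrier P. s x y)"
    unfolding dual_basis_def
  proof (intro conjI ballI)
    show "(\<lambda>y. \<lambda>x\<in>carrier P. s x y) \<in> T \<rightarrow> mod_hom R P (regular_module R)"
      using TP by (intro funcsetI mod_hom_restrictI[OF P])
        (auto simp: sc mod_hom_add[OF s] mod_hom_smult[OF s] free_module_def)
    fix x assume x: "x \<in> carrier P"
    have "x = (\<Oplus>\<^bsub>P\<^esub>y\<in>{y \<in> carrier P. s x y \<noteq> \<zero>\<^bsub>R\<^esub>}. s x y \<odot>\<^bsub>P\<^esub> y)"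
      using cs[OF x] sF[OF x] by (simp add: free_cover_def)
    also have "\<dots> = (\<Oplus>\<^bsub>P\<^esub>y\<in>T. s x y \<odot>\<^bsub>P\<^esub> y)"
      using x N by (intro free_ext_support[OF P sF[OF x] fT TP]) auto
    finally show "(\<Oplus>\<^bsub>P\<^esub>y\<in>T. (\<lambda>x\<in>carrier P. s x y) x \<odot>\<^bsub>P\<^esub> y) = x" using x by simp
  qed (use fT TP in auto)
  then show thesis by (rule that)
qed

section \<open>Duality for finitely generated projective modules\<close>

lemma dual_simps:
  "carrier (dual R P) = mod_hom R P (regular_module R)"
  "x \<in> carrier P \<Longrightarrow> \<zero>\<^bsub>dual R P\<^esub> x = \<zero>\<^bsub>R\<^esub>"
  "x \<in> carrier P \<Longrightarrow> (g \<oplus>\<^bsub>dual R P\<^esub> h) x = g x \<oplus>\<^bsub>R\<^esub> h x"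
  "x \<in> carrier P \<Longrightarrow> (a \<odot>\<^bsub>dual R P\<^esub> g) x = g x \<otimes>\<^bsub>R\<^esub> a"
  by (simp_all add: dual_def)

lemma eval_hom:
  assumes "left_module R P" "x \<in> carrier P"
  shows "(\<lambda>g\<in>carrier (dual R P). g x) \<in>
    mod_hom (opp_ring R) (dual R P) (regular_module (opp_ring R))"
  using mod_hom_closed[OF eval_map_hom[OF assms(1)] assms(2)] assms(2)
  by (simp add: eval_map_def dual_simps(1)[of "opp_ring R"])

text \<open>The two halves of a dual basis exchange their roles: the \<open>\<psi> i\<close> become
  the generators, and evaluations at the \<open>q i\<close> become the coordinates.\<close>

lemma dual_basis_dual:
  assumes db: "dual_basis R P T q \<psi>" and P: "left_module R P"
  shows "dual_basis (opp_ring R) (dual R P) T \<psi> (\<lambda>i. \<lambda>g\<in>carrier (dual R P). g (q i))"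
proof -
  interpret P: left_module R P by fact
  have D: "left_module (opp_ring R) (dual R P)" by (rule dual_left_module[OF P])
  interpret D: left_module "opp_ring R" "dual R P" by (rule D)
  have Reg: "left_module R (regular_module R)" by (rule regular_left_module[OF P.R.ring_axioms])
  interpret Reg: left_module R "regular_module R" by (rule Reg)
  have OReg: "left_module (opp_ring R) (regular_module (opp_ring R))"
    by (rule regular_left_module[OF D.R.ring_axioms])
  have fT: "finite T" and q: "\<And>i. i \<in> T \<Longrightarrow> q i \<in> carrier P"
    and psi: "\<And>i. i \<in> T \<Longrightarrow> \<psi> i \<in> mod_hom R P (regular_module R)"
    using db by (auto simp: dual_basis_def)
  have psiD: "\<psi> i \<in> carrier (dual R P)" if "i \<in> T" for i using psi that by (simp add: dual_simps)
  have psi_c [simp]: "\<psi> i x \<in> carrier R" if "i \<in> T" "x \<in> carrier P" for i x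
    using mod_hom_closed[OF psi] that by simp
  show ?thesis unfolding dual_basis_def
  proof (intro conjI ballI)
    show "finite T" "\<psi> \<in> T \<rightarrow> carrier (dual R P)" using fT psi by (auto simp: dual_simps)
    show "(\<lambda>i. \<lambda>g\<in>carrier (dual R P). g (q i)) \<in>
        T \<rightarrow> mod_hom (opp_ring R) (dual R P) (regular_module (opp_ring R))"
      by (intro funcsetI eval_hom[OF P] q)
    fix g assume g: "g \<in> carrier (dual R P)"
    then have gh: "g \<in> mod_hom R P (regular_module R)" by (simp add: dual_simps)
    have gq [simp]: "g (q i) \<in> carrier R" if "i \<in> T" for i
      using mod_hom_closed[OF gh] q that by auto
    let ?s = "\<Oplus>\<^bsub>dual R P\<^esub>i\<in>T. g (q i) \<odot>\<^bsub>dual R P\<^esub> \<psi> i"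
    have s: "?s \<in> carrier (dual R P)"
      by (intro D.M.finsum_closed) (simp add: psiD Pi_def)
    have "?s = g"
    proof (rule mod_hom_eqI)
      show "?s \<in> mod_hom R P (regular_module R)" using s by (simp add: dual_simps)
      show "g \<in> mod_hom R P (regular_module R)" by (rule gh)
      fix x assume x: "x \<in> carrier P"
      \<comment> \<open>A finite sum in the dual is not pointwise by definition. Evaluation at
        \<open>x\<close> is linear, so it can be moved inside the sum.\<close>
      have "?s x = (\<lambda>h\<in>carrier (dual R P). h x) ?s" using s by simp
      also have "\<dots> = (\<Oplus>\<^bsub>regular_module (opp_ring R)\<^esub>i\<in>T.
          (\<lambda>h\<in>carrier (dual R P). h x) (g (q i) \<odot>\<^bsub>dual R P\<^esub> \<psi> i))"
        by (rule mod_hom_finsum[OF D OReg eval_hom[OF P x] fT])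
          (simp add: psiD Pi_def)
      also have "\<dots> = (\<Oplus>\<^bsub>regular_module R\<^esub>i\<in>T. \<psi> i x \<odot>\<^bsub>regular_module R\<^esub> g (q i))"
        unfolding finsum_regular_opp
        using x
        by (intro Reg.M.finsum_cong') (simp_all add: psiD dual_simps(4) Pi_def)
      also have "\<dots> = g x" by (rule dual_basis_mod_hom[OF db P Reg gh x, symmetric])
      finally show "?s x = g x" .
    qed
    then show "(\<Oplus>\<^bsub>dual R P\<^esub>i\<in>T. (\<lambda>g\<in>carrier (dual R P). g (q i)) g \<odot>\<^bsub>dual R P\<^esub> \<psi> i) = g"
      using g by simp
  qed
qed

text \<open>The injective half of reflexivity: an element is recovered from its coordinates.\<close>

lemma dual_basis_separates:
  assumes db: "dual_basis R P T q \<psi>" and P: "left_module R P"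
    and x: "x \<in> carrier P" and y: "y \<in> carrier P"
    and eq: "\<And>g. g \<in> mod_hom R P (regular_module R) \<Longrightarrow> g x = g y"
  shows "x = y"
proof -
  interpret P: left_module R P by fact
  have "\<And>i. i \<in> T \<Longrightarrow> \<psi> i x = \<psi> i y" and q: "\<And>i. i \<in> T \<Longrightarrow> q i \<in> carrier P"
    and c: "\<And>i. i \<in> T \<Longrightarrow> \<psi> i y \<in> carrier R"
    using db eq mod_hom_closed[of _ R P "regular_module R"] y by (auto simp: dual_basis_def Pi_def)
  then have "(\<Oplus>\<^bsub>P\<^esub>i\<in>T. \<psi> i x \<odot>\<^bsub>P\<^esub> q i) = (\<Oplus>\<^bsub>P\<^esub>i\<in>T. \<psi> i y \<odot>\<^bsub>P\<^esub> q i)"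
    by (intro P.M.finsum_cong') auto
  then show ?thesis using db x y by (simp add: dual_basis_def)
qed

text \<open>The surjective half of reflexivity. A functional on the dual is determined by its values
  on the generators \<open>\<psi> i\<close>, and these values are the coefficients of the required
  element.\<close>

lemma dual_basis_reflexive:
  assumes db: "dual_basis R P T q \<psi>" and P: "left_module R P"
    and G: "G \<in> mod_hom (opp_ring R) (dual R P) (regular_module (opp_ring R))"
  obtains x where "x \<in> carrier P" "\<And>g. g \<in> mod_hom R P (regular_module R) \<Longrightarrow> G g = g x"
proof -
  interpret P: left_module R P by fact
  have D: "left_module (opp_ring R) (dual R P)" by (rule dual_left_module[OF P])
  interpret D: left_module "opp_ring R" "dual R P" by (rule D)
  have Reg: "left_module R (regular_module R)" by (rule regular_left_module[OF P.R.ring_axioms])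
  interpret Reg: left_module R "regular_module R" by (rule Reg)
  have OReg: "left_module (opp_ring R) (regular_module (opp_ring R))"
    by (rule regular_left_module[OF D.R.ring_axioms])
  have fT: "finite T" and q [simp]: "\<And>i. i \<in> T \<Longrightarrow> q i \<in> carrier P"
    and psi: "\<And>i. i \<in> T \<Longrightarrow> \<psi> i \<in> mod_hom R P (regular_module R)"
    using db by (auto simp: dual_basis_def)
  have Gc [simp]: "G (\<psi> i) \<in> carrier R" if "i \<in> T" for i
    using mod_hom_closed[OF G] psi that by (auto simp: dual_simps)
  let ?x = "\<Oplus>\<^bsub>P\<^esub>i\<in>T. G (\<psi> i) \<odot>\<^bsub>P\<^esub> q i"
  show thesis
  proof (rule that)
    show "?x \<in> carrier P" by (intro P.M.finsum_closed) auto
    fix g assume g: "g \<in> mod_hom R P (regular_module R)"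
    then have gc [simp]: "g (q i) \<in> carrier R" if "i \<in> T" for i using mod_hom_closed[OF g] that by auto
    have gD: "g \<in> carrier (dual R P)" using g by (simp add: dual_simps)
    have "G g = (\<Oplus>\<^bsub>regular_module (opp_ring R)\<^esub>i\<in>T.
        (\<lambda>g\<in>carrier (dual R P). g (q i)) g \<odot>\<^bsub>regular_module (opp_ring R)\<^esub> G (\<psi> i))"
      by (rule dual_basis_mod_hom[OF dual_basis_dual[OF db P] D OReg G gD])
    also have "\<dots> = (\<Oplus>\<^bsub>regular_module R\<^esub>i\<in>T. g (G (\<psi> i) \<odot>\<^bsub>P\<^esub> q i))"
      unfolding finsum_regular_opp
      by (intro Reg.M.finsum_cong') (auto simp: gD mod_hom_smult[OF g])
    also have "\<dots> = g ?x" by (rule mod_hom_finsum[OF P Reg g fT, symmetric]) auto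
    finally show "G g = g ?x" .
  qed
qed

section \<open>The descending chain condition\<close>

lemma submodule_closed:
  assumes "left_module R M" "submodule N R M"
  shows "N \<subseteq> carrier M" "\<zero>\<^bsub>M\<^esub> \<in> N"
    and "\<And>x y. x \<in> N \<Longrightarrow> y \<in> N \<Longrightarrow> x \<oplus>\<^bsub>M\<^esub> y \<in> N"
    and "\<And>x. x \<in> N \<Longrightarrow> \<ominus>\<^bsub>M\<^esub> x \<in> N"
    and "\<And>a x. a \<in> carrier R \<Longrightarrow> x \<in> N \<Longrightarrow> a \<odot>\<^bsub>M\<^esub> x \<in> N"
proof -
  interpret submodule N R M by fact
  show "N \<subseteq> carrier M" "\<zero>\<^bsub>M\<^esub> \<in> N"
    and "\<And>x y. x \<in> N \<Longrightarrow> y \<in> N \<Longrightarrow> x \<oplus>\<^bsub>M\<^esub> y \<in> N"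
    and "\<And>a x. a \<in> carrier R \<Longrightarrow> x \<in> N \<Longrightarrow> a \<odot>\<^bsub>M\<^esub> x \<in> N"
    using subset one_closed m_closed smult_closed by auto
  show "\<And>x. x \<in> N \<Longrightarrow> \<ominus>\<^bsub>M\<^esub> x \<in> N"
    using m_inv_closed by (simp add: a_inv_def)
qed

text \<open>The chains consist of submodules of the whole module and are only compared inside
  \<open>N\<close>. In this way \<open>N\<close> can be enlarged step by step while the chains under
  consideration stay the same.\<close>

definition dcc_on where
  "dcc_on R M N \<longleftrightarrow> (\<forall>C :: nat \<Rightarrow> _ set.
     (\<forall>n. submodule (C n) R M \<and> C (Suc n) \<subseteq> C n) \<longrightarrow> (\<exists>n. \<forall>m\<ge>n. C n \<inter> N \<subseteq> C m))"

text \<open>The quotient of \<open>N'\<close> by \<open>N\<close> is cyclic, so a chain is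
  controlled on \<open>N'\<close> by its part in \<open>N\<close> together with a descending chain
  of ideals of R.\<close>

lemma artinian_cring_dcc_on_extend:
  fixes R (structure) and M (structure)
  assumes R: "artinian_cring R" and M: "left_module R M" and N: "submodule N R M"
    and dcc: "dcc_on R M N" and x: "x \<in> carrier M"
  defines "N' \<equiv> {y \<oplus>\<^bsub>M\<^esub> r \<odot>\<^bsub>M\<^esub> x | y r. y \<in> N \<and> r \<in> carrier R}"
  shows "submodule N' R M" "N \<subseteq> N'" "x \<in> N'" "dcc_on R M N'"
proof -
  interpret left_module R M by (rule M)
  interpret cring R using R by (simp add: artinian_cring_def)
  note n = submodule_closed[OF M N]
  have Nc: "y \<in> carrier M" if "y \<in> N" for y using n(1) that by auto
  show "submodule N' R M"
  proof (rule left_submoduleI(2)[OF M])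
    show "N' \<subseteq> carrier M" using x Nc by (auto simp: N'_def)
    show "\<zero>\<^bsub>M\<^esub> \<in> N'"
      using n(2) smult_l_null[OF x] by (force simp: N'_def)
    fix u v assume "u \<in> N'" "v \<in> N'"
    then obtain y r z s where *: "u = y \<oplus>\<^bsub>M\<^esub> r \<odot>\<^bsub>M\<^esub> x" "v = z \<oplus>\<^bsub>M\<^esub> s \<odot>\<^bsub>M\<^esub> x"
      "y \<in> N" "z \<in> N" "r \<in> carrier R" "s \<in> carrier R" by (auto simp: N'_def)
    then have "u \<oplus>\<^bsub>M\<^esub> v = (y \<oplus>\<^bsub>M\<^esub> z) \<oplus>\<^bsub>M\<^esub> (r \<oplus> s) \<odot>\<^bsub>M\<^esub> x"
      using x Nc by (simp add: smult_l_distr M.a_ac)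
    then show "u \<oplus>\<^bsub>M\<^esub> v \<in> N'" using * n(3) unfolding N'_def by blast
  next
    fix a u assume "a \<in> carrier R" "u \<in> N'"
    then obtain y r where *: "u = y \<oplus>\<^bsub>M\<^esub> r \<odot>\<^bsub>M\<^esub> x" "y \<in> N" "r \<in> carrier R" by (auto simp: N'_def)
    with \<open>a \<in> carrier R\<close> have "a \<odot>\<^bsub>M\<^esub> u = a \<odot>\<^bsub>M\<^esub> y \<oplus>\<^bsub>M\<^esub> (a \<otimes> r) \<odot>\<^bsub>M\<^esub> x"
      using x Nc by (simp add: smult_r_distr smult_assoc1)
    then show "a \<odot>\<^bsub>M\<^esub> u \<in> N'" using * n(5) \<open>a \<in> carrier R\<close> unfolding N'_def by blast
  qed
  show "N \<subseteq> N'"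
  proof
    fix y assume "y \<in> N"
    then show "y \<in> N'"
      using Nc smult_l_null[OF x] unfolding N'_def by (intro CollectI exI[of _ y] exI[of _ \<zero>]) simp
  qed
  show "x \<in> N'"
    using n(2) x unfolding N'_def by (intro CollectI exI[of _ "\<zero>\<^bsub>M\<^esub>"] exI[of _ \<one>]) simp
  show "dcc_on R M N'" unfolding dcc_on_def
  proof (intro allI impI)
    fix C :: "nat \<Rightarrow> _ set" assume C: "\<forall>n. submodule (C n) R M \<and> C (Suc n) \<subseteq> C n"
    have anti: "C m \<subseteq> C n" if "n \<le> m" for n m
      by (rule lift_Suc_antimono_le[of C]) (use C that in auto)
    have c: "submodule (C n) R M" for n using C by auto
    have Cc: "y \<in> carrier M" if "y \<in> C n" for y n using submodule_closed(1)[OF M c] that by auto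
    \<comment> \<open>The coefficients of \<open>x\<close> that occur in \<open>C n\<close> modulo
      \<open>N\<close>.\<close>
    define I where "I n = {r \<in> carrier R. \<exists>y\<in>N. y \<oplus>\<^bsub>M\<^esub> r \<odot>\<^bsub>M\<^esub> x \<in> C n}" for n
    have "ideal (I n) R" for n
    proof -
      have s: "a \<otimes> r \<in> I n" if a: "a \<in> carrier R" and r: "r \<in> I n" for a r
      proof -
        obtain y where y: "y \<in> N" "y \<oplus>\<^bsub>M\<^esub> r \<odot>\<^bsub>M\<^esub> x \<in> C n" "r \<in> carrier R" using r by (auto simp: I_def)
        have "a \<odot>\<^bsub>M\<^esub> (y \<oplus>\<^bsub>M\<^esub> r \<odot>\<^bsub>M\<^esub> x) \<in> C n" by (rule submodule_closed(5)[OF M c a y(2)])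
        then have "a \<odot>\<^bsub>M\<^esub> y \<oplus>\<^bsub>M\<^esub> (a \<otimes> r) \<odot>\<^bsub>M\<^esub> x \<in> C n"
          using a y x Nc by (simp add: smult_r_distr smult_assoc1)
        then show ?thesis using a y n(5) unfolding I_def by auto
      qed
      have Ic: "r \<in> carrier R" if "r \<in> I n" for r using that by (simp add: I_def)
      have s': "r \<otimes> a \<in> I n" if "r \<in> I n" "a \<in> carrier R" for a r
        using s[OF that(2,1)] m_comm[OF that(2) Ic[OF that(1)]] by simp
      have p: "r \<oplus> t \<in> I n" if rt: "r \<in> I n" "t \<in> I n" for r t
      proof -
        obtain y z where *: "y \<in> N" "y \<oplus>\<^bsub>M\<^esub> r \<odot>\<^bsub>M\<^esub> x \<in> C n" "r \<in> carrier R"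
          "z \<in> N" "z \<oplus>\<^bsub>M\<^esub> t \<odot>\<^bsub>M\<^esub> x \<in> C n" "t \<in> carrier R"
          using rt by (auto simp: I_def)
        have "(y \<oplus>\<^bsub>M\<^esub> r \<odot>\<^bsub>M\<^esub> x) \<oplus>\<^bsub>M\<^esub> (z \<oplus>\<^bsub>M\<^esub> t \<odot>\<^bsub>M\<^esub> x) \<in> C n"
          using submodule_closed(3)[OF M c] * by auto
        then have "(y \<oplus>\<^bsub>M\<^esub> z) \<oplus>\<^bsub>M\<^esub> (r \<oplus> t) \<odot>\<^bsub>M\<^esub> x \<in> C n"
          using * x Nc by (simp add: smult_l_distr M.a_ac)
        then show ?thesis using * n(3) unfolding I_def by auto
      qed
      have z: "\<zero> \<in> I n"
        using n(2) smult_l_null[OF x] submodule_closed(2)[OF M c] unfolding I_def by force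
      have m: "\<ominus> r \<in> I n" if "r \<in> I n" for r
        using s[of "\<ominus> \<one>" r] that by (simp add: I_def l_minus)
      have "subgroup (I n) (add_monoid R)"
        by (rule R.add.subgroupI) (use z p m in \<open>auto simp: I_def\<close>)
      then show ?thesis
        by (intro idealI) (use s s' in \<open>auto simp: ring_axioms\<close>)
    qed
    moreover have "I (Suc n) \<subseteq> I n" for n using C unfolding I_def by blast
    ultimately have "\<exists>n. \<forall>m\<ge>n. I m = I n"
      by (intro R[unfolded artinian_cring_def, THEN conjunct2, THEN spec, THEN mp]) simp
    then obtain n1 where n1: "\<And>m. m \<ge> n1 \<Longrightarrow> I m = I n1" by blast
    obtain n2 where n2: "\<And>m. m \<ge> n2 \<Longrightarrow> C n2 \<inter> N \<subseteq> C m"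
      using dcc[unfolded dcc_on_def, THEN spec, THEN mp, OF C] by blast
    let ?n = "max n1 n2"
    show "\<exists>n. \<forall>m\<ge>n. C n \<inter> N' \<subseteq> C m"
    proof (intro exI[of _ ?n] allI impI subsetI)
      fix m z assume m: "m \<ge> ?n" and z: "z \<in> C ?n \<inter> N'"
      then obtain y r where y: "z = y \<oplus>\<^bsub>M\<^esub> r \<odot>\<^bsub>M\<^esub> x" "y \<in> N" "r \<in> carrier R" by (auto simp: N'_def)
      with z have "r \<in> I ?n" by (auto simp: I_def)
      then have "r \<in> I m" using n1[of m] n1[of ?n] m by simp
      then obtain y' where y': "y' \<in> N" "y' \<oplus>\<^bsub>M\<^esub> r \<odot>\<^bsub>M\<^esub> x \<in> C m" by (auto simp: I_def)
      \<comment> \<open>\<open>z\<close> and \<open>?w\<close> have the same coefficient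
        \<open>r\<close> at \<open>x\<close>. Their difference therefore lies in \<open>N\<close>,
        where the chain is stationary from \<open>n2\<close> on.\<close>
      let ?w = "y' \<oplus>\<^bsub>M\<^esub> r \<odot>\<^bsub>M\<^esub> x"
      have "?w \<in> C ?n" using y'(2) anti[OF m] by auto
      then have "z \<oplus>\<^bsub>M\<^esub> \<ominus>\<^bsub>M\<^esub> ?w \<in> C ?n"
        using z submodule_closed(3,4)[OF M c] by auto
      moreover have eq: "z \<oplus>\<^bsub>M\<^esub> \<ominus>\<^bsub>M\<^esub> ?w = y \<oplus>\<^bsub>M\<^esub> \<ominus>\<^bsub>M\<^esub> y'"
      proof -
        have "z \<oplus>\<^bsub>M\<^esub> \<ominus>\<^bsub>M\<^esub> ?w = (y \<oplus>\<^bsub>M\<^esub> \<ominus>\<^bsub>M\<^esub> y') \<oplus>\<^bsub>M\<^esub> (r \<odot>\<^bsub>M\<^esub> x \<oplus>\<^bsub>M\<^esub> \<ominus>\<^bsub>M\<^esub> (r \<odot>\<^bsub>M\<^esub> x))"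
          using y y' x Nc by (simp add: M.minus_add M.a_ac del: M.r_neg)
        then show ?thesis using y y' x Nc by (simp add: M.r_neg)
      qed
      ultimately have "z \<oplus>\<^bsub>M\<^esub> \<ominus>\<^bsub>M\<^esub> ?w \<in> C ?n \<inter> N" using n y y' by simp
      then have "z \<oplus>\<^bsub>M\<^esub> \<ominus>\<^bsub>M\<^esub> ?w \<in> C m"
        using n2[of m] anti[of n2 ?n] m by auto
      then have "(z \<oplus>\<^bsub>M\<^esub> \<ominus>\<^bsub>M\<^esub> ?w) \<oplus>\<^bsub>M\<^esub> ?w \<in> C m"
        using y'(2) submodule_closed(3)[OF M c] by auto
      moreover have "z \<in> carrier M" "?w \<in> carrier M" using z Cc y' by auto
      ultimately show "z \<in> C m" by (simp add: M.a_assoc M.l_neg)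
    qed
  qed
qed

text \<open>Start with the zero submodule and adjoin the generators one at a time.\<close>

lemma finitely_generated_dcc:
  assumes R: "artinian_cring R" and M: "left_module R M" and fg: "finitely_generated R M"
  shows "dcc_on R M (carrier M)"
proof -
  interpret left_module R M by (rule M)
  have "\<exists>N. submodule N R M \<and> S \<subseteq> N \<and> dcc_on R M N" if "finite S" "S \<subseteq> carrier M" for S
    using that
  proof (induction S)
    case empty
    have "submodule {\<zero>\<^bsub>M\<^esub>} R M" by (rule left_submoduleI(2)[OF M]) (auto simp: smult_r_null)
    moreover have "dcc_on R M {\<zero>\<^bsub>M\<^esub>}"
      using submodule_closed(2)[OF M] unfolding dcc_on_def by blast
    ultimately show ?case by blast
  next
    case (insert x S)
    then obtain N where "submodule N R M" "S \<subseteq> N" "dcc_on R M N" by auto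
    with insert.prems show ?case
      using artinian_cring_dcc_on_extend[OF R M, of N x] by blast
  qed
  moreover obtain S where "finite S" "S \<subseteq> carrier M"
    and gen: "\<And>N. submodule N R M \<Longrightarrow> S \<subseteq> N \<Longrightarrow> N = carrier M"
    using fg unfolding finitely_generated_def by (elim exE conjE) (rule that, auto)
  ultimately obtain N where "submodule N R M" "S \<subseteq> N" "dcc_on R M N" by blast
  then show ?thesis using gen by blast
qed

section \<open>Minimal principal ideals and idempotents in an Artin algebra\<close>

context
  fixes \<Lambda> :: "('a, 'r) ring_scheme" (structure)
  assumes artin: "artin_algebra \<Lambda>"
begin

interpretation ring \<Lambda> using artin by (simp add: artin_algebra_def)

lemma center_regular_module: "left_module (center \<Lambda>) (regular_module \<Lambda>)"
proof -
  interpret Reg: left_module \<Lambda> "regular_module \<Lambda>" by (rule regular_left_module[OF ring_axioms])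
  have "ring (center \<Lambda>)"
    using artin by (simp add: artin_algebra_def artinian_cring_def cring_def)
  moreover have "a \<in> carrier \<Lambda>" if "a \<in> carrier (center \<Lambda>)" for a
    using that by (simp add: center_def)
  moreover have "add (center \<Lambda>) = add \<Lambda>" "mult (center \<Lambda>) = mult \<Lambda>" "\<one>\<^bsub>center \<Lambda>\<^esub> = \<one>"
    by (simp_all add: center_def)
  ultimately show ?thesis
    by (intro left_moduleI) (simp_all add: Reg.M.abelian_group_axioms l_distr r_distr m_assoc)
qed

text \<open>Left ideals and right ideals are both submodules over the center, so this one chain
  condition serves for either side.\<close>

lemma artin_algebra_chain:
  assumes "\<And>n. submodule (C n) (center \<Lambda>) (regular_module \<Lambda>)" "\<And>n. C (Suc n) \<subseteq> C n"
  obtains n where "\<And>m. n \<le> m \<Longrightarrow> C n \<subseteq> C m"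
proof -
  have "dcc_on (center \<Lambda>) (regular_module \<Lambda>) (carrier (regular_module \<Lambda>))"
    by (rule finitely_generated_dcc[OF _ center_regular_module])
      (use artin in \<open>simp_all add: artin_algebra_def\<close>)
  from this[unfolded dcc_on_def, THEN spec, THEN mp, of C] assms
  obtain n where "\<And>m. n \<le> m \<Longrightarrow> C n \<inter> carrier \<Lambda> \<subseteq> C m" by auto
  moreover have "C n \<subseteq> carrier \<Lambda>"
    using submodule_closed(1)[OF center_regular_module assms(1)] by simp
  ultimately show thesis using that by blast
qed

lemma principal_right_submodule:
  assumes "a \<in> carrier \<Lambda>"
  shows "submodule ((\<lambda>r. a \<otimes> r) ` carrier \<Lambda>) (center \<Lambda>) (regular_module \<Lambda>)"
proof (rule left_submoduleI(2)[OF center_regular_module])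
  show "\<zero>\<^bsub>regular_module \<Lambda>\<^esub> \<in> (\<lambda>r. a \<otimes> r) ` carrier \<Lambda>"
    using assms by (intro image_eqI[of _ _ \<zero>]) auto
next
  fix x y assume "x \<in> (\<lambda>r. a \<otimes> r) ` carrier \<Lambda>" "y \<in> (\<lambda>r. a \<otimes> r) ` carrier \<Lambda>"
  then show "x \<oplus>\<^bsub>regular_module \<Lambda>\<^esub> y \<in> (\<lambda>r. a \<otimes> r) ` carrier \<Lambda>"
    using assms by (auto simp: r_distr[symmetric])
next
  fix z x assume z: "z \<in> carrier (center \<Lambda>)" and "x \<in> (\<lambda>r. a \<otimes> r) ` carrier \<Lambda>"
  then obtain r where r: "x = a \<otimes> r" "r \<in> carrier \<Lambda>" by auto
  have zc: "z \<in> carrier \<Lambda>" "z \<otimes> a = a \<otimes> z" using z assms unfolding center_def by simp_all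
  have "z \<otimes> (a \<otimes> r) = a \<otimes> (z \<otimes> r)"
    using zc r assms by (simp add: m_assoc[symmetric])
  then show "z \<odot>\<^bsub>regular_module \<Lambda>\<^esub> x \<in> (\<lambda>r. a \<otimes> r) ` carrier \<Lambda>"
    using zc r by auto
qed (use assms in auto)

lemma principal_left_submodule:
  assumes "a \<in> carrier \<Lambda>"
  shows "submodule ((\<lambda>r. r \<otimes> a) ` carrier \<Lambda>) (center \<Lambda>) (regular_module \<Lambda>)"
proof (rule left_submoduleI(2)[OF center_regular_module])
  show "\<zero>\<^bsub>regular_module \<Lambda>\<^esub> \<in> (\<lambda>r. r \<otimes> a) ` carrier \<Lambda>"
    using assms by (intro image_eqI[of _ _ \<zero>]) auto
next
  fix x y assume "x \<in> (\<lambda>r. r \<otimes> a) ` carrier \<Lambda>" "y \<in> (\<lambda>r. r \<otimes> a) ` carrier \<Lambda>"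
  then show "x \<oplus>\<^bsub>regular_module \<Lambda>\<^esub> y \<in> (\<lambda>r. r \<otimes> a) ` carrier \<Lambda>"
    using assms by (auto simp: l_distr[symmetric])
next
  have cc: "z \<in> carrier \<Lambda>" if "z \<in> carrier (center \<Lambda>)" for z
    using that by (simp add: center_def)
  fix z x assume "z \<in> carrier (center \<Lambda>)" "x \<in> (\<lambda>r. r \<otimes> a) ` carrier \<Lambda>"
  then show "z \<odot>\<^bsub>regular_module \<Lambda>\<^esub> x \<in> (\<lambda>r. r \<otimes> a) ` carrier \<Lambda>"
    using assms by (auto simp: cc m_assoc[symmetric])
qed (use assms in auto)

text \<open>The conclusion says that \<open>r \<otimes> a\<close> generates the same right ideal as
  \<open>r\<close>. If no such \<open>r\<close> existed, repeated multiplication on the right would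
  give an infinite strictly descending chain of principal right ideals.\<close>

lemma artin_algebra_right_minimal:
  assumes "r\<^sub>0 \<in> carrier \<Lambda>" "P r\<^sub>0"
  obtains r where "r \<in> carrier \<Lambda>" "P r"
    "\<And>a. a \<in> carrier \<Lambda> \<Longrightarrow> P (r \<otimes> a) \<Longrightarrow> \<exists>b\<in>carrier \<Lambda>. r \<otimes> a \<otimes> b = r"
proof -
  have "\<exists>r\<in>carrier \<Lambda>. P r \<and> (\<forall>a\<in>carrier \<Lambda>. P (r \<otimes> a) \<longrightarrow> (\<exists>b\<in>carrier \<Lambda>. r \<otimes> a \<otimes> b = r))"
  proof (rule ccontr)
    assume no: "\<not> ?thesis"
    have step: "\<exists>y. (y \<in> carrier \<Lambda> \<and> P y) \<and>
        (\<exists>a\<in>carrier \<Lambda>. y = x \<otimes> a \<and> (\<forall>b\<in>carrier \<Lambda>. x \<otimes> a \<otimes> b \<noteq> x))"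
      if x: "x \<in> carrier \<Lambda> \<and> P x" for x
    proof -
      from no x obtain a where "a \<in> carrier \<Lambda>" "P (x \<otimes> a)" "\<forall>b\<in>carrier \<Lambda>. x \<otimes> a \<otimes> b \<noteq> x"
        by auto
      with x show ?thesis by (intro exI[of _ "x \<otimes> a"]) auto
    qed
    \<comment> \<open>Dependent choice: \<open>s n\<close> never lies in the right ideal generated
      by \<open>s (Suc n)\<close>.\<close>
    have "\<exists>s. \<forall>n :: nat. (s n \<in> carrier \<Lambda> \<and> P (s n)) \<and>
        (\<exists>a\<in>carrier \<Lambda>. s (Suc n) = s n \<otimes> a \<and> (\<forall>b\<in>carrier \<Lambda>. s n \<otimes> a \<otimes> b \<noteq> s n))"
      using assms step by (intro dependent_nat_choice[of "\<lambda>_ r. r \<in> carrier \<Lambda> \<and> P r"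
          "\<lambda>_ r r'. \<exists>a\<in>carrier \<Lambda>. r' = r \<otimes> a \<and> (\<forall>b\<in>carrier \<Lambda>. r \<otimes> a \<otimes> b \<noteq> r)"]) auto
    then obtain s where s: "\<And>n :: nat. s n \<in> carrier \<Lambda>"
      and step: "\<And>n. \<exists>a\<in>carrier \<Lambda>. s (Suc n) = s n \<otimes> a \<and> (\<forall>b\<in>carrier \<Lambda>. s n \<otimes> a \<otimes> b \<noteq> s n)"
      by auto
    define C where "C n = (\<lambda>r. s n \<otimes> r) ` carrier \<Lambda>" for n
    have C_Suc: "C (Suc n) \<subseteq> C n" for n
      using step[of n] s[of n] by (auto simp: C_def m_assoc)
    have C_sub: "submodule (C n) (center \<Lambda>) (regular_module \<Lambda>)" for n
      unfolding C_def by (rule principal_right_submodule[OF s])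
    obtain n where n: "\<And>m. n \<le> m \<Longrightarrow> C n \<subseteq> C m"
      by (rule artin_algebra_chain[of C, OF C_sub C_Suc]) (rule that, blast)
    have "s n \<in> C n" unfolding C_def using s[of n] by (intro image_eqI[of _ _ \<one>]) auto
    then have "s n \<in> C (Suc n)" using n[of "Suc n"] by auto
    then show False using step[of n] by (auto simp: C_def)
  qed
  then show thesis using that by blast
qed

text \<open>Once \<open>\<Lambda> a\<^sup>n\<close> and \<open>a\<^sup>n \<Lambda>\<close> are stationary, \<open>u = a\<^sup>n\<close> satisfies
  \<open>u = b u\<^sup>2 = u\<^sup>2 c\<close>, and then \<open>b u = u c\<close> is idempotent.\<close>

lemma artin_algebra_idempotent:
  assumes a: "a \<in> carrier \<Lambda>" and nil: "\<And>n :: nat. a [^] n \<noteq> \<zero>"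
  obtains w where "w \<in> carrier \<Lambda>" "(a \<otimes> w) \<otimes> (a \<otimes> w) = a \<otimes> w" "a \<otimes> w \<noteq> \<zero>"
proof -
  define C where "C n = (\<lambda>r. a [^] (n::nat) \<otimes> r) ` carrier \<Lambda>" for n
  define D where "D n = (\<lambda>r. r \<otimes> a [^] (n::nat)) ` carrier \<Lambda>" for n
  have p: "a [^] n \<in> carrier \<Lambda>" for n :: nat using a by simp
  have C_Suc: "C (Suc n) \<subseteq> C n" for n using a by (auto simp: C_def m_assoc)
  have C_sub: "submodule (C n) (center \<Lambda>) (regular_module \<Lambda>)" for n
    unfolding C_def by (rule principal_right_submodule[OF p])
  obtain n1 where n1: "\<And>m. n1 \<le> m \<Longrightarrow> C n1 \<subseteq> C m"
    by (rule artin_algebra_chain[of C, OF C_sub C_Suc]) (rule that, blast)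
  have pow_Suc: "a [^] Suc k = a \<otimes> a [^] k" for k :: nat by (rule nat_pow_Suc2[OF a])
  have "r \<otimes> a [^] Suc k = (r \<otimes> a) \<otimes> a [^] k" if "r \<in> carrier \<Lambda>" for r and k :: nat
    unfolding pow_Suc using a that by (simp add: m_assoc)
  then have D_Suc: "D (Suc n) \<subseteq> D n" for n
    unfolding D_def using a by (intro image_subsetI) (metis imageI m_closed)
  have D_sub: "submodule (D n) (center \<Lambda>) (regular_module \<Lambda>)" for n
    unfolding D_def by (rule principal_left_submodule[OF p])
  obtain n2 where n2: "\<And>m. n2 \<le> m \<Longrightarrow> D n2 \<subseteq> D m"
    by (rule artin_algebra_chain[of D, OF D_sub D_Suc]) (rule that, blast)
  \<comment> \<open>The successor keeps the exponent positive, so that a factor \<open>a\<close> can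
    be split off \<open>u\<close> on the left at the end.\<close>
  define n where "n = Suc (max n1 n2)"
  have n12: "n1 \<le> n" "n2 \<le> n" "n1 \<le> n + n" "n2 \<le> n + n" by (simp_all add: n_def)
  define u where "u = a [^] n"
  have u: "u \<in> carrier \<Lambda>" by (simp add: u_def p)
  have uu: "a [^] (n + n) = u \<otimes> u" using a by (simp add: u_def nat_pow_mult)
  have anti: "C m \<subseteq> C k" "D m \<subseteq> D k" if "k \<le> m" for k m
    using lift_Suc_antimono_le[of C] lift_Suc_antimono_le[of D] C_Suc D_Suc that by simp_all
  have "u \<in> C n" "u \<in> D n"
    unfolding C_def D_def u_def using p by (auto intro: image_eqI[of _ _ \<one>])
  then have "u \<in> C (n + n)" "u \<in> D (n + n)"
    using anti(1)[of n1 n] anti(2)[of n2 n] n1[of "n + n"] n2[of "n + n"] n12 by auto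
  then obtain b c where b: "b \<in> carrier \<Lambda>" "u = b \<otimes> (u \<otimes> u)" and c: "c \<in> carrier \<Lambda>" "u = (u \<otimes> u) \<otimes> c"
    unfolding C_def D_def uu by auto
  have "b \<otimes> u = b \<otimes> (u \<otimes> u \<otimes> c)" by (rule arg_cong[OF c(2)])
  also have "\<dots> = b \<otimes> (u \<otimes> u) \<otimes> c" using b(1) c(1) u by (simp add: m_assoc)
  also have "\<dots> = u \<otimes> c" by (simp only: b(2)[symmetric])
  finally have bc: "b \<otimes> u = u \<otimes> c" .
  have "(u \<otimes> c) \<otimes> (u \<otimes> c) = (b \<otimes> u) \<otimes> (u \<otimes> c)" by (simp add: bc)
  also have "\<dots> = b \<otimes> (u \<otimes> u) \<otimes> c" using b(1) c(1) u by (simp add: m_assoc)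
  also have "\<dots> = u \<otimes> c" by (simp only: b(2)[symmetric])
  finally have idem: "(u \<otimes> c) \<otimes> (u \<otimes> c) = u \<otimes> c" .
  have "u \<otimes> c \<noteq> \<zero>"
  proof
    assume "u \<otimes> c = \<zero>"
    then have "u \<otimes> u \<otimes> c = \<zero>" using u c(1) by (simp add: m_assoc)
    then have "u = \<zero>" by (rule trans[OF c(2)])
    then show False using nil by (simp add: u_def)
  qed
  moreover have "u \<otimes> c = a \<otimes> (a [^] (max n1 n2) \<otimes> c)"
    using a c(1) p unfolding u_def n_def pow_Suc by (simp add: m_assoc)
  ultimately show thesis
    using idem that[of "a [^] (max n1 n2) \<otimes> c"] c(1) p by (metis m_closed)
qed

text \<open>Minimality gives \<open>r = r \<otimes> (a \<otimes> b)\<close>, so \<open>r\<close> is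
  fixed by all powers of \<open>a \<otimes> b\<close>, and a nilpotent \<open>a \<otimes> b\<close>
  would force \<open>r\<close> to be zero, against \<open>P r\<close>. The idempotent obtained from
  \<open>a \<otimes> b\<close> has \<open>a\<close> as a left factor.\<close>

lemma artin_algebra_right_minimal_idempotent:
  assumes "r\<^sub>0 \<in> carrier \<Lambda>" "P r\<^sub>0" "\<not> P \<zero>"
  obtains r where "r \<in> carrier \<Lambda>" "P r"
    "\<And>a. a \<in> carrier \<Lambda> \<Longrightarrow> P (r \<otimes> a) \<Longrightarrow>
      \<exists>w\<in>carrier \<Lambda>. (a \<otimes> w) \<otimes> (a \<otimes> w) = a \<otimes> w \<and> a \<otimes> w \<noteq> \<zero>"
proof -
  obtain r where r: "r \<in> carrier \<Lambda>" "P r"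
    and min: "\<And>a. a \<in> carrier \<Lambda> \<Longrightarrow> P (r \<otimes> a) \<Longrightarrow> \<exists>b\<in>carrier \<Lambda>. r \<otimes> a \<otimes> b = r"
    by (rule artin_algebra_right_minimal[OF assms(1), of P]) (use assms(2) in auto)
  show thesis
  proof (rule that[OF r])
    fix a assume a: "a \<in> carrier \<Lambda>" and "P (r \<otimes> a)"
    then obtain b where b: "b \<in> carrier \<Lambda>" "r \<otimes> a \<otimes> b = r" using min by blast
    have rab: "r \<otimes> (a \<otimes> b) = r" using b r(1) a by (simp add: m_assoc)
    have ab: "a \<otimes> b \<in> carrier \<Lambda>" using a b(1) by simp
    have pow: "r \<otimes> (a \<otimes> b) [^] n = r" for n :: nat
    proof (induction n)
      case (Suc n)
      have "r \<otimes> (a \<otimes> b) [^] Suc n = (r \<otimes> (a \<otimes> b) [^] n) \<otimes> (a \<otimes> b)"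
        unfolding nat_pow_Suc by (rule m_assoc[symmetric]) (use r(1) ab in simp_all)
      also have "\<dots> = r" by (simp only: Suc rab)
      finally show ?case .
    qed (use r in simp)
    have nil: "(a \<otimes> b) [^] n \<noteq> \<zero>" for n :: nat
    proof
      assume "(a \<otimes> b) [^] n = \<zero>"
      with pow[of n] r(1) have "r = \<zero>" by simp
      with r(2) assms(3) show False by simp
    qed
    obtain w where w: "w \<in> carrier \<Lambda>" "(a \<otimes> b \<otimes> w) \<otimes> (a \<otimes> b \<otimes> w) = a \<otimes> b \<otimes> w" "a \<otimes> b \<otimes> w \<noteq> \<zero>"
      by (rule artin_algebra_idempotent[OF ab nil]) (rule that)
    then show "\<exists>w\<in>carrier \<Lambda>. (a \<otimes> w) \<otimes> (a \<otimes> w) = a \<otimes> w \<and> a \<otimes> w \<noteq> \<zero>"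
      unfolding m_assoc[OF a b(1) w(1)] using b(1) by (intro bexI[of _ "b \<otimes> w"] conjI m_closed)
  qed
qed

end

section \<open>Extension groups and presentations\<close>

lemma mod_hom_image_submodule:
  assumes M: "left_module R M" and N: "left_module R N" and h: "h \<in> mod_hom R M N"
  shows "submodule (h ` carrier M) R N"
proof -
  interpret M: left_module R M by fact
  show ?thesis
  proof (rule left_submoduleI(2)[OF N])
    show "h ` carrier M \<subseteq> carrier N" using mod_hom_closed[OF h] by auto
    show "\<zero>\<^bsub>N\<^esub> \<in> h ` carrier M" using mod_hom_zero[OF M N h] by (metis imageI M.M.zero_closed)
    show "x \<oplus>\<^bsub>N\<^esub> y \<in> h ` carrier M" if "x \<in> h ` carrier M" "y \<in> h ` carrier M" for x y
      using that by (auto simp: mod_hom_add[OF h, symmetric])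
    show "a \<odot>\<^bsub>N\<^esub> x \<in> h ` carrier M" if "a \<in> carrier R" "x \<in> h ` carrier M" for a x
      using that by (auto simp: mod_hom_smult[OF h, symmetric])
  qed
qed

lemma mod_hom_plus:
  assumes "left_module R M" "left_module R N" "g \<in> mod_hom R M N" "h \<in> mod_hom R M N"
  shows "(\<lambda>x\<in>carrier M. g x \<oplus>\<^bsub>N\<^esub> h x) \<in> mod_hom R M N"
proof -
  interpret comm_group "hom_group R M N" by (rule hom_group_comm_group) fact+
  show ?thesis using m_closed[of g h] assms(3,4) by (simp add: hom_group_def)
qed

lemma mod_hom_uminus:
  assumes M: "left_module R M" and N: "left_module R N" and h: "h \<in> mod_hom R M N"
  shows "(\<lambda>x\<in>carrier M. \<ominus>\<^bsub>N\<^esub> h x) \<in> mod_hom R M N"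
proof -
  interpret M: left_module R M by fact
  interpret N: left_module R N by fact
  show ?thesis
    by (rule mod_hom_restrictI[OF M])
      (auto simp: mod_hom_closed[OF h] mod_hom_add[OF h] mod_hom_smult[OF h] N.M.minus_add N.smult_r_minus)
qed

lemma mod_hom_composeI:
  assumes "left_module R M" "g \<in> mod_hom R M N" "h \<in> mod_hom R N L"
  shows "(\<lambda>x\<in>carrier M. h (g x)) \<in> mod_hom R M L"
  using mod_hom_compose[OF assms(3,2,1)] by (simp add: compose_def)

lemma a_kernel_iff: "x \<in> a_kernel Q X e \<longleftrightarrow> x \<in> carrier Q \<and> e x = \<zero>\<^bsub>X\<^esub>"
  by (auto simp: a_kernel_def kernel_def)

lemma mod_hom_kernelI:
  assumes "t \<in> mod_hom R N Q" "\<And>x. x \<in> carrier N \<Longrightarrow> e (t x) = \<zero>\<^bsub>X\<^esub>"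
  shows "t \<in> mod_hom R N (Q\<lparr>carrier := a_kernel Q X e\<rparr>)"
  using assms by (auto simp: mod_hom_def a_kernel_iff PiE_def Pi_def)

text \<open>If \<open>Q1 \<rightarrow> Q \<rightarrow> X \<rightarrow> 0\<close> is exact with \<open>Q\<close> projective, \<open>ext_vanishes R Q1 d Q Y\<close> says that
  \<open>Ext1(X, Y) = 0\<close>; nothing is required of \<open>Q1\<close>, because maps that vanish on \<open>ker d\<close> are maps
  on the first syzygy.\<close>

definition ext_vanishes where
  "ext_vanishes R Q1 d Q Y \<longleftrightarrow> (\<forall>h\<in>mod_hom R Q1 Y.
     (\<forall>z\<in>carrier Q1. d z = \<zero>\<^bsub>Q\<^esub> \<longrightarrow> h z = \<zero>\<^bsub>Y\<^esub>) \<longrightarrow> (\<exists>g\<in>mod_hom R Q Y. \<forall>z\<in>carrier Q1. h z = g (d z)))"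

text \<open>Independence of the presentation. Projectivity enters through the comparison maps
  \<open>u\<close> and \<open>v\<close> over X. A map \<open>k\<close> on the kernel of
  \<open>e\<close> splits as k u v + k (1 - u v): the first summand extends to Q by hypothesis, and
  the second is defined on all of Q.\<close>

lemma ext_vanishes_transfer:
  assumes Q1: "left_module R Q1" and Q: "left_module R Q" and F1: "left_module R F1"
    and F: "left_module R F" and X: "left_module R X" and Y: "left_module R Y"
    and d: "d \<in> mod_hom R Q1 Q" and e: "e \<in> mod_hom R Q X"
    and de: "d ` carrier Q1 = a_kernel Q X e"
    and b: "b \<in> mod_hom R F1 F" and c: "c \<in> mod_hom R F X"
    and bc: "b ` carrier F1 = a_kernel F X c"
    and u: "u \<in> mod_hom R F Q" and eu: "\<And>z. z \<in> carrier F \<Longrightarrow> e (u z) = c z"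
    and v: "v \<in> mod_hom R Q F" and cv: "\<And>z. z \<in> carrier Q \<Longrightarrow> c (v z) = e z"
    and ext: "ext_vanishes R F1 b F Y"
  shows "ext_vanishes R Q1 d Q Y"
  unfolding ext_vanishes_def
proof (intro ballI impI)
  interpret Q: left_module R Q by fact
  interpret X: left_module R X by fact
  interpret Y: left_module R Y by fact
  fix h assume h: "h \<in> mod_hom R Q1 Y"
    and hk: "\<forall>z\<in>carrier Q1. d z = \<zero>\<^bsub>Q\<^esub> \<longrightarrow> h z = \<zero>\<^bsub>Y\<^esub>"
  let ?K = "Q\<lparr>carrier := a_kernel Q X e\<rparr>"
  have K: "left_module R ?K" by (rule kernel_left_module[OF Q X e])
  have dK: "d \<in> mod_hom R Q1 ?K"
    by (rule mod_hom_kernelI[OF d]) (use de in \<open>auto simp: a_kernel_iff\<close>)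
  \<comment> \<open>\<open>h\<close> vanishes on the kernel of \<open>d\<close>, so it descends to
    the image of \<open>d\<close>, which is the kernel of \<open>e\<close>.\<close>
  obtain k where k: "k \<in> mod_hom R ?K Y" and kd: "\<And>z. z \<in> carrier Q1 \<Longrightarrow> k (d z) = h z"
    by (rule mod_hom_factor[OF Q1 K Y dK _ h]) (use de hk in auto)
  have ub: "(\<lambda>z\<in>carrier F1. u (b z)) \<in> mod_hom R F1 ?K"
    using bc mod_hom_closed[OF b]
    by (intro mod_hom_kernelI mod_hom_composeI[OF F1 b u]) (auto simp: eu a_kernel_iff)
  \<comment> \<open>The map on \<open>F1\<close> that corresponds to \<open>k\<close>; the
    hypothesis \<open>ext\<close> is applied to it.\<close>
  have kub: "(\<lambda>z\<in>carrier F1. k ((\<lambda>z\<in>carrier F1. u (b z)) z)) \<in> mod_hom R F1 Y" (is "?h \<in> _")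
    by (rule mod_hom_composeI[OF F1 ub k])
  have "?h z = \<zero>\<^bsub>Y\<^esub>" if "z \<in> carrier F1" "b z = \<zero>\<^bsub>F\<^esub>" for z
    using that mod_hom_zero[OF F Q u] mod_hom_zero[OF K Y k] by simp
  with ext kub obtain g where g: "g \<in> mod_hom R F Y"
    and gb: "\<And>z. z \<in> carrier F1 \<Longrightarrow> k (u (b z)) = g (b z)"
    unfolding ext_vanishes_def by (auto dest!: bspec[where x = ?h])
  \<comment> \<open>This is 1 - u v, with values in the kernel of \<open>e\<close> because e u v =
    e. The nested abstractions match the form of the closure rules for homomorphisms.\<close>
  define t where "t = (\<lambda>x\<in>carrier Q. (\<lambda>x\<in>carrier Q. x) x \<oplus>\<^bsub>Q\<^esub> (\<lambda>x\<in>carrier Q. \<ominus>\<^bsub>Q\<^esub> (\<lambda>x\<in>carrier Q. u (v x)) x) x)"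
  have uvc: "u (v x) \<in> carrier Q" if "x \<in> carrier Q" for x
    using that mod_hom_closed[OF u] mod_hom_closed[OF v] by simp
  have euv: "e (u (v x)) = e x" if "x \<in> carrier Q" for x
    using that eu cv mod_hom_closed[OF v] by simp
  have t: "t x = x \<oplus>\<^bsub>Q\<^esub> \<ominus>\<^bsub>Q\<^esub> u (v x)" if "x \<in> carrier Q" for x using that by (simp add: t_def)
  have "t \<in> mod_hom R Q Q" unfolding t_def
    by (intro mod_hom_plus[OF Q Q] mod_hom_uminus[OF Q Q] mod_hom_composeI[OF Q v u])
      (rule mod_hom_restrictI[OF Q], auto)
  then have tK: "t \<in> mod_hom R Q ?K"
    by (rule mod_hom_kernelI)
      (simp add: t uvc euv mod_hom_add[OF e] mod_hom_minus[OF Q X e] mod_hom_closed[OF e] X.M.r_neg)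
  \<comment> \<open>The extension g v + k t. On \<open>d z\<close> the map \<open>g\<close> after
    \<open>v\<close> agrees with k u v, because \<open>v (d z)\<close> lies in the image of
    \<open>b\<close>.\<close>
  define G where "G = (\<lambda>x\<in>carrier Q. (\<lambda>x\<in>carrier Q. g (v x)) x \<oplus>\<^bsub>Y\<^esub> (\<lambda>x\<in>carrier Q. k (t x)) x)"
  show "\<exists>g\<in>mod_hom R Q Y. \<forall>z\<in>carrier Q1. h z = g (d z)"
  proof (intro bexI[of _ G] ballI)
    show "G \<in> mod_hom R Q Y" unfolding G_def
      by (intro mod_hom_plus[OF Q Y] mod_hom_composeI[OF Q v g] mod_hom_composeI[OF Q tK k])
    fix z assume z: "z \<in> carrier Q1"
    have dz: "d z \<in> carrier Q" "e (d z) = \<zero>\<^bsub>X\<^esub>" using de z by (auto simp: a_kernel_iff)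
    have "v (d z) \<in> a_kernel F X c"
      using dz mod_hom_closed[OF v] by (simp add: a_kernel_iff cv)
    then obtain w where w: "w \<in> carrier F1" "v (d z) = b w" using bc by (metis imageE)
    have uvK: "u (v (d z)) \<in> carrier ?K" using dz uvc euv by (simp add: a_kernel_iff)
    have tzK: "t (d z) \<in> carrier ?K" by (rule mod_hom_closed[OF tK dz(1)])
    have "u (v (d z)) \<oplus>\<^bsub>?K\<^esub> t (d z) = d z"
      using dz uvc by (simp add: t Q.M.r_neg Q.M.a_lcomm)
    then have "k (u (v (d z))) \<oplus>\<^bsub>Y\<^esub> k (t (d z)) = h z"
      using mod_hom_add[OF k uvK tzK] kd[OF z] by simp
    then show "h z = G (d z)" using dz w gb by (simp add: G_def)
  qed
qed

text \<open>The basis of the free module may be infinite, so the lift is given directly: each basis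
  element goes to a chosen preimage under \<open>e\<close>.\<close>

lemma free_cover_lift:
  assumes X: "left_module R X" and Q: "left_module R Q"
    and e: "e \<in> mod_hom R Q X" "e ` carrier Q = carrier X"
  obtains u where "u \<in> mod_hom R (free_module R (carrier X)) Q"
    "\<And>z. z \<in> carrier (free_module R (carrier X)) \<Longrightarrow> e (u z) = free_cover R X z"
proof -
  interpret X: left_module R X by fact
  interpret Q: left_module R Q by fact
  let ?F = "free_module R (carrier X)"
  define s where "s = inv_into (carrier Q) e"
  have s: "s x \<in> carrier Q" "e (s x) = x" if "x \<in> carrier X" for x
    using that unfolding s_def e(2)[symmetric] by (auto intro: inv_into_into f_inv_into_f)
  show thesis
  proof (rule that)
    show "free_ext R Q (carrier X) s \<in> mod_hom R ?F Q"
      by (rule free_ext_hom[OF Q]) (simp add: s)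
    fix z assume z: "z \<in> carrier ?F"
    let ?T = "{x \<in> carrier X. z x \<noteq> \<zero>\<^bsub>R\<^esub>}"
    have T: "finite ?T" and zc: "\<And>x. x \<in> carrier X \<Longrightarrow> z x \<in> carrier R"
      using z by (auto simp: free_module_def)
    have "e (free_ext R Q (carrier X) s z) = (\<Oplus>\<^bsub>X\<^esub>x\<in>?T. e (z x \<odot>\<^bsub>Q\<^esub> s x))"
      unfolding free_ext_def restrict_apply'[OF z]
      by (rule mod_hom_finsum[OF Q X e(1) T]) (auto simp: zc s)
    also have "\<dots> = (\<Oplus>\<^bsub>X\<^esub>x\<in>?T. z x \<odot>\<^bsub>X\<^esub> x)"
      by (rule X.M.finsum_cong') (auto simp: zc s mod_hom_smult[OF e(1)])
    also have "\<dots> = free_cover R X z"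
      unfolding free_cover_def restrict_apply'[OF z] ..
    finally show "e (free_ext R Q (carrier X) s z) = free_cover R X z" .
  qed
qed


section \<open>Computing the first Ext group from a presentation\<close>

lemma syzygy_simps [simp]:
  "carrier (syzygy R X) = a_kernel (free_module R (carrier X)) X (free_cover R X)"
  "\<zero>\<^bsub>syzygy R X\<^esub> = \<zero>\<^bsub>free_module R (carrier X)\<^esub>"
  by (simp_all add: syzygy_def Let_def)

text \<open>The image of \<open>d2\<close> is the kernel of \<open>d1\<close>, so the cocycles are
  the maps that vanish on that kernel. The coboundaries are the maps that factor through
  \<open>d1\<close>, and the quotient is trivial when the former are contained in the
  latter.\<close>

lemma Ext1_trivial_iff_free:
  assumes X: "left_module R X" and Y: "left_module R Y"
  shows "trivial_group (Ext1 R X Y) \<longleftrightarrow>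
    ext_vanishes R (free_module R (carrier (syzygy R X))) (free_cover R (syzygy R X))
      (free_module R (carrier X)) Y"
proof -
  interpret X: left_module R X by fact
  interpret Y: left_module R Y by fact
  define K where "K = syzygy R X"
  define L where "L = syzygy R K"
  define F0 where "F0 = free_module R (carrier X)"
  define F1 where "F1 = free_module R (carrier K)"
  define F2 where "F2 = free_module R (carrier L)"
  define d1 where "d1 = free_cover R K"
  define d2 where "d2 = free_cover R L"
  let ?G = "hom_group R F1 Y"
  let ?Z = "kernel ?G (hom_group R F2 Y) (\<lambda>h. compose (carrier F2) h d2)"
  let ?B = "(\<lambda>h. compose (carrier F1) h d1) ` mod_hom R F0 Y"
  have K: "left_module R K" unfolding K_def by (rule syzygy_left_module[OF X])
  have L: "left_module R L" unfolding L_def by (rule syzygy_left_module[OF K])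
  have F0: "left_module R F0" and F1: "left_module R F1" and F2: "left_module R F2"
    unfolding F0_def F1_def F2_def by (rule free_left_module[OF X.R.ring_axioms])+
  have d1: "d1 \<in> mod_hom R F1 F0"
    using mod_hom_syzygyD free_cover_hom[OF K] unfolding d1_def F1_def F0_def K_def by blast
  have d2: "d2 ` carrier F2 = {z \<in> carrier F1. d1 z = \<zero>\<^bsub>F0\<^esub>}"
    using free_cover_surj[OF L]
    by (auto simp: d2_def F2_def L_def K_def F1_def F0_def d1_def a_kernel_iff)
  have Z: "h \<in> ?Z \<longleftrightarrow> h \<in> mod_hom R F1 Y \<and> (\<forall>z\<in>carrier F1. d1 z = \<zero>\<^bsub>F0\<^esub> \<longrightarrow> h z = \<zero>\<^bsub>Y\<^esub>)" for h
  proof -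
    have "compose (carrier F2) h d2 = (\<lambda>x\<in>carrier F2. \<zero>\<^bsub>Y\<^esub>) \<longleftrightarrow> (\<forall>x\<in>carrier F2. h (d2 x) = \<zero>\<^bsub>Y\<^esub>)"
      by (auto simp: compose_def fun_eq_iff restrict_def)
    also have "\<dots> \<longleftrightarrow> (\<forall>z\<in>d2 ` carrier F2. h z = \<zero>\<^bsub>Y\<^esub>)" by blast
    finally show ?thesis unfolding d2 by (auto simp: kernel_def hom_group_def)
  qed
  have B: "h \<in> ?B \<longleftrightarrow> (\<exists>g\<in>mod_hom R F0 Y. \<forall>z\<in>carrier F1. h z = g (d1 z))"
    if h: "h \<in> mod_hom R F1 Y" for h
  proof -
    have "h = compose (carrier F1) g d1 \<longleftrightarrow> (\<forall>z\<in>carrier F1. h z = g (d1 z))"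
      if g: "g \<in> mod_hom R F0 Y" for g
      using mod_hom_eqI[OF h mod_hom_compose[OF g d1 F1]] by (auto simp: compose_eq)
    then show ?thesis by (auto simp: image_iff)
  qed
  interpret g1: group_hom "hom_group R F0 Y" ?G "\<lambda>h. compose (carrier F1) h d1"
    by (rule precompose_group_hom[OF F1 F0 Y d1])
  have Bsub: "subgroup ?B ?G" using g1.img_is_subgroup by (simp add: hom_group_def)
  let ?H = "?G\<lparr>carrier := ?Z\<rparr>"
  have Ext: "Ext1 R X Y = ?H Mod ?B"
    unfolding Ext1_def Let_def by (simp add: K_def L_def F0_def F1_def F2_def d1_def d2_def)
  have grp: "group (?H Mod ?B)"
    using Ext1_comm_group[OF X Y] unfolding Ext comm_group_def by simp
  have coset: "?B #>\<^bsub>?H\<^esub> z = ?B \<longleftrightarrow> z \<in> ?B" if "z \<in> ?Z" for z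
  proof -
    have z: "z \<in> carrier ?G" using iffD1[OF Z that] by (simp add: hom_group_def)
    have "?B #>\<^bsub>?H\<^esub> z = ?B #>\<^bsub>?G\<^esub> z" by (simp add: r_coset_def)
    then show ?thesis
      using g1.H.coset_join1[OF _ z Bsub] g1.H.coset_join2[OF z Bsub] by auto
  qed
  have one: "\<one>\<^bsub>?G\<^esub> \<in> ?Z"
    using g1.H.one_closed by (intro iffD2[OF Z]) (simp add: hom_group_def)
  \<comment> \<open>The carrier of the quotient group is a union of singletons over the cocycles,
    and the zero cocycle makes the index set nonempty.\<close>
  have UN_singleton: "(\<Union>z\<in>A. {c z}) = {b} \<longleftrightarrow> (\<forall>z\<in>A. c z = b)"
    if "A \<noteq> {}" for A :: "'z set" and c :: "'z \<Rightarrow> 'y" and b using that by auto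
  have "trivial_group (?H Mod ?B) \<longleftrightarrow> (\<Union>z\<in>?Z. {?B #>\<^bsub>?H\<^esub> z}) = {?B}"
    using grp by (simp add: trivial_group_def FactGroup_def RCOSETS_def)
  also have "\<dots> \<longleftrightarrow> (\<forall>z\<in>?Z. ?B #>\<^bsub>?H\<^esub> z = ?B)" by (rule UN_singleton) (use one in blast)
  also have "\<dots> \<longleftrightarrow> ?Z \<subseteq> ?B" unfolding subset_eq by (rule ball_cong[OF refl coset])
  also have "\<dots> \<longleftrightarrow> ext_vanishes R F1 d1 F0 Y"
    unfolding ext_vanishes_def subset_iff Z Ball_def imp_conjL by (intro all_cong imp_cong refl B[unfolded Ball_def])
  finally show ?thesis unfolding Ext F1_def F0_def d1_def K_def .
qed

text \<open>Comparison with the canonical free resolution. The map \<open>u\<close> exists because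
  the canonical module is free, and \<open>v\<close> because Q has a dual basis; the two directions
  differ by exchanging them.\<close>

lemma Ext1_trivial_iff_presentation:
  assumes Q1: "left_module R Q1" and Q: "left_module R Q" and X: "left_module R X"
    and Y: "left_module R Y" and db: "dual_basis R Q T q \<psi>"
    and d: "d \<in> mod_hom R Q1 Q" and e: "e \<in> mod_hom R Q X" "e ` carrier Q = carrier X"
    and de: "d ` carrier Q1 = a_kernel Q X e"
  shows "trivial_group (Ext1 R X Y) \<longleftrightarrow> ext_vanishes R Q1 d Q Y"
proof -
  interpret X: left_module R X by fact
  let ?K = "syzygy R X" and ?F = "free_module R (carrier X)"
  let ?F1 = "free_module R (carrier ?K)" and ?b = "free_cover R (syzygy R X)"
  have K: "left_module R ?K" by (rule syzygy_left_module[OF X])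
  have F: "left_module R ?F" and F1: "left_module R ?F1"
    by (rule free_left_module[OF X.R.ring_axioms])+
  have b: "?b \<in> mod_hom R ?F1 ?F" by (rule mod_hom_syzygyD[OF free_cover_hom[OF K]])
  have bc: "?b ` carrier ?F1 = a_kernel ?F X (free_cover R X)"
    unfolding free_cover_surj[OF K] by simp
  obtain u where u: "u \<in> mod_hom R ?F Q" "\<And>z. z \<in> carrier ?F \<Longrightarrow> e (u z) = free_cover R X z"
    by (rule free_cover_lift[OF X Q e]) (rule that, blast+)
  obtain v where v: "v \<in> mod_hom R Q ?F" "\<And>z. z \<in> carrier Q \<Longrightarrow> free_cover R X (v z) = e z"
    using dual_basis_lift[OF db Q F X free_cover_hom[OF X] free_cover_surj[OF X] e(1)] by auto
  show ?thesis unfolding Ext1_trivial_iff_free[OF X Y]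
  proof
    assume ext: "ext_vanishes R ?F1 ?b ?F Y"
    show "ext_vanishes R Q1 d Q Y"
      by (rule ext_vanishes_transfer[OF Q1 Q F1 F X Y d e(1) de b free_cover_hom[OF X] bc u(1) _ v(1) _ ext])
        (fact u(2) v(2))+
  next
    assume ext: "ext_vanishes R Q1 d Q Y"
    show "ext_vanishes R ?F1 ?b ?F Y"
      by (rule ext_vanishes_transfer[OF F1 F Q1 Q X Y b free_cover_hom[OF X] bc d e(1) de v(1) _ u(1) _ ext])
        (fact u(2) v(2))+
  qed
qed

section \<open>The transpose\<close>

lemma quot_module_proj:
  assumes M: "left_module R M" and N: "submodule N R M"
  obtains \<pi> where "\<pi> \<in> mod_hom R M (quot_module M N)"
    "\<pi> ` carrier M = carrier (quot_module M N)" "a_kernel M (quot_module M N) \<pi> = N"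
proof -
  interpret left_module R M by fact
  interpret N: submodule N R M by fact
  interpret N: abelian_subgroup N M
    using N.subgroup_axioms by (intro abelian_subgroupI3 additive_subgroup.intro M.abelian_group_axioms)
  have C: "carrier (quot_module M N) = (\<lambda>x. N +>\<^bsub>M\<^esub> x) ` carrier M"
    by (auto simp: quot_module_def A_RCOSETS_def')
  \<comment> \<open>Scalar multiplication on the quotient is a union over all representatives. They
    all give the same coset because \<open>N\<close> is stable under scalars.\<close>
  have S: "a \<odot>\<^bsub>quot_module M N\<^esub> (N +>\<^bsub>M\<^esub> x) = N +>\<^bsub>M\<^esub> (a \<odot>\<^bsub>M\<^esub> x)"
    if a: "a \<in> carrier R" and x: "x \<in> carrier M" for a x
  proof -
    have "N +>\<^bsub>M\<^esub> (a \<odot>\<^bsub>M\<^esub> y) = N +>\<^bsub>M\<^esub> (a \<odot>\<^bsub>M\<^esub> x)" if y: "y \<in> N +>\<^bsub>M\<^esub> x" for y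
    proof -
      obtain n where n: "n \<in> N" "y = n \<oplus>\<^bsub>M\<^esub> x" using y by (auto simp: a_r_coset_def')
      then have "a \<odot>\<^bsub>M\<^esub> y \<in> N +>\<^bsub>M\<^esub> (a \<odot>\<^bsub>M\<^esub> x)"
        using a x submodule_closed(5)[OF M N]
        by (auto simp: a_r_coset_def' smult_r_distr intro!: bexI[of _ "a \<odot>\<^bsub>M\<^esub> n"])
      then show ?thesis using a x N.a_repr_independence'[of "a \<odot>\<^bsub>M\<^esub> y" "a \<odot>\<^bsub>M\<^esub> x"] by simp
    qed
    moreover have "x \<in> N +>\<^bsub>M\<^esub> x" by (simp add: N.a_rcos_self x)
    ultimately have "(\<Union>y\<in>N +>\<^bsub>M\<^esub> x. N +>\<^bsub>M\<^esub> (a \<odot>\<^bsub>M\<^esub> y)) = N +>\<^bsub>M\<^esub> (a \<odot>\<^bsub>M\<^esub> x)" by blast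
    then show ?thesis by (simp add: quot_module_def)
  qed
  show thesis
  proof (rule that)
    show "(\<lambda>x\<in>carrier M. N +>\<^bsub>M\<^esub> x) \<in> mod_hom R M (quot_module M N)"
    proof (rule mod_hom_restrictI[OF M])
      show "N +>\<^bsub>M\<^esub> (x \<oplus>\<^bsub>M\<^esub> y) = (N +>\<^bsub>M\<^esub> x) \<oplus>\<^bsub>quot_module M N\<^esub> (N +>\<^bsub>M\<^esub> y)"
        if "x \<in> carrier M" "y \<in> carrier M" for x y
        using that by (simp add: quot_module_def N.a_rcos_sum)
    qed (auto simp: C S)
    show "(\<lambda>x\<in>carrier M. N +>\<^bsub>M\<^esub> x) ` carrier M = carrier (quot_module M N)"
      by (simp add: C)
    have "N +>\<^bsub>M\<^esub> x = N \<longleftrightarrow> x \<in> N" if "x \<in> carrier M" for x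
      using that N.a_rcos_self[OF that] M.a_coset_join2[OF that N.subgroup_axioms] by auto
    then show "a_kernel M (quot_module M N) (\<lambda>x\<in>carrier M. N +>\<^bsub>M\<^esub> x) = N"
      using N.subset by (auto simp: a_kernel_iff) (auto simp: quot_module_def)
  qed
qed

text \<open>Restricting to the dual of \<open>P0\<close> makes the map extensional, as membership in
  \<open>mod_hom\<close> requires.\<close>

definition dual_map where
  "dual_map R P1 P0 f = (\<lambda>g\<in>carrier (dual R P0). compose (carrier P1) g f)"

lemma dual_map_hom:
  assumes P1: "left_module R P1" and P0: "left_module R P0" and f: "f \<in> mod_hom R P1 P0"
  shows "dual_map R P1 P0 f \<in> mod_hom (opp_ring R) (dual R P0) (dual R P1)"
proof -
  have fc: "f x \<in> carrier P0" if "x \<in> carrier P1" for x using mod_hom_closed[OF f that] .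
  show ?thesis unfolding dual_map_def
    by (rule mod_hom_restrictI[OF dual_left_module[OF P0]])
      (use mod_hom_compose[OF _ f P1] in \<open>auto simp: dual_simps(1)\<close>,
        auto simp: dual_def compose_def fun_eq_iff fc)
qed

text \<open>The transpose as the cokernel of the dual of \<open>f\<close>, in the form of an exact
  sequence from which its functionals and its Ext groups can be computed.\<close>

lemma transpose_presentation:
  assumes P1: "left_module R P1" and P0: "left_module R P0" and f: "f \<in> mod_hom R P1 P0"
  obtains \<pi> where "\<pi> \<in> mod_hom (opp_ring R) (dual R P1) (transpose_module R P1 f P0)"
    "\<pi> ` carrier (dual R P1) = carrier (transpose_module R P1 f P0)"
    "dual_map R P1 P0 f ` carrier (dual R P0) =
      a_kernel (dual R P1) (transpose_module R P1 f P0) \<pi>"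
proof -
  let ?B = "dual_map R P1 P0 f ` carrier (dual R P0)"
  have D1: "left_module (opp_ring R) (dual R P1)" and D0: "left_module (opp_ring R) (dual R P0)"
    by (rule dual_left_module P1 P0)+
  have T: "transpose_module R P1 f P0 = quot_module (dual R P1) ?B"
    by (simp add: transpose_module_def dual_map_def)
  have "submodule ?B (opp_ring R) (dual R P1)"
    by (rule mod_hom_image_submodule[OF D0 D1 dual_map_hom[OF P1 P0 f]])
  then show thesis
    unfolding T by (rule quot_module_proj[OF D1]) (rule that[unfolded T], auto)
qed

section \<open>Torsionless transposes\<close>

lemma torsionless_iff:
  assumes X: "left_module S X"
  shows "torsionless S X \<longleftrightarrow>
    (\<forall>x\<in>carrier X. (\<forall>g\<in>mod_hom S X (regular_module S). g x = \<zero>\<^bsub>S\<^esub>) \<longrightarrow> x = \<zero>\<^bsub>X\<^esub>)"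
proof -
  interpret X: left_module S X by fact
  have Reg: "left_module S (regular_module S)" by (rule regular_left_module[OF X.R.ring_axioms])
  have eq: "eval_map S X x = eval_map S X y \<longleftrightarrow> (\<forall>g\<in>mod_hom S X (regular_module S). g x = g y)"
    if "x \<in> carrier X" "y \<in> carrier X" for x y
    using that by (auto simp: eval_map_def dual_simps(1) fun_eq_iff restrict_def)
  show ?thesis
  proof
    assume inj: "torsionless S X"
    show "\<forall>x\<in>carrier X. (\<forall>g\<in>mod_hom S X (regular_module S). g x = \<zero>\<^bsub>S\<^esub>) \<longrightarrow> x = \<zero>\<^bsub>X\<^esub>"
      using inj eq mod_hom_zero[OF X Reg] unfolding torsionless_def inj_on_def by simp
  next
    assume z: "\<forall>x\<in>carrier X. (\<forall>g\<in>mod_hom S X (regular_module S). g x = \<zero>\<^bsub>S\<^esub>) \<longrightarrow> x = \<zero>\<^bsub>X\<^esub>"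
    have "x = y" if x: "x \<in> carrier X" and y: "y \<in> carrier X"
      and "\<forall>g\<in>mod_hom S X (regular_module S). g x = g y" for x y
    proof -
      have "g (x \<oplus>\<^bsub>X\<^esub> \<ominus>\<^bsub>X\<^esub> y) = \<zero>\<^bsub>S\<^esub>" if g: "g \<in> mod_hom S X (regular_module S)" for g
      proof -
        have "g x = g y" using g that \<open>\<forall>g\<in>_. g x = g y\<close> by blast
        then have "g (x \<oplus>\<^bsub>X\<^esub> \<ominus>\<^bsub>X\<^esub> y) = g (y \<oplus>\<^bsub>X\<^esub> \<ominus>\<^bsub>X\<^esub> y)" using x y by (simp add: mod_hom_add[OF g])
        then show ?thesis using y mod_hom_zero[OF X Reg g] by (simp add: X.M.r_neg)
      qed
      then have "x \<oplus>\<^bsub>X\<^esub> \<ominus>\<^bsub>X\<^esub> y = \<zero>\<^bsub>X\<^esub>" using z x y by simp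
      then show ?thesis using x y
        by (metis X.M.add.inv_closed X.M.minus_equality X.M.minus_minus)
    qed
    then show "torsionless S X" unfolding torsionless_def inj_on_def using eq by blast
  qed
qed

text \<open>By reflexivity of \<open>P1\<close>, functionals on the transpose are evaluations at
  elements of the kernel of \<open>f\<close>. So all of them kill the class of \<open>\<phi>\<close>
  exactly when \<open>\<phi>\<close> vanishes on that kernel, while the class is zero exactly when
  \<open>\<phi>\<close> factors through \<open>f\<close>.\<close>

lemma transpose_torsionless_iff:
  assumes P1: "left_module R P1" and P0: "left_module R P0" and f: "f \<in> mod_hom R P1 P0"
    and db1: "dual_basis R P1 T1 q1 \<psi>1" and db0: "dual_basis R P0 T0 q0 \<psi>0"
  shows "torsionless (opp_ring R) (transpose_module R P1 f P0) \<longleftrightarrow>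
    ext_vanishes R P1 f P0 (regular_module R)"
proof -
  interpret P1: left_module R P1 by fact
  interpret P0: left_module R P0 by fact
  let ?X = "transpose_module R P1 f P0" and ?S = "opp_ring R"
  let ?B = "dual_map R P1 P0 f ` carrier (dual R P0)"
  have D1: "left_module ?S (dual R P1)" by (rule dual_left_module[OF P1])
  have X: "left_module ?S ?X" by (rule transpose_left_module[OF P0 P1 f])
  interpret X: left_module ?S ?X by (rule X)
  have RegR: "left_module R (regular_module R)" by (rule regular_left_module[OF P1.R.ring_axioms])
  have Reg: "left_module ?S (regular_module ?S)" by (rule regular_left_module[OF X.R.ring_axioms])
  obtain \<pi> where \<pi>: "\<pi> \<in> mod_hom ?S (dual R P1) ?X" "\<pi> ` carrier (dual R P1) = carrier ?X"
    and ker: "?B = a_kernel (dual R P1) ?X \<pi>"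
    by (rule transpose_presentation[OF P1 P0 f]) (rule that)
  have fc: "f x \<in> carrier P0" if "x \<in> carrier P1" for x using mod_hom_closed[OF f that] .
  have B: "\<phi> \<in> ?B \<longleftrightarrow> (\<exists>g\<in>mod_hom R P0 (regular_module R). \<forall>z\<in>carrier P1. \<phi> z = g (f z))"
    if h: "\<phi> \<in> mod_hom R P1 (regular_module R)" for \<phi>
  proof -
    have "\<phi> = compose (carrier P1) g f \<longleftrightarrow> (\<forall>z\<in>carrier P1. \<phi> z = g (f z))"
      if g: "g \<in> mod_hom R P0 (regular_module R)" for g
      using mod_hom_eqI[OF h mod_hom_compose[OF g f P1]] by (auto simp: compose_eq)
    then show ?thesis by (auto simp: dual_map_def dual_simps(1) image_iff)
  qed
  have "torsionless ?S ?X \<longleftrightarrow> (\<forall>\<phi>\<in>mod_hom R P1 (regular_module R).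
      (\<forall>g\<in>mod_hom ?S ?X (regular_module ?S). g (\<pi> \<phi>) = \<zero>\<^bsub>R\<^esub>) \<longrightarrow> \<pi> \<phi> = \<zero>\<^bsub>?X\<^esub>)"
    unfolding torsionless_iff[OF X] \<pi>(2)[symmetric] by (simp add: dual_simps(1))
  also have "\<dots> \<longleftrightarrow> (\<forall>\<phi>\<in>mod_hom R P1 (regular_module R).
      (\<forall>x\<in>carrier P1. f x = \<zero>\<^bsub>P0\<^esub> \<longrightarrow> \<phi> x = \<zero>\<^bsub>R\<^esub>) \<longrightarrow> \<phi> \<in> ?B)"
  proof (rule ball_cong[OF refl], rule imp_cong)
    fix \<phi> assume phi: "\<phi> \<in> mod_hom R P1 (regular_module R)"
    then have phiD: "\<phi> \<in> carrier (dual R P1)" by (simp add: dual_simps(1))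
    show "\<pi> \<phi> = \<zero>\<^bsub>?X\<^esub> \<longleftrightarrow> \<phi> \<in> ?B" using phiD unfolding ker by (simp add: a_kernel_iff)
    show "(\<forall>g\<in>mod_hom ?S ?X (regular_module ?S). g (\<pi> \<phi>) = \<zero>\<^bsub>R\<^esub>) \<longleftrightarrow>
      (\<forall>x\<in>carrier P1. f x = \<zero>\<^bsub>P0\<^esub> \<longrightarrow> \<phi> x = \<zero>\<^bsub>R\<^esub>)"
    proof (intro iffI ballI impI)
      fix x assume g0: "\<forall>g\<in>mod_hom ?S ?X (regular_module ?S). g (\<pi> \<phi>) = \<zero>\<^bsub>R\<^esub>"
        and x: "x \<in> carrier P1" and fx: "f x = \<zero>\<^bsub>P0\<^esub>"
      \<comment> \<open>Since \<open>f x\<close> is zero, evaluation at \<open>x\<close> kills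
        \<open>?B\<close> and descends to the transpose.\<close>
      let ?ev = "\<lambda>g\<in>carrier (dual R P1). g x"
      have ev0: "?ev g = \<zero>\<^bsub>regular_module ?S\<^esub>" if "g \<in> carrier (dual R P1)" "\<pi> g = \<zero>\<^bsub>?X\<^esub>" for g
      proof -
        have gB: "g \<in> ?B" unfolding ker using that by (simp add: a_kernel_iff)
        have "g \<in> mod_hom R P1 (regular_module R)" using that(1) by (simp add: dual_simps(1))
        from iffD1[OF B[OF this] gB]
        obtain h where "h \<in> mod_hom R P0 (regular_module R)" "g x = h (f x)" using x by auto
        then show ?thesis using that fx mod_hom_zero[OF P0 RegR] by simp
      qed
      obtain g where "g \<in> mod_hom ?S ?X (regular_module ?S)"
        and g\<pi>: "\<And>h. h \<in> carrier (dual R P1) \<Longrightarrow> g (\<pi> h) = ?ev h"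
        by (rule mod_hom_factor[OF D1 X Reg \<pi> eval_hom[OF P1 x]], erule (1) ev0) (rule that, blast+)
      then show "\<phi> x = \<zero>\<^bsub>R\<^esub>" using g0 g\<pi>[OF phiD] phiD by simp
    next
      fix g assume x0: "\<forall>x\<in>carrier P1. f x = \<zero>\<^bsub>P0\<^esub> \<longrightarrow> \<phi> x = \<zero>\<^bsub>R\<^esub>"
        and g: "g \<in> mod_hom ?S ?X (regular_module ?S)"
      \<comment> \<open>Conversely, reflexivity turns \<open>g\<close> after \<open>\<pi>\<close>
        into evaluation at some \<open>x\<close>. It kills \<open>?B\<close>, and functionals on
        \<open>P0\<close> separate points, so \<open>f x\<close> is zero.\<close>
      obtain x where x: "x \<in> carrier P1"
        and gx: "\<And>h. h \<in> mod_hom R P1 (regular_module R) \<Longrightarrow> (\<lambda>h\<in>carrier (dual R P1). g (\<pi> h)) h = h x"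
        by (rule dual_basis_reflexive[OF db1 P1 mod_hom_composeI[OF D1 \<pi>(1) g]]) (rule that, blast+)
      have "f x = \<zero>\<^bsub>P0\<^esub>"
      proof (rule dual_basis_separates[OF db0 P0 fc[OF x] P0.M.zero_closed])
        fix h assume h: "h \<in> mod_hom R P0 (regular_module R)"
        let ?hf = "compose (carrier P1) h f"
        have hf: "?hf \<in> mod_hom R P1 (regular_module R)" by (rule mod_hom_compose[OF h f P1])
        have "?hf \<in> ?B" by (rule iffD2[OF B[OF hf]]) (use h in \<open>auto simp: compose_eq\<close>)
        then have "\<pi> ?hf = \<zero>\<^bsub>?X\<^esub>" unfolding ker by (simp add: a_kernel_iff)
        then have "?hf x = \<zero>\<^bsub>R\<^esub>"
          using gx[OF hf] hf mod_hom_zero[OF X Reg g] by (simp add: dual_simps(1))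
        then show "h (f x) = h \<zero>\<^bsub>P0\<^esub>" using x mod_hom_zero[OF P0 RegR h] by (simp add: compose_eq)
      qed
      then show "g (\<pi> \<phi>) = \<zero>\<^bsub>R\<^esub>" using x0 x gx[OF phi] phiD by simp
    qed
  qed
  also have "\<dots> \<longleftrightarrow> ext_vanishes R P1 f P0 (regular_module R)"
    unfolding ext_vanishes_def using B by simp
  finally show ?thesis .
qed

section \<open>Projectivity criteria\<close>

text \<open>Push the generators forward along \<open>p\<close> and pull the coordinates back along
  \<open>s\<close>.\<close>

lemma dual_basis_retract:
  assumes db: "dual_basis R P T q \<psi>" and P: "left_module R P" and M: "left_module R M"
    and s: "s \<in> mod_hom R M P" and p: "p \<in> mod_hom R P M"
    and ps: "\<And>x. x \<in> carrier M \<Longrightarrow> p (s x) = x"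
  shows "dual_basis R M T (\<lambda>i. p (q i)) (\<lambda>i. \<lambda>x\<in>carrier M. \<psi> i (s x))"
  unfolding dual_basis_def
proof (intro conjI ballI)
  show "finite T" "(\<lambda>i. p (q i)) \<in> T \<rightarrow> carrier M"
    using db mod_hom_closed[OF p] by (auto simp: dual_basis_def)
  show "(\<lambda>i. \<lambda>x\<in>carrier M. \<psi> i (s x)) \<in> T \<rightarrow> mod_hom R M (regular_module R)"
    using db by (intro funcsetI mod_hom_composeI[OF M s]) (auto simp: dual_basis_def)
  fix x assume x: "x \<in> carrier M"
  show "(\<Oplus>\<^bsub>M\<^esub>i\<in>T. (\<lambda>x\<in>carrier M. \<psi> i (s x)) x \<odot>\<^bsub>M\<^esub> p (q i)) = x"
    using dual_basis_mod_hom[OF db P M p mod_hom_closed[OF s x]] ps[OF x] x by simp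
qed

lemma regular_dual_basis:
  assumes "ring R"
  shows "dual_basis R (regular_module R) {()} (\<lambda>_. \<one>\<^bsub>R\<^esub>) (\<lambda>_. \<lambda>x\<in>carrier R. x)"
proof -
  interpret ring R by fact
  interpret Reg: left_module R "regular_module R" by (rule regular_left_module) fact
  have "(\<lambda>x\<in>carrier R. x) \<in> mod_hom R (regular_module R) (regular_module R)"
    using mod_hom_restrictI[OF Reg.left_module_axioms, of "\<lambda>x. x"] by simp
  then show ?thesis by (auto simp: dual_basis_def)
qed

text \<open>The idempotent value yields a nonzero idempotent endomorphism \<open>\<sigma>\<close> of
  M that factors through R. Its image and kernel decompose M, so indecomposability makes it the
  identity, and M is a retract of R.\<close>

lemma idempotent_value_projective:
  assumes M: "left_module R M" and ind: "indecomposable R M"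
    and g: "g \<in> mod_hom R M (regular_module R)" and m: "m \<in> carrier M"
    and idem: "g m \<otimes>\<^bsub>R\<^esub> g m = g m" and nz: "g m \<noteq> \<zero>\<^bsub>R\<^esub>"
  shows "projective R M"
proof -
  interpret M: left_module R M by fact
  have Reg: "left_module R (regular_module R)" by (rule regular_left_module[OF M.R.ring_axioms])
  define e where "e = g m"
  define n where "n = e \<odot>\<^bsub>M\<^esub> m"
  have e: "e \<in> carrier R" "e \<otimes>\<^bsub>R\<^esub> e = e" "e \<noteq> \<zero>\<^bsub>R\<^esub>"
    using mod_hom_closed[OF g m] idem nz by (simp_all add: e_def)
  have n: "n \<in> carrier M" "e \<odot>\<^bsub>M\<^esub> n = n"
    using e(1) m M.smult_assoc1[OF e(1) e(1) m] by (simp_all add: n_def e(2))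
  \<comment> \<open>Replacing \<open>m\<close> by \<open>n\<close> and \<open>g\<close> by
    \<open>\<gamma>\<close> arranges that \<open>\<gamma> n\<close> is \<open>e\<close> and that
    \<open>e\<close> fixes \<open>n\<close>. These two equations make \<open>\<sigma>\<close>
    idempotent.\<close>
  define \<gamma> where "\<gamma> = (\<lambda>x\<in>carrier M. g x \<odot>\<^bsub>regular_module R\<^esub> e)"
  have \<gamma>: "\<gamma> \<in> mod_hom R M (regular_module R)"
    unfolding \<gamma>_def by (rule smult_left_hom[OF M Reg g]) (simp add: e)
  have \<gamma>n: "\<gamma> n = e"
    using n(1) mod_hom_smult[OF g e(1) m] by (simp add: \<gamma>_def n_def e e_def[symmetric])
  define \<sigma> where "\<sigma> = (\<lambda>x\<in>carrier M. \<gamma> x \<odot>\<^bsub>M\<^esub> n)"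
  have \<sigma>: "\<sigma> \<in> mod_hom R M M" unfolding \<sigma>_def by (rule smult_left_hom[OF M M \<gamma> n(1)])
  have \<gamma>c: "\<gamma> x \<in> carrier R" if "x \<in> carrier M" for x using mod_hom_closed[OF \<gamma> that] by simp
  have \<sigma>\<sigma>: "\<sigma> (\<sigma> x) = \<sigma> x" if x: "x \<in> carrier M" for x
  proof -
    have "\<gamma> (\<gamma> x \<odot>\<^bsub>M\<^esub> n) = \<gamma> x \<otimes>\<^bsub>R\<^esub> e"
      using mod_hom_smult[OF \<gamma> \<gamma>c[OF x] n(1)] by (simp add: \<gamma>n)
    then show ?thesis using x \<gamma>c[OF x] n e by (simp add: \<sigma>_def M.smult_assoc1)
  qed
  let ?N = "\<sigma> ` carrier M" and ?N' = "a_kernel M M \<sigma>"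
  have N: "submodule ?N R M" by (rule mod_hom_image_submodule[OF M M \<sigma>])
  have N': "submodule ?N' R M"
    using mod_hom_zero[OF M M \<sigma>]
    by (intro left_submoduleI(2)[OF M])
      (auto simp: a_kernel_iff mod_hom_add[OF \<sigma>] mod_hom_smult[OF \<sigma>] M.smult_r_null)
  have diff: "x \<oplus>\<^bsub>M\<^esub> \<ominus>\<^bsub>M\<^esub> \<sigma> x \<in> ?N'" if "x \<in> carrier M" for x
    using that mod_hom_closed[OF \<sigma> that]
    by (simp add: a_kernel_iff mod_hom_add[OF \<sigma>] mod_hom_minus[OF M M \<sigma>] \<sigma>\<sigma> M.M.r_neg)
  have "?N <+>\<^bsub>M\<^esub> ?N' = carrier M"
  proof
    show "?N <+>\<^bsub>M\<^esub> ?N' \<subseteq> carrier M"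
      by (rule M.M.set_add_closed[OF submodule_closed(1)[OF M N] submodule_closed(1)[OF M N']])
    show "carrier M \<subseteq> ?N <+>\<^bsub>M\<^esub> ?N'"
    proof
      fix x assume x: "x \<in> carrier M"
      have "x = \<sigma> x \<oplus>\<^bsub>M\<^esub> (x \<oplus>\<^bsub>M\<^esub> \<ominus>\<^bsub>M\<^esub> \<sigma> x)"
        using x mod_hom_closed[OF \<sigma> x] by (simp add: M.M.a_lcomm M.M.r_neg)
      then show "x \<in> ?N <+>\<^bsub>M\<^esub> ?N'"
        using diff[OF x] x unfolding set_add_def set_mult_def by auto
    qed
  qed
  moreover have "y = \<zero>\<^bsub>M\<^esub>" if "y \<in> ?N" "y \<in> ?N'" for y
    using that \<sigma>\<sigma> by (metis a_kernel_iff imageE)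
  then have "?N \<inter> ?N' = {\<zero>\<^bsub>M\<^esub>}"
    using submodule_closed(2)[OF M N] submodule_closed(2)[OF M N'] by blast
  ultimately have "?N = {\<zero>\<^bsub>M\<^esub>} \<or> ?N' = {\<zero>\<^bsub>M\<^esub>}"
    using ind N N' unfolding indecomposable_def by blast
  moreover have "?N \<noteq> {\<zero>\<^bsub>M\<^esub>}"
  proof
    assume "?N = {\<zero>\<^bsub>M\<^esub>}"
    then have "\<sigma> n = \<zero>\<^bsub>M\<^esub>" using n(1) by blast
    then have "n = \<zero>\<^bsub>M\<^esub>" using n by (simp add: \<sigma>_def \<gamma>n)
    then show False using \<gamma>n e(3) mod_hom_zero[OF M Reg \<gamma>] by simp
  qed
  ultimately have ker: "?N' = {\<zero>\<^bsub>M\<^esub>}" by blast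
  have \<sigma>_id: "\<sigma> x = x" if x: "x \<in> carrier M" for x
  proof -
    have "x \<oplus>\<^bsub>M\<^esub> \<ominus>\<^bsub>M\<^esub> \<sigma> x = \<zero>\<^bsub>M\<^esub>" using diff[OF x] ker by blast
    then show ?thesis using x mod_hom_closed[OF \<sigma> x]
      by (metis M.M.add.inv_closed M.M.minus_equality M.M.minus_minus)
  qed
  have "(\<lambda>x\<in>carrier R. x) \<in> mod_hom R (regular_module R) (regular_module R)"
    using mod_hom_restrictI[OF Reg, of "\<lambda>x. x"] by simp
  from smult_left_hom[OF Reg M this n(1)]
  have "(\<lambda>r\<in>carrier R. r \<odot>\<^bsub>M\<^esub> n) \<in> mod_hom R (regular_module R) M"
    by (simp cong: restrict_cong)
  then have "dual_basis R M {()} (\<lambda>i. (\<lambda>r\<in>carrier R. r \<odot>\<^bsub>M\<^esub> n) \<one>\<^bsub>R\<^esub>)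
      (\<lambda>i. \<lambda>x\<in>carrier M. (\<lambda>x\<in>carrier R. x) (\<gamma> x))"
    by (rule dual_basis_retract[OF regular_dual_basis[OF M.R.ring_axioms] Reg M \<gamma>])
      (use \<gamma>c \<sigma>_id in \<open>simp add: \<sigma>_def\<close>)
  then show ?thesis by (rule dual_basis_projective[OF _ M])
qed

text \<open>Extending the coordinates of \<open>P1\<close> along \<open>f\<close> gives a retraction
  \<open>r\<close> of \<open>f\<close>. Then 1 - f r kills the image of \<open>f\<close>, which is
  the kernel of \<open>p\<close>, and descends to a section of \<open>p\<close>.\<close>

lemma dual_map_surj_projective:
  assumes M: "left_module R M" and P1: "left_module R P1" and P0: "left_module R P0"
    and f: "f \<in> mod_hom R P1 P0" and p: "p \<in> mod_hom R P0 M" "p ` carrier P0 = carrier M"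
    and fp: "f ` carrier P1 = a_kernel P0 M p"
    and db1: "dual_basis R P1 T1 q1 \<psi>1" and db0: "dual_basis R P0 T0 q0 \<psi>0"
    and surj: "\<And>\<phi>. \<phi> \<in> mod_hom R P1 (regular_module R) \<Longrightarrow>
      \<exists>g\<in>mod_hom R P0 (regular_module R). \<forall>z\<in>carrier P1. \<phi> z = g (f z)"
  shows "projective R M"
proof -
  interpret M: left_module R M by fact
  interpret P1: left_module R P1 by fact
  interpret P0: left_module R P0 by fact
  have psi: "\<psi>1 i \<in> mod_hom R P1 (regular_module R)" and q: "q1 i \<in> carrier P1" if "i \<in> T1" for i
    using db1 that by (auto simp: dual_basis_def)
  have fT: "finite T1" using db1 by (simp add: dual_basis_def)
  have "\<forall>i\<in>T1. \<exists>g\<in>mod_hom R P0 (regular_module R). \<forall>z\<in>carrier P1. \<psi>1 i z = g (f z)"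
    using surj psi by blast
  then obtain g where g: "\<And>i. i \<in> T1 \<Longrightarrow> g i \<in> mod_hom R P0 (regular_module R)"
    and gf: "\<And>i z. i \<in> T1 \<Longrightarrow> z \<in> carrier P1 \<Longrightarrow> \<psi>1 i z = g i (f z)"
    by metis
  have fc: "f x \<in> carrier P0" if "x \<in> carrier P1" for x by (rule mod_hom_closed[OF f that])
  define r where "r = (\<lambda>y\<in>carrier P0. \<Oplus>\<^bsub>P1\<^esub>i\<in>T1. g i y \<odot>\<^bsub>P1\<^esub> q1 i)"
  have r: "r \<in> mod_hom R P0 P1"
    unfolding r_def by (rule lincomb_hom[OF P0 P1 fT]) (use g q in auto)
  have rf: "r (f x) = x" if x: "x \<in> carrier P1" for x
  proof -
    have "r (f x) = (\<Oplus>\<^bsub>P1\<^esub>i\<in>T1. g i (f x) \<odot>\<^bsub>P1\<^esub> q1 i)" using fc[OF x] by (simp add: r_def)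
    also have "\<dots> = (\<Oplus>\<^bsub>P1\<^esub>i\<in>T1. \<psi>1 i x \<odot>\<^bsub>P1\<^esub> q1 i)"
      using mod_hom_closed[OF psi _] x
      by (intro P1.M.finsum_cong') (auto simp: gf[symmetric] q)
    also have "\<dots> = x" using db1 x by (simp add: dual_basis_def)
    finally show ?thesis .
  qed
  define t where "t = (\<lambda>y\<in>carrier P0. (\<lambda>y\<in>carrier P0. y) y \<oplus>\<^bsub>P0\<^esub> (\<lambda>y\<in>carrier P0. \<ominus>\<^bsub>P0\<^esub> (\<lambda>y\<in>carrier P0. f (r y)) y) y)"
  have t_hom: "t \<in> mod_hom R P0 P0" unfolding t_def
    by (intro mod_hom_plus[OF P0 P0] mod_hom_uminus[OF P0 P0] mod_hom_composeI[OF P0 r f])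
      (rule mod_hom_restrictI[OF P0], auto)
  have t: "t y = y \<oplus>\<^bsub>P0\<^esub> \<ominus>\<^bsub>P0\<^esub> f (r y)" if "y \<in> carrier P0" for y using that by (simp add: t_def)
  have tk: "t y = \<zero>\<^bsub>P0\<^esub>" if y: "y \<in> carrier P0" "p y = \<zero>\<^bsub>M\<^esub>" for y
  proof -
    obtain x where "x \<in> carrier P1" "y = f x" using fp y by (auto simp: a_kernel_iff set_eq_iff image_iff)
    then show ?thesis using y(1) by (simp add: t rf P0.M.r_neg)
  qed
  obtain k where k: "k \<in> mod_hom R M P0" "\<And>y. y \<in> carrier P0 \<Longrightarrow> k (p y) = t y"
    by (rule mod_hom_factor[OF P0 M P0 p t_hom], erule (1) tk) (rule that, blast+)
  have pk: "p (k x) = x" if x: "x \<in> carrier M" for x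
  proof -
    obtain y where y: "y \<in> carrier P0" "x = p y" using p(2) x by blast
    have ry: "f (r y) \<in> carrier P0" and "f (r y) \<in> f ` carrier P1"
      using fc mod_hom_closed[OF r y(1)] by auto
    then have pfr: "p (f (r y)) = \<zero>\<^bsub>M\<^esub>" unfolding fp by (simp add: a_kernel_iff)
    have "p (k x) = p y \<oplus>\<^bsub>M\<^esub> \<ominus>\<^bsub>M\<^esub> p (f (r y))"
      using y ry by (simp add: k(2) t mod_hom_add[OF p(1)] mod_hom_minus[OF P0 M p(1)])
    then show ?thesis using y mod_hom_closed[OF p(1) y(1)] by (simp add: pfr)
  qed
  show ?thesis
    by (rule dual_basis_projective[OF dual_basis_retract[OF db0 P0 M k(1) p(1)] M]) (rule pk)
qed

section \<open>Contradiction from a non-projective module\<close>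

lemma artin_algebra_ext_projective:
  fixes R (structure)
  assumes artin: "artin_algebra R" and M: "left_module R M"
    and faith: "faithful R M" and ind: "indecomposable R M"
    and P1: "left_module R P1" and P0: "left_module R P0"
    and f: "f \<in> mod_hom R P1 P0" and p: "p \<in> mod_hom R P0 M" "p ` carrier P0 = carrier M"
    and fp: "f ` carrier P1 = a_kernel P0 M p"
    and db1: "dual_basis R P1 T1 q1 \<psi>1" and db0: "dual_basis R P0 T0 q0 \<psi>0"
    and ext: "ext_vanishes R P1 f P0 (regular_module R)"
    and ext': "ext_vanishes (opp_ring R) (dual R P0) (dual_map R P1 P0 f) (dual R P1)
      (transpose_module R P1 f P0)"
  shows "projective R M"
proof (rule ccontr)
  assume nproj: "\<not> projective R M"
  interpret M: left_module R M by fact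
  interpret P1: left_module R P1 by fact
  interpret P0: left_module R P0 by fact
  let ?X = "transpose_module R P1 f P0" and ?S = "opp_ring R" and ?f = "dual_map R P1 P0 f"
  let ?B = "?f ` carrier (dual R P0)"
  have D1: "left_module ?S (dual R P1)" by (rule dual_left_module[OF P1])
  have D0: "left_module ?S (dual R P0)" by (rule dual_left_module[OF P0])
  interpret D1: left_module ?S "dual R P1" by (rule D1)
  interpret D0: left_module ?S "dual R P0" by (rule D0)
  have X: "left_module ?S ?X" by (rule transpose_left_module[OF P0 P1 f])
  have RegR: "left_module R (regular_module R)" by (rule regular_left_module[OF M.R.ring_axioms])
  have Reg: "left_module ?S (regular_module ?S)" by (rule regular_left_module[OF D1.R.ring_axioms])
  have f': "?f \<in> mod_hom ?S (dual R P0) (dual R P1)" by (rule dual_map_hom[OF P1 P0 f])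
  obtain \<pi> where \<pi>: "\<pi> \<in> mod_hom ?S (dual R P1) ?X" "\<pi> ` carrier (dual R P1) = carrier ?X"
    and ker: "?B = a_kernel (dual R P1) ?X \<pi>"
    by (rule transpose_presentation[OF P1 P0 f]) (rule that)
  have f'_app: "?f g x = g (f x)" if "g \<in> carrier (dual R P0)" "x \<in> carrier P1" for g x
    using that by (simp add: dual_map_def compose_eq)
  have fc: "f x \<in> carrier P0" if "x \<in> carrier P1" for x by (rule mod_hom_closed[OF f that])
  have Bsub: "submodule ?B ?S (dual R P1)" by (rule mod_hom_image_submodule[OF D0 D1 f'])
  have BI: "\<phi> \<in> ?B" if \<phi>: "\<phi> \<in> mod_hom R P1 (regular_module R)"
    and g: "g \<in> mod_hom R P0 (regular_module R)" and eq: "\<forall>z\<in>carrier P1. \<phi> z = g (f z)" for \<phi> g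
  proof -
    have "\<phi> = ?f g"
      using mod_hom_eqI[OF \<phi> mod_hom_compose[OF g f P1]] eq g
      by (auto simp: compose_eq dual_map_def dual_simps(1))
    then show ?thesis using g by (simp add: dual_simps(1))
  qed

  obtain \<phi>\<^sub>0 where \<phi>\<^sub>0: "\<phi>\<^sub>0 \<in> carrier (dual R P1)" "\<phi>\<^sub>0 \<notin> ?B"
  proof -
    \<comment> \<open>Otherwise the dual of \<open>f\<close> would be onto, and M would be
      projective.\<close>
    have "\<not> (\<forall>\<phi>\<in>mod_hom R P1 (regular_module R).
        \<exists>g\<in>mod_hom R P0 (regular_module R). \<forall>z\<in>carrier P1. \<phi> z = g (f z))"
      using dual_map_surj_projective[OF M P1 P0 f p fp db1 db0] nproj by blast
    then obtain \<phi> where \<phi>: "\<phi> \<in> mod_hom R P1 (regular_module R)"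
      and no: "\<And>g. g \<in> mod_hom R P0 (regular_module R) \<Longrightarrow> \<exists>z\<in>carrier P1. \<phi> z \<noteq> g (f z)"
      by auto
    have "\<phi> \<notin> ?B"
    proof
      assume "\<phi> \<in> ?B"
      then obtain g where g: "g \<in> carrier (dual R P0)" "\<phi> = ?f g" by blast
      then show False using no[of g] f'_app by (auto simp: dual_simps(1))
    qed
    with \<phi> show thesis by (intro that) (simp_all add: dual_simps(1))
  qed

  \<comment> \<open>Scalars act on the dual by right multiplication of values, so
    \<open>r \<otimes> a\<close> acts as \<open>r\<close> followed by \<open>a\<close>. The search
    for a minimal \<open>r\<close> starts at 1.\<close>
  obtain r where r: "r \<in> carrier R" "r \<odot>\<^bsub>dual R P1\<^esub> \<phi>\<^sub>0 \<notin> ?B"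
    and min: "\<And>a. a \<in> carrier R \<Longrightarrow> (r \<otimes> a) \<odot>\<^bsub>dual R P1\<^esub> \<phi>\<^sub>0 \<notin> ?B \<Longrightarrow>
      \<exists>w\<in>carrier R. (a \<otimes> w) \<otimes> (a \<otimes> w) = a \<otimes> w \<and> a \<otimes> w \<noteq> \<zero>"
  proof (rule artin_algebra_right_minimal_idempotent[OF artin, of \<one> "\<lambda>r. r \<odot>\<^bsub>dual R P1\<^esub> \<phi>\<^sub>0 \<notin> ?B"])
    show "\<one> \<odot>\<^bsub>dual R P1\<^esub> \<phi>\<^sub>0 \<notin> ?B" using D1.smult_one[OF \<phi>\<^sub>0(1)] \<phi>\<^sub>0(2) by simp
    show "\<not> \<zero> \<odot>\<^bsub>dual R P1\<^esub> \<phi>\<^sub>0 \<notin> ?B"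
      using D1.smult_l_null[OF \<phi>\<^sub>0(1)] submodule_closed(2)[OF D1 Bsub] by simp
  qed (simp, rule that, blast+)
  define \<phi> where "\<phi> = r \<odot>\<^bsub>dual R P1\<^esub> \<phi>\<^sub>0"
  have \<phi>D: "\<phi> \<in> carrier (dual R P1)" unfolding \<phi>_def using D1.smult_closed[OF _ \<phi>\<^sub>0(1)] r by simp
  then have \<phi>: "\<phi> \<in> mod_hom R P1 (regular_module R)" by (simp add: dual_simps(1))
  have \<phi>B: "\<phi> \<notin> ?B" using r by (simp add: \<phi>_def)

  \<comment> \<open>Otherwise the choice of \<open>r\<close> gives a nonzero idempotent
    \<open>\<alpha> m \<otimes> w\<close>. It is the value at \<open>m\<close> of the functional
    \<open>?g\<close>, so M would be projective.\<close>
  have \<phi>_trace: "\<alpha> m \<odot>\<^bsub>dual R P1\<^esub> \<phi> \<in> ?B"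
    if \<alpha>: "\<alpha> \<in> mod_hom R M (regular_module R)" and m: "m \<in> carrier M" for \<alpha> m
  proof (rule ccontr)
    have a: "\<alpha> m \<in> carrier R" using mod_hom_closed[OF \<alpha> m] by simp
    assume "\<alpha> m \<odot>\<^bsub>dual R P1\<^esub> \<phi> \<notin> ?B"
    moreover have "\<alpha> m \<odot>\<^bsub>dual R P1\<^esub> \<phi> = (r \<otimes> \<alpha> m) \<odot>\<^bsub>dual R P1\<^esub> \<phi>\<^sub>0"
      using D1.smult_assoc1[of "\<alpha> m" r \<phi>\<^sub>0] a r(1) \<phi>\<^sub>0(1) by (simp add: \<phi>_def)
    ultimately obtain w where w: "w \<in> carrier R" "(\<alpha> m \<otimes> w) \<otimes> (\<alpha> m \<otimes> w) = \<alpha> m \<otimes> w" "\<alpha> m \<otimes> w \<noteq> \<zero>"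
      using min[OF a] by auto
    let ?g = "\<lambda>x\<in>carrier M. \<alpha> x \<odot>\<^bsub>regular_module R\<^esub> w"
    have "?g \<in> mod_hom R M (regular_module R)"
      by (rule smult_left_hom[OF M RegR \<alpha>]) (simp add: w(1))
    moreover have "?g m = \<alpha> m \<otimes> w" using m by simp
    ultimately have "projective R M"
      using w(2,3) by (intro idempotent_value_projective[OF M ind _ m, of ?g]) simp_all
    with nproj show False ..
  qed

  have \<phi>_ker: "\<phi> x \<odot>\<^bsub>M\<^esub> m = \<zero>\<^bsub>M\<^esub>"
    if x: "x \<in> carrier P1" and fx: "f x = \<zero>\<^bsub>P0\<^esub>" and m: "m \<in> carrier M" for x m
  proof -
    have "m \<in> p ` carrier P0" using p(2) m by simp
    then obtain m' where m': "m' \<in> carrier P0" "p m' = m" by blast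
    let ?ev = "\<lambda>g\<in>carrier (dual R P0). g m'"
    \<comment> \<open>The map from the dual of \<open>P0\<close> to the transpose that will be
      extended along the dual of \<open>f\<close>.\<close>
    define h where "h = (\<lambda>g\<in>carrier (dual R P0). ?ev g \<odot>\<^bsub>?X\<^esub> \<pi> \<phi>)"
    have h: "h \<in> mod_hom ?S (dual R P0) ?X"
      unfolding h_def
      by (rule smult_left_hom[OF D0 X eval_hom[OF P0 m'(1)] mod_hom_closed[OF \<pi>(1) \<phi>D]])
    have gm': "g m' \<in> carrier R" if "g \<in> carrier (dual R P0)" for g
      using that mod_hom_closed[OF _ m'(1), of g R "regular_module R"] by (simp add: dual_simps(1))
    have h_app: "h g = \<pi> (g m' \<odot>\<^bsub>dual R P1\<^esub> \<phi>)" if g: "g \<in> carrier (dual R P0)" for g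
      using g gm'[OF g] \<phi>D by (simp add: h_def mod_hom_smult[OF \<pi>(1)])
    have "h g = \<zero>\<^bsub>?X\<^esub>" if g: "g \<in> carrier (dual R P0)" and "?f g = \<zero>\<^bsub>dual R P1\<^esub>" for g
    proof -
      \<comment> \<open>If the dual of \<open>f\<close> kills \<open>g\<close>, then
        \<open>g\<close> vanishes on the kernel of \<open>p\<close> and comes from a functional on
        M, to which \<open>\<phi>_trace\<close> applies.\<close>
      have g0: "g y = \<zero>\<^bsub>regular_module R\<^esub>" if "y \<in> carrier P0" "p y = \<zero>\<^bsub>M\<^esub>" for y
      proof -
        have "y \<in> f ` carrier P1" unfolding fp using that by (simp add: a_kernel_iff)
        then obtain z where z: "z \<in> carrier P1" "y = f z" by blast
        then show ?thesis using f'_app[OF g z(1)] \<open>?f g = _\<close> by (simp add: dual_simps(2))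
      qed
      have gh: "g \<in> mod_hom R P0 (regular_module R)" using g by (simp add: dual_simps(1))
      obtain \<alpha> where \<alpha>: "\<alpha> \<in> mod_hom R M (regular_module R)" "\<And>y. y \<in> carrier P0 \<Longrightarrow> \<alpha> (p y) = g y"
        by (rule mod_hom_factor[OF P0 M RegR p gh], erule (1) g0) (rule that, blast+)
      have "g m' \<odot>\<^bsub>dual R P1\<^esub> \<phi> \<in> ?B" using \<phi>_trace[OF \<alpha>(1) m] \<alpha>(2)[OF m'(1)] m'(2) by simp
      then show ?thesis unfolding h_app[OF g] ker by (simp add: a_kernel_iff)
    qed
    with ext' h obtain K where K: "K \<in> mod_hom ?S (dual R P1) ?X"
      and hK: "\<And>g. g \<in> carrier (dual R P0) \<Longrightarrow> h g = K (?f g)"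
      unfolding ext_vanishes_def by (auto dest!: bspec[where x = h])

    let ?evx = "\<lambda>g\<in>carrier (dual R P1). g x"
    have ev0: "?evx g = \<zero>\<^bsub>regular_module ?S\<^esub>" if g: "g \<in> carrier (dual R P1)" "\<pi> g = \<zero>\<^bsub>?X\<^esub>" for g
    proof -
      have "g \<in> ?B" unfolding ker using g by (simp add: a_kernel_iff)
      then obtain g' where g': "g' \<in> carrier (dual R P0)" "g = ?f g'" by blast
      then have "g' \<in> mod_hom R P0 (regular_module R)" by (simp add: dual_simps(1))
      then show ?thesis using g(1) g' f'_app[OF g'(1) x] fx mod_hom_zero[OF P0 RegR] by simp
    qed
    obtain E where E: "E \<in> mod_hom ?S ?X (regular_module ?S)"
      and E\<pi>: "\<And>g. g \<in> carrier (dual R P1) \<Longrightarrow> E (\<pi> g) = ?evx g"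
      by (rule mod_hom_factor[OF D1 X Reg \<pi> eval_hom[OF P1 x]], erule (1) ev0) (rule that, blast+)
    \<comment> \<open>Reflexivity of \<open>P1\<close>, applied to the composite of \<open>K\<close>
      with the functional \<open>E\<close> that evaluation at \<open>x\<close> induces on the
      transpose.\<close>
    obtain l where l: "l \<in> carrier P1"
      and EK: "\<And>g. g \<in> mod_hom R P1 (regular_module R) \<Longrightarrow>
        (\<lambda>g\<in>carrier (dual R P1). E (K g)) g = g l"
      by (rule dual_basis_reflexive[OF db1 P1 mod_hom_composeI[OF D1 K E]]) (rule that, blast+)
    have \<phi>x: "\<phi> x \<in> carrier R" using mod_hom_closed[OF \<phi> x] by simp
    \<comment> \<open>Both sides are tested against all functionals on \<open>P0\<close>, which
      separate its points.\<close>
    have "f l = \<phi> x \<odot>\<^bsub>P0\<^esub> m'"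
    proof (rule dual_basis_separates[OF db0 P0 fc[OF l]])
      show "\<phi> x \<odot>\<^bsub>P0\<^esub> m' \<in> carrier P0" using \<phi>x m' by simp
      fix g assume g: "g \<in> mod_hom R P0 (regular_module R)"
      then have gD: "g \<in> carrier (dual R P0)" by (simp add: dual_simps(1))
      have fgD: "?f g \<in> carrier (dual R P1)" by (rule mod_hom_closed[OF f' gD])
      then have "g (f l) = E (K (?f g))"
        using EK[of "?f g"] f'_app[OF gD l] by (simp add: dual_simps(1))
      also have "\<dots> = E (\<pi> (g m' \<odot>\<^bsub>dual R P1\<^esub> \<phi>))" using hK[OF gD] h_app[OF gD] by simp
      also have "\<dots> = (g m' \<odot>\<^bsub>dual R P1\<^esub> \<phi>) x"
        using E\<pi> D1.smult_closed[OF _ \<phi>D] gm'[OF gD] by simp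
      also have "\<dots> = g (\<phi> x \<odot>\<^bsub>P0\<^esub> m')"
        using mod_hom_smult[OF g \<phi>x m'(1)] x by (simp add: dual_simps(4))
      finally show "g (f l) = g (\<phi> x \<odot>\<^bsub>P0\<^esub> m')" .
    qed
    moreover have "p (f l) = \<zero>\<^bsub>M\<^esub>" using fp l by (auto simp: a_kernel_iff set_eq_iff image_iff)
    ultimately show ?thesis using mod_hom_smult[OF p(1) \<phi>x m'(1)] m'(2) by simp
  qed

  \<comment> \<open>By \<open>\<phi>_ker\<close> the scalar \<open>\<phi> x\<close> annihilates M,
    so faithfulness makes it zero. The vanishing of Ext into the ring then puts
    \<open>\<phi>\<close> in \<open>?B\<close>.\<close>
  have "\<phi> x = \<zero>" if "x \<in> carrier P1" "f x = \<zero>\<^bsub>P0\<^esub>" for x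
    using faith \<phi>_ker[OF that] mod_hom_closed[OF \<phi> that(1)] unfolding faithful_def by auto
  with ext \<phi> obtain g where "g \<in> mod_hom R P0 (regular_module R)" "\<forall>z\<in>carrier P1. \<phi> z = g (f z)"
    unfolding ext_vanishes_def by (auto dest!: bspec[where x = \<phi>])
  then have "\<phi> \<in> ?B" by (rule BI[OF \<phi>])
  with \<phi>B show False ..
qed

section \<open>From projective presentations to dual bases and extension criteria\<close>

theorem proposition3p6:
  fixes \<Lambda> :: "('a, 'r) ring_scheme"
    and M :: "('a, 'b) module"
    and P0 :: "('a, 'c) module"
    and P1 :: "('a, 'd) module"
    and f :: "'d \<Rightarrow> 'c"
    and p :: "'c \<Rightarrow> 'b"
  assumes "artin_algebra \<Lambda>"
    and "left_module \<Lambda> M"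
    and "finitely_generated \<Lambda> M"
    and "faithful \<Lambda> M"
    and "indecomposable \<Lambda> M"
    and "minimal_projective_presentation \<Lambda> P1 f P0 p M"
  shows "(torsionless (opp_ring \<Lambda>) (transpose_module \<Lambda> P1 f P0) \<longleftrightarrow>
            trivial_group (Ext1 \<Lambda> M (regular_module \<Lambda>))) \<and>
         (torsionless (opp_ring \<Lambda>) (transpose_module \<Lambda> P1 f P0) \<and>
            trivial_group (Ext1 (opp_ring \<Lambda>) (transpose_module \<Lambda> P1 f P0) (transpose_module \<Lambda> P1 f P0)) \<longrightarrow>
          projective \<Lambda> M)"
proof -
  let ?X = "transpose_module \<Lambda> P1 f P0"
  note M = assms(2)
  interpret M: left_module \<Lambda> M by (rule M)
  have cover: "projective_cover \<Lambda> P0 p M"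
    "projective_cover \<Lambda> P1 f (P0\<lparr>carrier := a_kernel P0 M p\<rparr>)"
    and fg: "finitely_generated \<Lambda> P0" "finitely_generated \<Lambda> P1"
    using assms(6) by (auto simp: minimal_projective_presentation_def)
  have proj: "projective \<Lambda> P0" "projective \<Lambda> P1"
    and p: "p \<in> mod_hom \<Lambda> P0 M" "p ` carrier P0 = carrier M"
    and fK: "f \<in> mod_hom \<Lambda> P1 (P0\<lparr>carrier := a_kernel P0 M p\<rparr>)"
    and fp: "f ` carrier P1 = a_kernel P0 M p"
    using cover by (auto simp: projective_cover_def)
  have P0: "left_module \<Lambda> P0" and P1: "left_module \<Lambda> P1"
    using proj by (auto simp: projective_def)
  \<comment> \<open>The cover \<open>f\<close> maps onto the kernel of \<open>p\<close>; from here
    on it is a map into \<open>P0\<close>.\<close>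
  have f: "f \<in> mod_hom \<Lambda> P1 P0"
    using fK by (auto simp: mod_hom_def a_kernel_iff PiE_def Pi_def)
  obtain T0 :: "'c set" and q0 \<psi>0 where db0: "dual_basis \<Lambda> P0 T0 q0 \<psi>0"
    by (rule projective_dual_basis[OF proj(1) fg(1)])
  obtain T1 :: "'d set" and q1 \<psi>1 where db1: "dual_basis \<Lambda> P1 T1 q1 \<psi>1"
    by (rule projective_dual_basis[OF proj(2) fg(2)])
  have D0: "left_module (opp_ring \<Lambda>) (dual \<Lambda> P0)" and D1: "left_module (opp_ring \<Lambda>) (dual \<Lambda> P1)"
    by (rule dual_left_module P0 P1)+
  have X: "left_module (opp_ring \<Lambda>) ?X" by (rule transpose_left_module[OF P0 P1 f])
  obtain \<pi> where \<pi>: "\<pi> \<in> mod_hom (opp_ring \<Lambda>) (dual \<Lambda> P1) ?X" "\<pi> ` carrier (dual \<Lambda> P1) = carrier ?X"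
    and ker: "dual_map \<Lambda> P1 P0 f ` carrier (dual \<Lambda> P0) = a_kernel (dual \<Lambda> P1) ?X \<pi>"
    by (rule transpose_presentation[OF P1 P0 f]) (rule that)
  note tors = transpose_torsionless_iff[OF P1 P0 f db1 db0]
  have "torsionless (opp_ring \<Lambda>) ?X \<longleftrightarrow> trivial_group (Ext1 \<Lambda> M (regular_module \<Lambda>))"
    unfolding tors
    by (rule Ext1_trivial_iff_presentation[OF P1 P0 M regular_left_module[OF M.R.ring_axioms] db0 f p fp, symmetric])
  \<comment> \<open>The dual of \<open>P1\<close> inherits a dual basis and maps onto the transpose
    with kernel the image of the dual of \<open>f\<close>, so Ext of the transpose can be read off
    from this presentation.\<close>
  moreover have "trivial_group (Ext1 (opp_ring \<Lambda>) ?X ?X) \<longleftrightarrow>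
      ext_vanishes (opp_ring \<Lambda>) (dual \<Lambda> P0) (dual_map \<Lambda> P1 P0 f) (dual \<Lambda> P1) ?X"
    by (rule Ext1_trivial_iff_presentation[OF D0 D1 X X dual_basis_dual[OF db1 P1]
          dual_map_hom[OF P1 P0 f] \<pi> ker])
  ultimately show ?thesis
    using artin_algebra_ext_projective[OF assms(1) M assms(4,5) P1 P0 f p fp db1 db0] tors by blast
qed

end
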